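(* Let $\mathcal{P}=\mathcal{L}(G)$ be the line graph of a graph $G$, where $G$ is different from the seven exceptional graphs $J_1,\dots,J_7$ defined in the context. Then $\mathcal{P}$ is a $3$-polytope (i.e. planar and $3$-connected) if and only if $G$ is obtained from a cubic $3$-polytope by subdividing each edge at most once, and then adding at most one degree $1$ neighbour to each vertex of degree $3$.
   Context: All graphs are finite and simple (no loops or repeated edges). A graph is $k$-connected if it has at least $k+1$ vertices and removing any $k-1$ or fewer vertices leaves a connected graph. A graph is called a $3$-polytope if it is planar and $3$-connected. Cubic means $3$-regular. The line graph $\mathcal{L}(G)$ has vertex set $E(G)$, two distinct edges of $G$ being adjacent in $\mathcal{L}(G)$ iff they share an endpoint in $G$. Subdividing an edge $xy$ means deleting $xy$ and adding a new vertex $z$ with edges $xz, zy$. "Subdividing each edge at most once" means choosing any (possibly empty) subset of the edges of the cubic graph and subdividing each chosen edge exactly once. "Adding at most one degree $1$ neighbour to each vertex of degree $3$" means choosing any (possibly empty) subset of the degree $3$ vertices of the resulting graph and, for each chosen vertex $u$, adding one new vertex whose only neighbour is $u$. The seven exceptional graphs: $J_1$ is the star $K_{1,4}$; the other six, $J_2,\dots,J_7$, are the graphs obtained by taking $B$ to be either the diamond graph ($K_4$ minus one edge) or $K_{2,3}$, and attaching one new degree $1$ neighbour to each vertex in some subset (of size $0$, $1$ or $2$) of the two degree $3$ vertices of $B$ (three graphs up to isomorphism for each of the two choices of $B$).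
   Formalization: The graph G is additionally assumed to have no isolated vertices; without this the "only if" direction fails, e.g. for K_4 together with an isolated vertex, whose line graph is the octahedron. *)

theory Defs
  imports "HOL-Analysis.Analysis"
begin

text \<open>
  An undirected graph is a vertex set together with a set of edges, an edge being the
  two-element set of its endpoints. Loops and parallel edges are thus excluded.
\<close>

record 'a ugraph =
  uverts :: "'a set"
  uedges :: "'a set set"

definition simple_graph :: "'a ugraph \<Rightarrow> bool" where
  "simple_graph G \<longleftrightarrow>
     finite (uverts G) \<and> (\<forall>e\<in>uedges G. e \<subseteq> uverts G \<and> card e = 2)"

definition vdegree :: "'a ugraph \<Rightarrow> 'a \<Rightarrow> nat" where
  "vdegree G v = card {e \<in> uedges G. v \<in> e}"

definition cubic :: "'a ugraph \<Rightarrow> bool" where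
  "cubic G \<longleftrightarrow> (\<forall>v\<in>uverts G. vdegree G v = 3)"

definition graph_iso :: "'a ugraph \<Rightarrow> 'b ugraph \<Rightarrow> bool" where
  "graph_iso G H \<longleftrightarrow>
     (\<exists>f. bij_betw f (uverts G) (uverts H) \<and> uedges H = (\<lambda>e. f ` e) ` uedges G)"

definition delete_verts :: "'a ugraph \<Rightarrow> 'a set \<Rightarrow> 'a ugraph" where
  "delete_verts G S =
     \<lparr>uverts = uverts G - S, uedges = {e \<in> uedges G. e \<inter> S = {}}\<rparr>"

definition graph_connected :: "'a ugraph \<Rightarrow> bool" where
  "graph_connected G \<longleftrightarrow>
     (\<forall>u\<in>uverts G. \<forall>v\<in>uverts G. (u, v) \<in> {(x, y). {x, y} \<in> uedges G}\<^sup>*)"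

definition k_connected :: "nat \<Rightarrow> 'a ugraph \<Rightarrow> bool" where
  "k_connected k G \<longleftrightarrow>
     k + 1 \<le> card (uverts G) \<and>
     (\<forall>S\<subseteq>uverts G. card S < k \<longrightarrow> graph_connected (delete_verts G S))"

text \<open>
  Planarity is topological. A drawing places the vertices at distinct points of the plane and
  draws every edge as a (continuous, injective) arc between the points of its endpoints. An arc
  meets no other vertex, and two arcs meet only at the points of common endpoints.
\<close>

definition plane_drawing ::
    "'a ugraph \<Rightarrow> ('a \<Rightarrow> complex) \<Rightarrow> ('a set \<Rightarrow> real \<Rightarrow> complex) \<Rightarrow> bool" where
  "plane_drawing G p \<gamma> \<longleftrightarrow>
     inj_on p (uverts G) \<and>
     (\<forall>e\<in>uedges G.
        arc (\<gamma> e) \<and>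
        {pathstart (\<gamma> e), pathfinish (\<gamma> e)} = p ` e \<and>
        path_image (\<gamma> e) \<inter> p ` uverts G = p ` e) \<and>
     (\<forall>e\<in>uedges G. \<forall>f\<in>uedges G. e \<noteq> f \<longrightarrow>
        path_image (\<gamma> e) \<inter> path_image (\<gamma> f) = p ` (e \<inter> f))"

definition planar :: "'a ugraph \<Rightarrow> bool" where
  "planar G \<longleftrightarrow> (\<exists>p \<gamma>. plane_drawing G p \<gamma>)"

definition three_polytope :: "'a ugraph \<Rightarrow> bool" where
  "three_polytope G \<longleftrightarrow> planar G \<and> k_connected 3 G"

definition line_graph :: "'a ugraph \<Rightarrow> 'a set ugraph" where
  "line_graph G =
     \<lparr>uverts = uedges G,
      uedges = {{e, f} | e f. e \<in> uedges G \<and> f \<in> uedges G \<and> e \<noteq> f \<and> e \<inter> f \<noteq> {}}\<rparr>"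

text \<open>
  In the next two relations the new vertices are distinct fresh elements of the same type:
  \<open>z e\<close> is the vertex subdividing the edge \<open>e\<close>, for \<open>e\<close> in the chosen set \<open>S\<close>, and \<open>l u\<close> is
  the degree 1 neighbour attached to \<open>u\<close>, for \<open>u\<close> in the chosen set \<open>U\<close>.
\<close>

definition subdivides_edges_at_most_once :: "'a ugraph \<Rightarrow> 'a ugraph \<Rightarrow> bool" where
  "subdivides_edges_at_most_once H K \<longleftrightarrow>
     (\<exists>S z. S \<subseteq> uedges H \<and> inj_on z S \<and> z ` S \<inter> uverts H = {} \<and>
        K = \<lparr>uverts = uverts H \<union> z ` S,
             uedges = (uedges H - S) \<union> {{x, z e} | x e. e \<in> S \<and> x \<in> e}\<rparr>)"

definition adds_pendants_at_degree_3 :: "'a ugraph \<Rightarrow> 'a ugraph \<Rightarrow> bool" where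
  "adds_pendants_at_degree_3 K G \<longleftrightarrow>
     (\<exists>U l. U \<subseteq> {u \<in> uverts K. vdegree K u = 3} \<and>
        inj_on l U \<and> l ` U \<inter> uverts K = {} \<and>
        G = \<lparr>uverts = uverts K \<union> l ` U,
             uedges = uedges K \<union> {{u, l u} | u. u \<in> U}\<rparr>)"

definition complete_bipartite :: "nat \<Rightarrow> nat \<Rightarrow> nat ugraph" where
  "complete_bipartite m n =
     \<lparr>uverts = {..<m + n}, uedges = {{i, j} | i j. i < m \<and> m \<le> j \<and> j < m + n}\<rparr>"

definition diamond :: "nat ugraph" where
  "diamond = \<lparr>uverts = {0, 1, 2, 3}, uedges = {{0, 1}, {0, 2}, {0, 3}, {1, 2}, {1, 3}}\<rparr>"

definition exceptional :: "'a ugraph \<Rightarrow> bool" where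
  "exceptional G \<longleftrightarrow>
     graph_iso G (complete_bipartite 1 4) \<or>
     (\<exists>B. simple_graph B \<and>
          (graph_iso B diamond \<or> graph_iso B (complete_bipartite 2 3)) \<and>
          adds_pendants_at_degree_3 B G)"

end

theory Submission
  imports Defs "HOL-Complex_Analysis.Riemann_Mapping"
begin

text \<open>
  Suppose \<open>G\<close> arises from a cubic 3-polytope \<open>H\<close>. A drawing of the line graph is obtained by replacing every
  vertex of \<open>H\<close> by a small triangle and contracting the arcs of the edges that are not subdivided, and a separation of
  the line graph by at most two vertices would give a cut of \<open>H\<close> with at most two edges.

  Conversely let the line graph be planar and 3-connected. Four edges at a common vertex \<open>v\<close> form a drawn
  \<open>K\<^sub>4\<close>, and no connected set off this drawing has all four corners in its closure. Hence degrees are at most 4, and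
  at a vertex of degree 4 every component of the remaining edges is attached to exactly three of the four edges, so
  exactly one of them is pendant (or \<open>G\<close> is \<open>K\<^sub>1\<^sub>,\<^sub>4\<close>). Minimum degree 3 in the line graph makes the vertices
  of degree 2 independent and puts leaves next to vertices of degree 4 only. Deleting the leaves and suppressing the
  vertices of degree 2 gives \<open>H\<close>; a multiple edge would force one of the exceptional graphs. For cubic
  graphs 3-connectedness is about edge cuts, which are read off from the line graph, and \<open>H\<close> is planar since the
  line graph contains a subdivision of it.
\<close>

subsection \<open>Topological discs and planarity\<close>

text \<open>Planarity is given by arcs in the plane, so contracting an edge is not a combinatorial
  operation. \<open>planar_of_model\<close> is the substitute: a vertex may be spread over a compact
  connected set with connected complement. The fact about the corners of a drawn
  \<open>K\<^sub>4\<close> is the only obstruction to planarity that is used; it stands in for the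
  non-planarity of \<open>K\<^sub>5\<close> and its contractions. The six exceptions built from the
  diamond and \<open>K\<^sub>2\<^sub>,\<^sub>3\<close> have one source: without their leaves and
  with the vertices of degree 2 suppressed they become two vertices joined by three parallel edges,
  a cubic multigraph that is not simple. Two parallel links leave one further edge at each of their
  ends, and 3-connectedness closes the graph up there, so no other multigraph occurs. Drawing
  \<open>H\<close> inside the line graph meets another obstacle: a vertex of \<open>H\<close>
  corresponds to a clique and not to a point. Instead of contracting it, one incident edge is chosen
  for every vertex, no edge twice; this is possible because every cut of \<open>H\<close> has at
  least two edges.\<close>

text \<open>The part of the plane outside \<open>W\<close> is connected up to infinity by paths avoiding \<open>T\<close>; the component of \<open>T\<close>
  in the complement of the result is simply connected, so the Riemann mapping theorem applies.\<close>

lemma disc_neighbourhood: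
  fixes T W :: "complex set"
  assumes T: "compact T" "connected T" "T \<noteq> {}" "connected (- T)"
    and W: "open W" "T \<subseteq> W"
  obtains U where "open U" "T \<subseteq> U" "U \<subseteq> W" "U homeomorphic ball (0::complex) 1"
proof -
  obtain M where M: "M > 0" "T \<subseteq> ball 0 M"
    using T(1) bounded_subset_ballD compact_imp_bounded by blast
  let ?R0 = "cball 0 M - W"
  have cR0: "compact ?R0" using W(1) by (simp add: compact_diff)
  have opT: "open (- T)" using T(1) by (simp add: compact_imp_closed open_Compl)
  have "\<exists>e>0. cball x e \<subseteq> - T" if "x \<in> - T" for x
    using opT that open_contains_cball by metis
  then obtain e where e: "\<And>x. x \<in> - T \<Longrightarrow> e x > 0 \<and> cball x (e x) \<subseteq> - T" by metis
  have R0T: "?R0 \<subseteq> - T" using W(2) by auto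
  obtain F where F: "finite F" "F \<subseteq> ?R0" "?R0 \<subseteq> (\<Union>x\<in>F. ball x (e x))"
  proof (rule compactE_image[OF cR0, of ?R0 "\<lambda>x. ball x (e x)"])
    show "?R0 \<subseteq> (\<Union>c\<in>?R0. ball c (e c))" using e R0T centre_in_ball by blast
  qed (auto)
  define m where "m = complex_of_real M"
  have mT: "m \<in> - T" using M by (auto simp: m_def)
  have pc: "path_connected (- T)" using opT T(4) by (simp add: connected_open_path_connected)
  have "\<exists>g. path g \<and> path_image g \<subseteq> - T \<and> pathstart g = x \<and> pathfinish g = m" if "x \<in> - T" for x
    using pc that mT unfolding path_connected_def by blast
  then obtain g where g: "\<And>x. x \<in> - T \<Longrightarrow> path (g x) \<and> path_image (g x) \<subseteq> - T \<and> pathstart (g x) = x \<and> pathfinish (g x) = m"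
    by metis
  let ?O = "- ball (0::complex) M"
  \<comment> \<open>\<open>R\<close> is closed and connected, contains the complement of
    \<open>W\<close> and misses \<open>T\<close>: finitely many closed balls cover
    \<open>?R0\<close>, and each is tied by a path off \<open>T\<close> to the point
    \<open>m\<close> of the unbounded part \<open>?O\<close>. Connectedness of \<open>R\<close>
    keeps the components of its complement free of holes.\<close>
  define R where "R = ?O \<union> (\<Union>x\<in>F. cball x (e x) \<union> path_image (g x))"
  have FT: "\<And>x. x \<in> F \<Longrightarrow> x \<in> - T" using F(2) R0T by auto
  have clR: "closed R" unfolding R_def using F(1) FT g
    by (intro closed_Un closed_UN closed_path_image ballI) (auto simp: closed_Compl)
  have conO: "connected ?O" by (rule connected_complement_bounded_convex) auto
  have mO: "m \<in> ?O" using M by (simp add: m_def)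
  have coR: "connected R"
  proof -
    have "connected (?O \<union> \<Union>((\<lambda>x. (cball x (e x) \<union> path_image (g x)) \<union> ?O) ` F))"
    proof (cases "F = {}")
      case False
      have "connected (\<Union>((\<lambda>x. (cball x (e x) \<union> path_image (g x)) \<union> ?O) ` F))"
      proof (rule connected_Union)
        fix s assume "s \<in> (\<lambda>x. (cball x (e x) \<union> path_image (g x)) \<union> ?O) ` F"
        then obtain x where x: "x \<in> F" "s = (cball x (e x) \<union> path_image (g x)) \<union> ?O" by auto
        have "m \<in> path_image (g x)" "x \<in> path_image (g x)" "x \<in> cball x (e x)"
          using g[OF FT[OF x(1)]] e[OF FT[OF x(1)]] pathfinish_in_path_image pathstart_in_path_image by (metis, metis, auto)
        moreover have "connected (cball x (e x))" "connected (path_image (g x))"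
          using g[OF FT[OF x(1)]] by (auto intro: connected_path_image)
        ultimately show "connected s"
          unfolding x(2) using mO conO by (metis (no_types, lifting) Int_iff Un_iff connected_Un empty_iff)
      next
        show "\<Inter>((\<lambda>x. (cball x (e x) \<union> path_image (g x)) \<union> ?O) ` F) \<noteq> {}"
          using mO by blast
      qed
      then show ?thesis using False by (simp add: Un_absorb1 subset_iff)
    qed (simp add: conO)
    moreover have "?O \<union> \<Union>((\<lambda>x. (cball x (e x) \<union> path_image (g x)) \<union> ?O) ` F) = R"
      unfolding R_def by auto
    ultimately show ?thesis by simp
  qed
  have RT: "T \<subseteq> - R" using M(2) e g FT unfolding R_def by blast
  have RW: "- R \<subseteq> W"
  proof
    fix x assume x: "x \<in> - R"
    then have "x \<in> cball 0 M" "x \<notin> (\<Union>x\<in>F. ball x (e x))" unfolding R_def by auto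
    then show "x \<in> W" using F(3) by blast
  qed
  obtain t where t: "t \<in> T" using T(3) by auto
  let ?U = "connected_component_set (- R) t"
  have U: "?U \<in> components (- R)" using t RT by (auto simp: components_def)
  have oU: "open ?U" using clR by (simp add: open_Compl open_connected_component)
  have TU: "T \<subseteq> ?U" using T(2) t RT by (simp add: connected_component_maximal)
  have subU: "?U \<subseteq> - R" by (simp add: connected_component_subset)
  have "connected (- ?U)"
    using component_complement_connected[OF coR U] by simp
  moreover have "bounded ?U"
    by (rule bounded_subset[of "ball 0 M"]) (use subU in \<open>auto simp: R_def\<close>)
  ultimately have "simply_connected ?U" using simply_connected_iff_simple[OF oU] by simp
  then have "?U homeomorphic ball (0::complex) 1"
    using simply_connected_eq_homeomorphic_to_disc[OF oU] TU t by auto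
  with that[of ?U] oU TU subU RW show ?thesis by blast
qed

text \<open>\<open>t0\<close> is the last time in \<open>D1\<close> and \<open>t1\<close> the first
  time from \<open>t0\<close> on in \<open>D2\<close>; both exist because the two sets are closed.
  From a point of the open set \<open>O1\<close> the path would stay in \<open>D1\<close> a little
  longer, and similarly for \<open>O2\<close>, so the new ends lie in \<open>D1 - O1\<close> and
  \<open>D2 - O2\<close>.\<close>

lemma truncate_arc:
  fixes \<gamma> :: "real \<Rightarrow> complex"
  assumes \<gamma>: "arc \<gamma>" "pathstart \<gamma> \<in> O1" "pathfinish \<gamma> \<in> O2"
    and op: "open O1" "open O2" "O1 \<subseteq> D1" "O2 \<subseteq> D2" "closed D1" "closed D2" "D1 \<inter> D2 = {}"
  obtains A where "arc A" "path_image A \<subseteq> path_image \<gamma>"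
    "pathstart A \<in> D1 - O1" "pathfinish A \<in> D2 - O2"
    "path_image A \<inter> D1 = {pathstart A}" "path_image A \<inter> D2 = {pathfinish A}"
proof -
  have cont: "continuous_on {0..1} \<gamma>" and inj: "inj_on \<gamma> {0..1}"
    using \<gamma>(1) by (auto simp: arc_def path_def)
  have g0: "\<gamma> 0 \<in> O1" and g1: "\<gamma> 1 \<in> O2" using \<gamma> by (auto simp: pathstart_def pathfinish_def)
  have "compact ({0..1} \<inter> \<gamma> -` D1)"
    using continuous_closed_preimage[OF cont _ op(5)] bounded_subset[of "{0..1::real}"]
    by (auto simp: compact_eq_bounded_closed)
  then obtain t0 where t0: "t0 \<in> {0..1}" "\<gamma> t0 \<in> D1" "\<And>t. t \<in> {0..1} \<Longrightarrow> \<gamma> t \<in> D1 \<Longrightarrow> t \<le> t0"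
    using compact_attains_sup[of "{0..1} \<inter> \<gamma> -` D1"] g0 op(3) by fastforce
  have t01: "t0 < 1" using t0 g1 op by (metis IntI atLeastAtMost_iff empty_iff order_le_imp_less_or_eq subsetD)
  have "compact ({t0..1} \<inter> \<gamma> -` D2)"
    using continuous_closed_preimage[OF continuous_on_subset[OF cont] _ op(6), of "{t0..1}"]
      bounded_subset[of "{t0..1::real}"] t0(1)
    by (auto simp: compact_eq_bounded_closed)
  moreover have "1 \<in> {t0..1} \<inter> \<gamma> -` D2" using g1 op(4) t01 by auto
  ultimately obtain t1 where t1: "t1 \<in> {t0..1}" "\<gamma> t1 \<in> D2" "\<And>t. t \<in> {t0..1} \<Longrightarrow> \<gamma> t \<in> D2 \<Longrightarrow> t1 \<le> t"
    using compact_attains_inf[of "{t0..1} \<inter> \<gamma> -` D2"] by blast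
  have lt: "t0 < t1" using t0 t1 op(7) by (metis IntI atLeastAtMost_iff empty_iff order_le_imp_less_or_eq)
  have near: "\<exists>d>0. \<forall>s\<in>{0..1}. dist s t < d \<longrightarrow> \<gamma> s \<in> Q" if tQ: "t \<in> {0..1}" "open Q" "\<gamma> t \<in> Q" for t Q
  proof -
    obtain \<epsilon> where \<epsilon>: "\<epsilon> > 0" "ball (\<gamma> t) \<epsilon> \<subseteq> Q" using openE[OF tQ(2,3)] by metis
    obtain d where "d > 0" "\<forall>s\<in>{0..1}. dist s t < d \<longrightarrow> dist (\<gamma> s) (\<gamma> t) < \<epsilon>"
      using cont[unfolded continuous_on_iff, rule_format, OF tQ(1) \<epsilon>(1)] by metis
    then show ?thesis using \<epsilon>(2) by (metis dist_commute mem_ball subsetD)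
  qed
  have n0: "\<gamma> t0 \<notin> O1"
  proof
    assume "\<gamma> t0 \<in> O1"
    then obtain d where d: "d > 0" "\<And>s. s \<in> {0..1} \<Longrightarrow> dist s t0 < d \<Longrightarrow> \<gamma> s \<in> O1"
      using near[OF t0(1) op(1)] by blast
    let ?s = "min 1 (t0 + d/2)"
    have "?s \<in> {0..1}" "dist ?s t0 < d" "?s > t0" using t0(1) t01 d(1) by (auto simp: dist_real_def)
    then show False using d(2)[of ?s] t0(3)[of ?s] op(3) by auto
  qed
  have n1: "\<gamma> t1 \<notin> O2"
  proof
    assume "\<gamma> t1 \<in> O2"
    then obtain d where d: "d > 0" "\<And>s. s \<in> {0..1} \<Longrightarrow> dist s t1 < d \<Longrightarrow> \<gamma> s \<in> O2"
      using near[of t1, OF _ op(2)] t0(1) t1(1) by auto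
    let ?s = "max t0 (t1 - d/2)"
    have "?s \<in> {0..1}" "dist ?s t1 < d" "?s < t1" using t0(1) t1(1) lt d(1) by (auto simp: dist_real_def)
    then show False using d(2)[of ?s] t1(3)[of ?s] op(4) by auto
  qed
  have im: "path_image (subpath t0 t1 \<gamma>) = \<gamma> ` {t0..t1}" using lt by (simp add: path_image_subpath)
  have r: "t \<in> {0..1}" if "t \<in> {t0..t1}" for t using that t0 t1 by auto
  show ?thesis
  proof (rule that[of "subpath t0 t1 \<gamma>"])
    show "arc (subpath t0 t1 \<gamma>)" using \<gamma>(1) t0 t1 lt by (intro arc_subpath_arc) auto
    show "path_image (subpath t0 t1 \<gamma>) \<subseteq> path_image \<gamma>"
      using t0 t1 by (intro path_image_subpath_subset) auto
    have "\<gamma> t = \<gamma> t0" if "t \<in> {t0..t1}" "\<gamma> t \<in> D1" for t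
      using t0(3)[OF r[OF that(1)] that(2)] that(1) by (simp add: order_antisym)
    then show "path_image (subpath t0 t1 \<gamma>) \<inter> D1 = {pathstart (subpath t0 t1 \<gamma>)}"
      unfolding im using t0 lt by (auto intro!: image_eqI[of _ _ t0])
    have "\<gamma> t = \<gamma> t1" if "t \<in> {t0..t1}" "\<gamma> t \<in> D2" for t
      using t1(3)[of t] that t1(1) by (simp add: order_antisym)
    then show "path_image (subpath t0 t1 \<gamma>) \<inter> D2 = {pathfinish (subpath t0 t1 \<gamma>)}"
      unfolding im using t1 lt by (auto intro!: image_eqI[of _ _ t1])
  qed (use t0 t1 n0 n1 in auto)
qed

text \<open>The homeomorphism carries a closed disc of radius \<open>r < 1\<close> containing the
  image of \<open>T\<close> back into \<open>U\<close>. The spokes are the images of its radii, so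
  two of them share only the image \<open>c\<close> of the centre, and \<open>D - Q\<close> is the
  image of the bounding circle.\<close>

lemma disc_spokes:
  fixes T U :: "complex set"
  assumes U: "open U" "U homeomorphic ball (0::complex) 1" and T: "compact T" "T \<subseteq> U"
  obtains Q D c \<sigma> where "open Q" "compact D" "T \<subseteq> Q" "Q \<subseteq> D" "D \<subseteq> U" "c \<in> Q"
    "\<And>q. q \<in> D - Q \<Longrightarrow> arc (\<sigma> q) \<and> pathstart (\<sigma> q) = c \<and> pathfinish (\<sigma> q) = q \<and>
        path_image (\<sigma> q) \<subseteq> D \<and> path_image (\<sigma> q) \<inter> (D - Q) = {q}"
    "\<And>q q'. q \<in> D - Q \<Longrightarrow> q' \<in> D - Q \<Longrightarrow> q \<noteq> q' \<Longrightarrow> path_image (\<sigma> q) \<inter> path_image (\<sigma> q') = {c}"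
proof -
  obtain h k :: "complex \<Rightarrow> complex" where hk: "homeomorphism U (ball 0 1) h k" using U(2) unfolding homeomorphic_def by blast
  have cT: "compact (h ` T)"
    using T hk by (meson compact_continuous_image continuous_on_subset homeomorphism_cont1)
  have "h ` T \<subseteq> ball 0 1" using T(2) hk by (metis homeomorphism_image1 image_mono)
  then obtain r where r: "0 < r" "r < 1" "h ` T \<subseteq> ball 0 r"
  proof (cases "T = {}")
    case False
    obtain z where z: "z \<in> h ` T" "\<And>w. w \<in> h ` T \<Longrightarrow> norm w \<le> norm z"
      using continuous_attains_sup[OF cT, of norm] False by (auto intro: continuous_intros)
    have "norm z < 1" using z(1) \<open>h ` T \<subseteq> ball 0 1\<close> by auto
    then obtain r where "norm z < r" "r < 1" using dense by blast
    then show ?thesis using z(2) by (intro that[of r]) (auto, smt (verit) norm_ge_zero, force)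
  qed (use that[of "1/2"] in auto)
  define Q where "Q = k ` ball 0 r"
  define D where "D = k ` cball 0 r"
  define \<sigma> where "\<sigma> q = k \<circ> linepath 0 (h q)" for q
  have kinj: "inj_on k (ball 0 1)" using hk unfolding homeomorphism_def inj_on_def by metis
  have sub: "ball 0 r \<subseteq> ball (0::complex) 1" "cball 0 r \<subseteq> ball (0::complex) 1" using r by auto
  have kU: "k ` ball 0 1 = U" and hk': "\<And>w. w \<in> ball 0 1 \<Longrightarrow> h (k w) = w"
    and kh: "\<And>x. x \<in> U \<Longrightarrow> k (h x) = x" and hU: "h ` U = ball 0 1"
    and ch: "continuous_on U h" and ck: "continuous_on (ball 0 1) k"
    using hk unfolding homeomorphism_def by auto
  have QU: "Q = U \<inter> h -` ball 0 r"
  proof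
    show "Q \<subseteq> U \<inter> h -` ball 0 r" unfolding Q_def using kU hk' sub by auto
    show "U \<inter> h -` ball 0 r \<subseteq> Q" unfolding Q_def using kh by force
  qed
  have DQ: "D - Q = k ` sphere 0 r"
    unfolding D_def Q_def using inj_on_image_set_diff[OF kinj, of "cball 0 r" "ball 0 r"] sub(2)
    by (metis Diff_subset cball_diff_eq_sphere order_trans ball_subset_cball)
  have spoke: "arc (\<sigma> q)" "pathstart (\<sigma> q) = k 0" "pathfinish (\<sigma> q) = q"
    "path_image (\<sigma> q) = k ` closed_segment 0 (h q)" "h q \<in> sphere 0 r"
    "closed_segment 0 (h q) \<subseteq> cball 0 r" "closed_segment 0 (h q) \<inter> sphere 0 r = {h q}"
    if q: "q \<in> D - Q" for q
  proof -
    obtain w where w: "w \<in> sphere 0 r" "q = k w" using q DQ by auto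
    then have hq: "h q = w" using hk' sub by auto
    then show hs: "h q \<in> sphere 0 r" using w by simp
    show seg: "closed_segment 0 (h q) \<subseteq> cball 0 r"
      by (rule closed_segment_subset) (use hs r in auto)
    have "t *\<^sub>R h q \<in> sphere 0 r \<Longrightarrow> 0 \<le> t \<Longrightarrow> t *\<^sub>R h q = h q" for t using hs r by auto
    then show "closed_segment 0 (h q) \<inter> sphere 0 r = {h q}" using hs ends_in_segment(2)[of "h q" 0] by (auto simp: closed_segment_def)
    show "pathstart (\<sigma> q) = k 0" "pathfinish (\<sigma> q) = q" "path_image (\<sigma> q) = k ` closed_segment 0 (h q)"
      using hq w by (auto simp: \<sigma>_def pathstart_compose pathfinish_compose path_image_compose)
    show "arc (\<sigma> q)"
    proof -
      have "arc (linepath 0 (h q))" using hs r by (intro arc_linepath) auto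
      moreover have "path_image (linepath 0 (h q)) \<subseteq> ball 0 1" using seg sub by auto
      ultimately show ?thesis unfolding \<sigma>_def arc_def
        by (metis comp_inj_on continuous_on_subset[OF ck] inj_on_subset[OF kinj] path_continuous_image path_image_def)
    qed
  qed
  show ?thesis
  proof (rule that[of Q D "k 0" \<sigma>])
    show "open Q" unfolding QU by (intro continuous_open_preimage ch U) auto
    show "compact D" unfolding D_def
      by (intro compact_continuous_image continuous_on_subset[OF ck] sub) auto
    show "T \<subseteq> Q" unfolding QU using T r by auto
    show "Q \<subseteq> D" unfolding Q_def D_def by auto
    show "D \<subseteq> U" unfolding D_def using kU sub by auto
    show "k 0 \<in> Q" unfolding Q_def using r by auto
    show "arc (\<sigma> q) \<and> pathstart (\<sigma> q) = k 0 \<and> pathfinish (\<sigma> q) = q \<and>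
        path_image (\<sigma> q) \<subseteq> D \<and> path_image (\<sigma> q) \<inter> (D - Q) = {q}" if q: "q \<in> D - Q" for q
    proof -
      have qU: "q \<in> U" using q kU sub unfolding D_def by auto
      have "path_image (\<sigma> q) \<inter> (D - Q) = k ` (closed_segment 0 (h q) \<inter> sphere 0 r)"
        unfolding spoke(4)[OF q] DQ using spoke(6)[OF q] sub
        by (intro inj_on_image_Int[OF kinj, symmetric]) auto
      also have "\<dots> = {q}" using spoke(7)[OF q] kh[OF qU] by simp
      finally show ?thesis using spoke[OF q] unfolding D_def by blast
    qed
    show "path_image (\<sigma> q) \<inter> path_image (\<sigma> q') = {k 0}" if q: "q \<in> D - Q" "q' \<in> D - Q" "q \<noteq> q'" for q q'
    proof -
      have "h q \<noteq> h q'" using q kU sub kh unfolding D_def by (metis DiffD1 image_mono subsetD)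
      have "closed_segment 0 (h q) \<inter> closed_segment 0 (h q') = {0}"
      proof -
        have "s *\<^sub>R h q = 0" if "s *\<^sub>R h q = t *\<^sub>R h q'" "0 \<le> s" "0 \<le> t" for s t
        proof -
          have "norm (s *\<^sub>R h q) = norm (t *\<^sub>R h q')" using that by simp
          then have "s = t" using spoke(5)[OF q(1)] spoke(5)[OF q(2)] that(2,3) r(1) by simp
          then show ?thesis using that(1) \<open>h q \<noteq> h q'\<close> by auto
        qed
        then show ?thesis by (auto simp: closed_segment_def)
      qed
      then show ?thesis unfolding spoke(4)[OF q(1)] spoke(4)[OF q(2)]
        using inj_on_image_Int[OF kinj, of "closed_segment 0 (h q)" "closed_segment 0 (h q')"]
          spoke(6)[OF q(1)] spoke(6)[OF q(2)] sub by force
    qed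
  qed
qed

lemma simple_graph_edgeE:
  assumes "simple_graph G" "e \<in> uedges G"
  obtains x y where "e = {x, y}" "x \<noteq> y" "x \<in> uverts G" "y \<in> uverts G"
  using assms unfolding simple_graph_def by (metis card_2_iff insert_subset)

text \<open>A planarity criterion in the style of minor models: every vertex is spread over a set \<open>T x\<close>. Each
  \<open>T x\<close> is fattened to a disc, the arcs are cut at their last exit from the disc at one end and at their
  first entry into the disc at the other, and inside a disc they are continued along spokes.\<close>

lemma planar_of_model:
  fixes X :: "'b ugraph" and T :: "'b \<Rightarrow> complex set"
  assumes X: "simple_graph X"
    and T: "\<And>x. x \<in> uverts X \<Longrightarrow> compact (T x) \<and> connected (T x) \<and> T x \<noteq> {} \<and> connected (- T x)"
    and disj: "\<And>x y. x \<in> uverts X \<Longrightarrow> y \<in> uverts X \<Longrightarrow> x \<noteq> y \<Longrightarrow> T x \<inter> T y = {}"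
    and \<Gamma>: "\<And>e. e \<in> uedges X \<Longrightarrow> arc (\<Gamma> e) \<and>
          (\<exists>x y. e = {x, y} \<and> pathstart (\<Gamma> e) \<in> T x \<and> pathfinish (\<Gamma> e) \<in> T y)"
    and off: "\<And>e z. e \<in> uedges X \<Longrightarrow> z \<in> uverts X \<Longrightarrow> z \<notin> e \<Longrightarrow> path_image (\<Gamma> e) \<inter> T z = {}"
    and meet: "\<And>e f. e \<in> uedges X \<Longrightarrow> f \<in> uedges X \<Longrightarrow> e \<noteq> f \<Longrightarrow>
          path_image (\<Gamma> e) \<inter> path_image (\<Gamma> f) \<subseteq> (\<Union>x\<in>e \<inter> f. T x)"
  shows "planar X"
proof -
  let ?V = "uverts X" and ?E = "uedges X"
  have finV: "finite ?V" and finE: "finite ?E" and EV: "\<And>e x. e \<in> ?E \<Longrightarrow> x \<in> e \<Longrightarrow> x \<in> ?V"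
    using X finite_subset[of ?E "Pow ?V"] unfolding simple_graph_def by auto
  \<comment> \<open>\<open>B x\<close> is all that \<open>T x\<close> has to keep away from: the
    sets of the other vertices and the arcs of the edges not at \<open>x\<close>.\<close>
  define B where "B x = (\<Union>y\<in>?V - {x}. T y) \<union> (\<Union>e\<in>{e \<in> ?E. x \<notin> e}. path_image (\<Gamma> e))" for x
  have "\<exists>d>0. \<forall>s\<in>T x. \<forall>t\<in>B x. d \<le> dist s t" if x: "x \<in> ?V" for x
  proof (rule separate_compact_closed)
    show "compact (T x)" using T x by blast
    show "closed (B x)" unfolding B_def
      using finV finE T \<Gamma> by (intro closed_Un closed_UN) (auto intro: compact_imp_closed closed_arc_image)
    show "T x \<inter> B x = {}" unfolding B_def using disj off x by blast
  qed
  then obtain d where d: "\<And>x. x \<in> ?V \<Longrightarrow> d x > 0 \<and> (\<forall>s\<in>T x. \<forall>t\<in>B x. d x \<le> dist s t)" by metis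
  \<comment> \<open>Half of the distance suffices for disjointness: a common point of
    \<open>W x\<close> and \<open>W y\<close> would bring \<open>T x\<close> and \<open>T y\<close>
    closer than the mean of \<open>d x\<close> and \<open>d y\<close>, while their distance is at
    least either of them.\<close>
  define W where "W x = (\<Union>t\<in>T x. ball t (d x / 2))" for x
  have oW: "open (W x)" for x unfolding W_def by auto
  have TW: "T x \<subseteq> W x" if "x \<in> ?V" for x unfolding W_def using d[OF that] by force
  have W\<Gamma>: "W x \<inter> path_image (\<Gamma> e) = {}" if "x \<in> ?V" "e \<in> ?E" "x \<notin> e" for x e
  proof (rule ccontr)
    assume "W x \<inter> path_image (\<Gamma> e) \<noteq> {}"
    then obtain t z where "t \<in> T x" "z \<in> path_image (\<Gamma> e)" "dist t z < d x / 2" unfolding W_def by auto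
    moreover have "z \<in> B x" unfolding B_def using that calculation by auto
    ultimately show False using d[OF that(1)] by fastforce
  qed
  have WW: "W x \<inter> W y = {}" if "x \<in> ?V" "y \<in> ?V" "x \<noteq> y" for x y
  proof (rule ccontr)
    assume "W x \<inter> W y \<noteq> {}"
    then obtain s t z where st: "s \<in> T x" "t \<in> T y" "dist s z < d x / 2" "dist t z < d y / 2" unfolding W_def by auto
    have "t \<in> B x" "s \<in> B y" unfolding B_def using that st by auto
    then have "d x \<le> dist s t" "d y \<le> dist t s" using d that st by auto
    then show False using st(3,4) dist_triangle2[of s t z] by (simp add: dist_commute)
  qed
  define P where "P x Q D c \<sigma> \<longleftrightarrow> (open Q \<and> compact D \<and> T x \<subseteq> Q \<and> Q \<subseteq> D \<and> D \<subseteq> W x \<and> c \<in> Q \<and>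
    (\<forall>q \<in> D - Q. arc (\<sigma> q) \<and> pathstart (\<sigma> q) = c \<and> pathfinish (\<sigma> q) = q \<and>
        path_image (\<sigma> q) \<subseteq> D \<and> path_image (\<sigma> q) \<inter> (D - Q) = {q}) \<and>
    (\<forall>q \<in> D - Q. \<forall>q' \<in> D - Q. q \<noteq> q' \<longrightarrow> path_image (\<sigma> q) \<inter> path_image (\<sigma> q') = {c}))" for x Q D c and \<sigma> :: "complex \<Rightarrow> real \<Rightarrow> complex"
  have "\<exists>Q D c \<sigma>. P x Q D c \<sigma>" if x: "x \<in> ?V" for x
  proof -
    obtain U where U: "open U" "T x \<subseteq> U" "U \<subseteq> W x" "U homeomorphic ball (0::complex) 1"
      using disc_neighbourhood[of "T x" "W x"] T[OF x] oW TW[OF x] by metis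
    show ?thesis
    proof (rule disc_spokes[OF U(1,4) _ U(2)])
      show "compact (T x)" using T[OF x] by blast
      fix Q D c \<sigma>
      assume a: "open Q" "compact D" "T x \<subseteq> Q" "Q \<subseteq> D" "D \<subseteq> U" "c \<in> Q"
        and b: "\<And>q. q \<in> D - Q \<Longrightarrow> arc (\<sigma> q) \<and> pathstart (\<sigma> q) = c \<and> pathfinish (\<sigma> q) = q \<and>
          path_image (\<sigma> q) \<subseteq> D \<and> path_image (\<sigma> q) \<inter> (D - Q) = {q}"
        and c: "\<And>q q'. q \<in> D - Q \<Longrightarrow> q' \<in> D - Q \<Longrightarrow> q \<noteq> q' \<Longrightarrow> path_image (\<sigma> q) \<inter> path_image (\<sigma> q') = {c}"
      have "P x Q D c \<sigma>"
        unfolding P_def using order_trans[OF a(5) U(3)] a(1-4,6) b c by simp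
      then show "\<exists>Q D c \<sigma>. P x Q D c \<sigma>" by (intro exI)
    qed
  qed
  then obtain Q D c \<sigma> where P: "\<And>x. x \<in> ?V \<Longrightarrow> P x (Q x) (D x) (c x) (\<sigma> x)" by metis
  have disc: "open (Q x) \<and> compact (D x) \<and> T x \<subseteq> Q x \<and> Q x \<subseteq> D x \<and> D x \<subseteq> W x \<and> c x \<in> Q x" if "x \<in> ?V" for x
    using P[OF that] unfolding P_def by (elim conjE) (intro conjI)
  have sp: "arc (\<sigma> x q) \<and> pathstart (\<sigma> x q) = c x \<and> pathfinish (\<sigma> x q) = q \<and>
        path_image (\<sigma> x q) \<subseteq> D x \<and> path_image (\<sigma> x q) \<inter> (D x - Q x) = {q}"
    if "x \<in> ?V" "q \<in> D x - Q x" for x q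
    using P[OF that(1)] that(2) unfolding P_def by (elim conjE) (rule bspec)
  have sp2: "path_image (\<sigma> x q) \<inter> path_image (\<sigma> x q') = {c x}"
    if "x \<in> ?V" "q \<in> D x - Q x" "q' \<in> D x - Q x" "q \<noteq> q'" for x q q'
    using P[OF that(1)] that(2-) unfolding P_def by (elim conjE) simp
  have DD: "D x \<inter> D y = {}" if "x \<in> ?V" "y \<in> ?V" "x \<noteq> y" for x y
    using WW[OF that] disc that by blast
  have D\<Gamma>: "D x \<inter> path_image (\<Gamma> e) = {}" if "x \<in> ?V" "e \<in> ?E" "x \<notin> e" for x e
    using W\<Gamma>[OF that] disc that by blast
  \<comment> \<open>\<open>A\<close> is the truncated part of \<open>\<Gamma> e\<close>,
    \<open>q x\<close> the single point where it touches the disc of \<open>x\<close>, and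
    \<open>g\<close> its prolongation along the two spokes to the centres.\<close>
  define R where "R e g A q \<longleftrightarrow> (arc g \<and> {pathstart g, pathfinish g} = c ` e \<and>
      path_image g = path_image A \<union> (\<Union>x\<in>e. path_image (\<sigma> x (q x))) \<and>
      path_image A \<subseteq> path_image (\<Gamma> e) \<and> (\<forall>x\<in>e. q x \<in> D x - Q x \<and> path_image A \<inter> D x = {q x}))" for e g A and q :: "'b \<Rightarrow> complex"
  have "\<exists>g A q. R e g A q" if e: "e \<in> ?E" for e
  proof -
    obtain x y where xy: "e = {x, y}" "pathstart (\<Gamma> e) \<in> T x" "pathfinish (\<Gamma> e) \<in> T y" and arc: "arc (\<Gamma> e)"
      using \<Gamma>[OF e] by blast
    have xy': "x \<noteq> y" "x \<in> ?V" "y \<in> ?V" using X e xy(1) unfolding simple_graph_def by auto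
    note dx = disc[OF xy'(2)] note dy = disc[OF xy'(3)]
    have ends: "pathstart (\<Gamma> e) \<in> Q x" "pathfinish (\<Gamma> e) \<in> Q y" and op: "open (Q x)" "open (Q y)"
      "Q x \<subseteq> D x" "Q y \<subseteq> D y" and cl: "closed (D x)" "closed (D y)"
      using dx dy xy by (auto intro: compact_imp_closed)
    obtain A where A: "arc A" "path_image A \<subseteq> path_image (\<Gamma> e)"
      "pathstart A \<in> D x - Q x" "pathfinish A \<in> D y - Q y"
      "path_image A \<inter> D x = {pathstart A}" "path_image A \<inter> D y = {pathfinish A}"
      by (rule truncate_arc[OF arc ends op cl DD[OF xy'(2,3,1)]])
    let ?s = "\<sigma> x (pathstart A)" and ?t = "\<sigma> y (pathfinish A)"
    note s = sp[OF xy'(2) A(3)] note t = sp[OF xy'(3) A(4)]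
    let ?g = "(?s +++ A) +++ reversepath ?t"
    have sD: "path_image ?s \<subseteq> D x" and tD: "path_image ?t \<subseteq> D y" and as: "arc ?s" "arc ?t"
      and sq: "pathfinish ?s = pathstart A" "pathstart ?s = c x"
      and tq: "pathfinish ?t = pathfinish A" "pathstart ?t = c y"
      using s t by simp_all
    have a1: "arc (?s +++ A)" by (rule arc_join[OF as(1) A(1) sq(1)]) (use sD A(5) in blast)
    have im1: "path_image (?s +++ A) = path_image ?s \<union> path_image A" using sq by (simp add: path_image_join)
    have "arc ?g"
    proof (rule arc_join)
      show "path_image (?s +++ A) \<inter> path_image (reversepath ?t) \<subseteq> {pathstart (reversepath ?t)}"
        unfolding im1 path_image_reversepath pathstart_reversepath tq using sD tD A(6) DD[OF xy'(2,3,1)] by blast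
    qed (use a1 as tq in \<open>auto simp: arc_reversepath\<close>)
    moreover have "path_image ?g = path_image A \<union> (path_image ?s \<union> path_image ?t)"
      using tq im1 by (subst path_image_join) auto
    moreover have "{pathstart ?g, pathfinish ?g} = c ` e" using sq tq xy(1) by simp
    moreover define q where "q z = (if z = x then pathstart A else pathfinish A)" for z
    ultimately have "R e ?g A q" unfolding R_def using A xy'(1) xy(1) by simp
    then show ?thesis by (intro exI)
  qed
  then obtain g A q where R: "\<And>e. e \<in> ?E \<Longrightarrow> R e (g e) (A e) (q e)" by metis
  have g: "arc (g e) \<and> {pathstart (g e), pathfinish (g e)} = c ` e"
    and gim: "path_image (g e) = path_image (A e) \<union> (\<Union>x\<in>e. path_image (\<sigma> x (q e x)))"
    and A\<Gamma>: "path_image (A e) \<subseteq> path_image (\<Gamma> e)" if "e \<in> ?E" for e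
    using R[OF that] unfolding R_def by simp_all
  have q: "q e x \<in> D x - Q x" and qA: "path_image (A e) \<inter> D x = {q e x}" if "e \<in> ?E" "x \<in> e" for e x
    using R[OF that(1)] that(2) unfolding R_def by simp_all
  have AD: "x \<in> e" "q e x = z" if z: "e \<in> ?E" "x \<in> ?V" "z \<in> path_image (A e)" "z \<in> D x" for e x z
  proof -
    show "x \<in> e" using D\<Gamma>[OF z(2,1)] A\<Gamma>[OF z(1)] z(3,4) by (metis IntI empty_iff subsetD)
    from qA[OF z(1) this] z(3,4) show "q e x = z" by (metis IntI singletonD)
  qed
  have \<sigma>D: "path_image (\<sigma> x (q e x)) \<subseteq> D x" "path_image (\<sigma> x (q e x)) \<inter> (D x - Q x) = {q e x}" if "e \<in> ?E" "x \<in> e" for e x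
    using sp[OF EV[OF that] q[OF that]] by simp_all
  \<comment> \<open>A common point would lie in some \<open>T x\<close> and so in the open set
    \<open>Q x\<close>, whereas a truncated arc touches \<open>D x\<close> only in
    \<open>D x - Q x\<close>.\<close>
  have AA: "path_image (A e) \<inter> path_image (A f) = {}" if ef: "e \<in> ?E" "f \<in> ?E" "e \<noteq> f" for e f
  proof (rule ccontr)
    assume "path_image (A e) \<inter> path_image (A f) \<noteq> {}"
    then obtain z where z: "z \<in> path_image (A e)" "z \<in> path_image (A f)" by auto
    have "z \<in> path_image (\<Gamma> e) \<inter> path_image (\<Gamma> f)" using z A\<Gamma>[OF ef(1)] A\<Gamma>[OF ef(2)] by blast
    then obtain x where x: "x \<in> e" "z \<in> T x" using meet[OF ef] by blast
    note dx = disc[OF EV[OF ef(1) x(1)]]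
    then have "z \<in> Q x" "z \<in> D x" using x(2) by (meson subsetD)+
    then show False using AD(2)[OF ef(1) EV[OF ef(1) x(1)] z(1)] q[OF ef(1) x(1)] by simp
  qed
  have A\<sigma>: "path_image (A e) \<inter> path_image (\<sigma> x (q f x)) = {}" if ef: "e \<in> ?E" "f \<in> ?E" "e \<noteq> f" "x \<in> f" for e f x
  proof (rule ccontr)
    assume "path_image (A e) \<inter> path_image (\<sigma> x (q f x)) \<noteq> {}"
    then obtain z where z: "z \<in> path_image (A e)" "z \<in> path_image (\<sigma> x (q f x))" by auto
    have "z \<in> D x" using z(2) \<sigma>D(1)[OF ef(2,4)] by (rule subsetD[rotated])
    then have "x \<in> e" "q e x = z" using AD[OF ef(1) EV[OF ef(2,4)] z(1)] by simp_all
    then have "z \<in> D x - Q x" using q[OF ef(1)] by metis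
    then have "z = q f x" using \<sigma>D(2)[OF ef(2,4)] z(2) by (metis IntI singletonD)
    then have "z \<in> path_image (A f)" using qA[OF ef(2,4)] by (metis IntE insertI1)
    then show False using AA[OF ef(1-3)] z(1) by (metis IntI empty_iff)
  qed
  have cD: "c x \<in> D x" if "x \<in> ?V" for x using disc[OF that] by (meson subsetD)
  have cinj: "inj_on c ?V" by (intro inj_onI) (metis IntI empty_iff cD DD)
  have ce: "c ` e \<subseteq> path_image (g e)" if "e \<in> ?E" for e
    using g[OF that] pathstart_in_path_image pathfinish_in_path_image by (metis insert_subset empty_subsetI)
  have "plane_drawing X c g"
    unfolding plane_drawing_def
  proof (intro conjI ballI impI cinj)
    fix e assume e: "e \<in> ?E"
    show "arc (g e)" "{pathstart (g e), pathfinish (g e)} = c ` e" using g e by auto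
    have "z \<in> e" if z: "z \<in> ?V" "c z \<in> path_image (g e)" for z
    proof -
      note cz = cD[OF z(1)]
      from z(2) consider "c z \<in> path_image (A e)" | x where "x \<in> e" "c z \<in> path_image (\<sigma> x (q e x))"
        unfolding gim[OF e] by blast
      then show ?thesis
      proof cases
        case 1 show ?thesis by (rule AD(1)[OF e z(1) 1 cz])
      next
        case 2
        then have "c z \<in> D x" using \<sigma>D(1)[OF e] by blast
        then show ?thesis using 2(1) cz DD[OF EV[OF e 2(1)] z(1)] by blast
      qed
    qed
    then show "path_image (g e) \<inter> c ` ?V = c ` e" using ce[OF e] EV[OF e] by blast
    fix f assume f: "f \<in> ?E" and ef: "e \<noteq> f"
    have "c ` (e \<inter> f) \<subseteq> path_image (g e) \<inter> path_image (g f)" using ce e f by blast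
    moreover have "path_image (g e) \<inter> path_image (g f) \<subseteq> c ` (e \<inter> f)"
    proof
      fix z assume "z \<in> path_image (g e) \<inter> path_image (g f)"
      moreover have "z \<notin> path_image (A e) \<or> z \<notin> path_image (A f)" using AA[OF e f ef] by blast
      moreover have "z \<notin> path_image (A e) \<or> z \<notin> path_image (\<sigma> x (q f x))" if "x \<in> f" for x
        using A\<sigma>[OF e f ef that] by blast
      moreover have "z \<notin> path_image (A f) \<or> z \<notin> path_image (\<sigma> x (q e x))" if "x \<in> e" for x
        using A\<sigma>[OF f e ef[symmetric] that] by blast
      ultimately obtain x y where z: "x \<in> e" "y \<in> f" "z \<in> path_image (\<sigma> x (q e x))" "z \<in> path_image (\<sigma> y (q f y))"
        unfolding gim[OF e] gim[OF f] by blast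
      have "z \<in> D x" "z \<in> D y" using \<sigma>D(1)[OF e z(1)] \<sigma>D(1)[OF f z(2)] z(3,4) by (meson subsetD)+
      then have xy: "y = x" using DD[OF EV[OF e z(1)] EV[OF f z(2)]] by blast
      note zf = z(2)[unfolded xy]
      have "q e x \<noteq> q f x" using AA[OF e f ef] qA[OF e z(1)] qA[OF f zf] by blast
      from sp2[OF EV[OF e z(1)] q[OF e z(1)] q[OF f zf] this]
      have "z = c x" using z(3,4) unfolding xy by blast
      then show "z \<in> c ` (e \<inter> f)" using z(1) zf by blast
    qed
    ultimately show "path_image (g e) \<inter> path_image (g f) = c ` (e \<inter> f)" by blast
  qed
  then show ?thesis unfolding planar_def by blast
qed

subsection \<open>Faces of a drawn complete graph on four vertices\<close>

text \<open>The arcs are oriented and all fifteen intersections are listed, because the triangle and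
  its chords are built by joining arcs and the theta curve theorem asks for these intersections
  explicitly.\<close>

definition K4_arcs :: "complex \<Rightarrow> complex \<Rightarrow> complex \<Rightarrow> complex \<Rightarrow> (real \<Rightarrow> complex) \<Rightarrow> (real \<Rightarrow> complex) \<Rightarrow>
    (real \<Rightarrow> complex) \<Rightarrow> (real \<Rightarrow> complex) \<Rightarrow> (real \<Rightarrow> complex) \<Rightarrow> (real \<Rightarrow> complex) \<Rightarrow> bool" where
  "K4_arcs a b c d ab bc ac ad bd cd \<longleftrightarrow>
     (arc ab \<and> pathstart ab = a \<and> pathfinish ab = b) \<and>
     (arc bc \<and> pathstart bc = b \<and> pathfinish bc = c) \<and>
     (arc ac \<and> pathstart ac = a \<and> pathfinish ac = c) \<and>
     (arc ad \<and> pathstart ad = a \<and> pathfinish ad = d) \<and>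
     (arc bd \<and> pathstart bd = b \<and> pathfinish bd = d) \<and>
     (arc cd \<and> pathstart cd = c \<and> pathfinish cd = d) \<and>
     path_image ab \<inter> path_image bc = {b} \<and> path_image ab \<inter> path_image ac = {a} \<and>
     path_image bc \<inter> path_image ac = {c} \<and> path_image ab \<inter> path_image ad = {a} \<and>
     path_image ab \<inter> path_image bd = {b} \<and> path_image ab \<inter> path_image cd = {} \<and>
     path_image bc \<inter> path_image ad = {} \<and> path_image bc \<inter> path_image bd = {b} \<and>
     path_image bc \<inter> path_image cd = {c} \<and> path_image ac \<inter> path_image ad = {a} \<and>
     path_image ac \<inter> path_image bd = {} \<and> path_image ac \<inter> path_image cd = {c} \<and>
     path_image ad \<inter> path_image bd = {d} \<and> path_image ad \<inter> path_image cd = {d} \<and>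
     path_image bd \<inter> path_image cd = {d}"

lemma connected_subset_inside_or_outside:
  fixes C S :: "'a::real_normed_vector set"
  assumes "connected C" "C \<inter> S = {}" "closed S"
  shows "C \<subseteq> inside S \<or> C \<subseteq> outside S"
proof -
  have "C \<subseteq> inside S \<union> outside S" using assms(2) by (auto simp: inside_Un_outside)
  moreover have "inside S \<inter> outside S \<inter> C = {}" by (simp add: inside_Int_outside)
  ultimately have "inside S \<inter> C = {} \<or> outside S \<inter> C = {}"
    using connectedD[OF assms(1) open_inside[OF assms(3)] open_outside[OF assms(3)]] by blast
  then show ?thesis using \<open>C \<subseteq> inside S \<union> outside S\<close> by blast
qed

lemma closure_arc_endless:
  fixes g :: "real \<Rightarrow> complex"
  assumes "arc g"
  shows "closure (path_image g - {pathstart g, pathfinish g}) = path_image g"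
proof
  have "closed (path_image g)" using assms by (rule closed_arc_image)
  then show "closure (path_image g - {pathstart g, pathfinish g}) \<subseteq> path_image g"
    by (simp add: closure_minimal)
  have "g ` closure {0<..<1} \<subseteq> closure (g ` {0<..<1})"
    using assms by (intro image_closure_subset[OF _ closed_closure closure_subset])
      (auto simp: arc_def path_def)
  then show "path_image g \<subseteq> closure (path_image g - {pathstart g, pathfinish g})"
    using simple_path_endless[OF arc_imp_simple_path[OF assms]] by (simp add: path_image_def)
qed

lemma connected_arc_endless:
  fixes g :: "real \<Rightarrow> complex"
  assumes "arc g" "E \<subseteq> {pathstart g, pathfinish g}"
  shows "connected (path_image g - E)"
  using connected_simple_path_endless[OF arc_imp_simple_path[OF assms(1)]]
  by (rule connected_intermediate_closure) (use assms closure_arc_endless in auto)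

text \<open>The theta curve theorem, applied to the chord through \<open>d\<close> and then to the arc from \<open>c\<close> to \<open>d\<close>, splits the
  inside of the triangle into three regions, each of which misses a corner.\<close>

lemma K4_arcs_inside:
  assumes K: "K4_arcs a b c d ab bc ac ad bd cd"
    and d: "d \<in> inside (path_image ab \<union> path_image bc \<union> path_image ac)"
    and C: "connected C" "C \<inter> (path_image ab \<union> path_image bc \<union> path_image ac \<union>
      path_image ad \<union> path_image bd \<union> path_image cd) = {}"
    and cl: "{a, b, c, d} \<subseteq> closure C"
  shows False
proof -
  note K' = K[unfolded K4_arcs_def]
  let ?ab = "path_image ab" and ?bc = "path_image bc" and ?ac = "path_image ac"
    and ?ad = "path_image ad" and ?bd = "path_image bd" and ?cd = "path_image cd"
  have arcs: "arc ab" "arc bc" "arc ac" "arc ad" "arc bd" "arc cd" using K' by simp_all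
  have ends: "pathstart ab = a" "pathfinish ab = b" "pathstart bc = b" "pathfinish bc = c"
    "pathstart ac = a" "pathfinish ac = c" "pathstart ad = a" "pathfinish ad = d"
    "pathstart bd = b" "pathfinish bd = d" "pathstart cd = c" "pathfinish cd = d" using K' by simp_all
  have ints: "?ab \<inter> ?bc = {b}" "?ab \<inter> ?ac = {a}" "?bc \<inter> ?ac = {c}" "?ab \<inter> ?ad = {a}" "?ab \<inter> ?bd = {b}"
     "?ab \<inter> ?cd = {}" "?bc \<inter> ?ad = {}" "?bc \<inter> ?bd = {b}" "?bc \<inter> ?cd = {c}" "?ac \<inter> ?ad = {a}"
     "?ac \<inter> ?bd = {}" "?ac \<inter> ?cd = {c}" "?ad \<inter> ?bd = {d}" "?ad \<inter> ?cd = {d}" "?bd \<inter> ?cd = {d}"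
    using K' by simp_all
  have mem: "a \<in> ?ab" "b \<in> ?ab" "b \<in> ?bc" "c \<in> ?bc" "a \<in> ?ac" "c \<in> ?ac" "a \<in> ?ad" "d \<in> ?ad"
     "b \<in> ?bd" "d \<in> ?bd" "c \<in> ?cd" "d \<in> ?cd"
    using pathstart_in_path_image pathfinish_in_path_image ends by metis+
  have ne: "a \<noteq> b" "c \<noteq> d" using arcs ends arc_distinct_ends by metis+
  have notin: "c \<notin> ?ab" "c \<notin> ?ad" "c \<notin> ?bd" "b \<notin> ?ac" "b \<notin> ?ad" "b \<notin> ?cd" "a \<notin> ?bc" "a \<notin> ?bd" "a \<notin> ?cd"
    using ints mem ne by auto
  let ?I0 = "inside (?ab \<union> ?bc \<union> ?ac)"
  let ?I1 = "inside (?ab \<union> (?ad \<union> ?bd))"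
  let ?I2 = "inside ((?ac \<union> ?bc) \<union> (?ad \<union> ?bd))"
  let ?J1 = "inside ((?ac \<union> ?ad) \<union> ?cd)"
  let ?J2 = "inside ((?bc \<union> ?bd) \<union> ?cd)"
  have cls: "closed ?ab" "closed ?bc" "closed ?ac" "closed ?ad" "closed ?bd" "closed ?cd"
    using arcs by (simp_all add: closed_arc_image)
  have jo: "arc (ac +++ reversepath bc)" "arc (ad +++ reversepath bd)" "arc (reversepath ac +++ ad)" "arc (reversepath bc +++ bd)"
    using arcs ends ints by (auto intro!: arc_join simp: arc_reversepath)
  have im: "path_image (ac +++ reversepath bc) = ?ac \<union> ?bc" "path_image (ad +++ reversepath bd) = ?ad \<union> ?bd"
    "path_image (reversepath ac +++ ad) = ?ac \<union> ?ad" "path_image (reversepath bc +++ bd) = ?bc \<union> ?bd"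
    using ends by (simp_all add: path_image_join)
  have 0: "?ab \<union> (?ac \<union> ?bc) = ?ab \<union> ?bc \<union> ?ac" by auto
  \<comment> \<open>The theta curve has the branches \<open>ab\<close>,
    \<open>a\<close>-\<open>c\<close>-\<open>b\<close> and
    \<open>a\<close>-\<open>d\<close>-\<open>b\<close>: the chord through \<open>d\<close> cuts the
    triangle into \<open>?I1\<close> at the side \<open>ab\<close> and \<open>?I2\<close> at the
    corner \<open>c\<close>.\<close>
  have s1: "?I1 \<inter> ?I2 = {} \<and> ?I1 \<union> ?I2 \<union> (?ad \<union> ?bd - {a, b}) = ?I0"
  proof (rule split_inside_simple_closed_curve[of ab a b "ac +++ reversepath bc" "ad +++ reversepath bd"], unfold im 0)
    show "?ab \<inter> (?ac \<union> ?bc) = {a, b}" "?ab \<inter> (?ad \<union> ?bd) = {a, b}" "(?ac \<union> ?bc) \<inter> (?ad \<union> ?bd) = {a, b}"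
      using ints by auto
    show "(?ad \<union> ?bd) \<inter> ?I0 \<noteq> {}" using mem d by auto
  qed (use arcs jo ends ne in \<open>auto intro: arc_imp_simple_path\<close>)
  have curve: "x \<notin> ?I0" if "x \<in> ?ab \<union> ?bc \<union> ?ac" for x
    using that inside_no_overlap[of "?ab \<union> ?bc \<union> ?ac"] by blast
  have cI0: "c \<notin> ?I0" "b \<notin> ?I0" "a \<notin> ?I0" using curve mem by auto
  have cI1: "c \<notin> closure ?I1"
    using closure_inside_subset[of "?ab \<union> (?ad \<union> ?bd)"] cls s1 cI0 notin by (auto simp: closed_Un)
  have con: "connected (?cd - {c})" "c \<in> closure (?cd - {c, d})"
    using connected_arc_endless[OF arcs(6), of "{c}"] closure_arc_endless[OF arcs(6)] ends mem(11) by auto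
  have cdI0: "?cd - {c} \<subseteq> ?I0"
  proof -
    have "(?cd - {c}) \<inter> (?ab \<union> ?bc \<union> ?ac) = {}" using ints by auto
    from connected_subset_inside_or_outside[OF con(1) this]
    have "?cd - {c} \<subseteq> ?I0 \<or> ?cd - {c} \<subseteq> outside (?ab \<union> ?bc \<union> ?ac)" using cls by (simp add: closed_Un)
    then show ?thesis using d mem(12) ne inside_Int_outside[of "?ab \<union> ?bc \<union> ?ac"] by blast
  qed
  \<comment> \<open>If \<open>cd\<close> missed \<open>?I2\<close>, it would run through
    \<open>?I1\<close>, and its end \<open>c\<close> would be in the closure of \<open>?I1\<close>,
    which \<open>cI1\<close> excludes.\<close>
  have cdI2: "?cd \<inter> ?I2 \<noteq> {}"
  proof
    assume "?cd \<inter> ?I2 = {}"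
    then have "?cd - {c, d} \<subseteq> ?I1" using cdI0 s1 ints(14,15) by blast
    then show False using con(2) cI1 closure_mono by blast
  qed
  have 2: "(?ac \<union> ?ad) \<union> (?bc \<union> ?bd) = (?ac \<union> ?bc) \<union> (?ad \<union> ?bd)" by auto
  have s2: "?J1 \<inter> ?J2 = {} \<and> ?J1 \<union> ?J2 \<union> (?cd - {c, d}) = ?I2"
  proof (rule split_inside_simple_closed_curve[of "reversepath ac +++ ad" c d "reversepath bc +++ bd" cd], unfold im 2)
    show "(?ac \<union> ?ad) \<inter> (?bc \<union> ?bd) = {c, d}" "(?ac \<union> ?ad) \<inter> ?cd = {c, d}" "(?bc \<union> ?bd) \<inter> ?cd = {c, d}"
      using ints by auto
    show "?cd \<inter> ?I2 \<noteq> {}" by (rule cdI2)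
  qed (use arcs jo ends ne in \<open>auto intro: arc_imp_simple_path\<close>)
  have CI0: "C \<subseteq> ?I0"
  proof -
    have "C \<subseteq> ?I0 \<or> C \<subseteq> outside (?ab \<union> ?bc \<union> ?ac)"
      using C by (intro connected_subset_inside_or_outside closed_Un cls) auto
    moreover have "C \<inter> ?I0 \<noteq> {}"
      using cl d open_inside[of "?ab \<union> ?bc \<union> ?ac"] cls
      by (metis closed_Un closure_iff_nhds_not_empty insert_subset order_refl inf_commute)
    ultimately show ?thesis using inside_Int_outside[of "?ab \<union> ?bc \<union> ?ac"] by blast
  qed
  have sub: "C \<subseteq> ?I1 \<union> ?J1 \<union> ?J2" using CI0 s1 s2 C(2) by blast
  have o: "open ?I1" "open ?J1" "open ?J2" "open ?I2" using cls by (auto intro!: open_inside)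
  have J: "?J1 \<subseteq> ?I0" "?J2 \<subseteq> ?I0" using s1 s2 by blast+
  have bJ1: "b \<notin> closure ?J1"
    using closure_inside_subset[of "(?ac \<union> ?ad) \<union> ?cd"] cls J cI0 notin by (auto simp: closed_Un)
  have aJ2: "a \<notin> closure ?J2"
    using closure_inside_subset[of "(?bc \<union> ?bd) \<union> ?cd"] cls J cI0 notin by (auto simp: closed_Un)
  have "C \<subseteq> ?I1 \<or> C \<subseteq> ?J1 \<union> ?J2"
  proof -
    have "?I1 \<inter> (?J1 \<union> ?J2) \<inter> C = {}" using s1 s2 by blast
    from connectedD[OF C(1) o(1) open_Un[OF o(2,3)] this] sub show ?thesis by blast
  qed
  moreover have "C \<subseteq> ?J1 \<or> C \<subseteq> ?J2" if "C \<subseteq> ?J1 \<union> ?J2"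
  proof -
    have "?J1 \<inter> ?J2 \<inter> C = {}" using s2 by blast
    from connectedD[OF C(1) o(2,3) this that] that show ?thesis by blast
  qed
  ultimately have "C \<subseteq> ?I1 \<or> C \<subseteq> ?J1 \<or> C \<subseteq> ?J2" by blast
  then have "closure C \<subseteq> closure ?I1 \<or> closure C \<subseteq> closure ?J1 \<or> closure C \<subseteq> closure ?J2"
    using closure_mono by metis
  then show False using cl cI1 bJ1 aJ2 by blast
qed

lemma K4_arcs_image:
  assumes K: "K4_arcs a b c d ab bc ac ad bd cd"
    and \<phi>: "continuous_on X \<phi>" "inj_on \<phi> X"
    and X: "path_image ab \<union> path_image bc \<union> path_image ac \<union> path_image ad \<union> path_image bd \<union> path_image cd \<subseteq> X"
  shows "K4_arcs (\<phi> a) (\<phi> b) (\<phi> c) (\<phi> d) (\<phi> \<circ> ab) (\<phi> \<circ> bc) (\<phi> \<circ> ac) (\<phi> \<circ> ad) (\<phi> \<circ> bd) (\<phi> \<circ> cd)"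
proof -
  have arc: "arc (\<phi> \<circ> g)" if "arc g" "path_image g \<subseteq> X" for g
    using that \<phi> unfolding arc_def
    by (metis comp_inj_on continuous_on_subset inj_on_subset path_continuous_image path_image_def)
  have int: "path_image (\<phi> \<circ> g) \<inter> path_image (\<phi> \<circ> h) = \<phi> ` (path_image g \<inter> path_image h)"
    if "path_image g \<subseteq> X" "path_image h \<subseteq> X" for g h
    unfolding path_image_compose using inj_on_image_Int[OF \<phi>(2) that] by simp
  show ?thesis using K X unfolding K4_arcs_def
    by (simp add: arc int pathstart_compose pathfinish_compose)
qed

text \<open>The inversion swaps the two sides of the curve. The image \<open>?Q\<close> of the
  inside without \<open>z0\<close> is connected and unbounded, hence outside the image curve. Were
  the image \<open>?P\<close> of the outside there too, no point would be left for the inside of the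
  image curve.\<close>

lemma inversion_outside_to_inside:
  fixes g :: "real \<Rightarrow> complex"
  assumes g: "simple_path g" "pathfinish g = pathstart g"
    and z0: "z0 \<in> inside (path_image g)" and d: "d \<in> outside (path_image g)"
  defines "\<phi> \<equiv> \<lambda>z. inverse (z - z0)"
  shows "\<phi> d \<in> inside (path_image (\<phi> \<circ> g))"
proof (rule ccontr)
  assume not: "\<phi> d \<notin> inside (path_image (\<phi> \<circ> g))"
  let ?J = "path_image g" and ?J' = "path_image (\<phi> \<circ> g)"
  have J': "?J' = \<phi> ` ?J" by (simp add: path_image_compose)
  note jg = Jordan_inside_outside[OF g]
  have z0J: "z0 \<notin> ?J" "z0 \<notin> outside ?J" using z0 jg by blast+
  have cont: "continuous_on (- {z0}) \<phi>" unfolding \<phi>_def by (auto intro!: continuous_intros)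
  have inj: "inj_on \<phi> (- {z0})" unfolding \<phi>_def inj_on_def by simp
  have nz: "\<phi> z \<noteq> 0" if "z \<noteq> z0" for z using that unfolding \<phi>_def by simp
  have g': "simple_path (\<phi> \<circ> g)"
    using g(1) z0J(1) by (intro simple_path_continuous_image continuous_on_subset[OF cont] inj_on_subset[OF inj]) auto
  have l': "pathfinish (\<phi> \<circ> g) = pathstart (\<phi> \<circ> g)" using g(2) by (simp add: pathstart_compose pathfinish_compose)
  note jg' = Jordan_inside_outside[OF g' l']
  have cJ': "closed ?J'" using g' by (simp add: closed_simple_path_image)
  have disj: "\<phi> z \<notin> ?J'" if "z \<notin> ?J" "z \<noteq> z0" for z
  proof
    assume "\<phi> z \<in> ?J'"
    then obtain y where y: "y \<in> ?J" "\<phi> y = \<phi> z" unfolding J' by auto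
    have "y \<noteq> z0" using y(1) z0J(1) by blast
    then have "y = z" using inj_onD[OF inj y(2)] that(2) by simp
    then show False using y(1) that(1) by simp
  qed
  let ?P = "\<phi> ` outside ?J"
  have cP: "connected ?P"
    using jg z0J(2) by (intro connected_continuous_image continuous_on_subset[OF cont]) auto
  \<comment> \<open>The point 0 is the image of infinity and has no preimage in the plane. It is
    added to \<open>?P\<close>, so that a point \<open>w\<close> inside the image curve is nonzero
    and has a preimage.\<close>
  have "0 \<in> closure ?P"
    unfolding closure_approachable
  proof (intro allI impI)
    fix e :: real assume e: "e > 0"
    have "\<exists>z\<in>outside ?J. inverse e + norm z0 < norm z" using jg unfolding bounded_iff by (meson not_le)
    then obtain z where z: "z \<in> outside ?J" "inverse e + norm z0 < norm z" by auto
    have "inverse e < norm (z - z0)" using z(2) norm_triangle_ineq2[of z z0] by linarith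
    then have "norm (\<phi> z) < e" unfolding \<phi>_def norm_inverse using e
      by (metis inverse_inverse_eq inverse_less_iff_less inverse_positive_iff_positive order_less_trans)
    then show "\<exists>y\<in>?P. dist y 0 < e" using z(1) by auto
  qed
  then have cP0: "connected (insert 0 ?P)"
    by (intro connected_intermediate_closure[OF cP]) (auto simp: closure_subset[THEN subsetD])
  have "0 \<notin> ?J'" unfolding J' using nz z0J by force
  moreover have "?P \<inter> ?J' = {}" using disj jg z0J by blast
  ultimately have "insert 0 ?P \<subseteq> inside ?J' \<or> insert 0 ?P \<subseteq> outside ?J'"
    using cP0 by (intro connected_subset_inside_or_outside cJ') auto
  then have P: "insert 0 ?P \<subseteq> outside ?J'" using not d by blast
  let ?Q = "\<phi> ` (inside ?J - {z0})"
  have "connected (inside ?J - {z0})" using jg by (intro connected_open_delete) auto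
  then have cQ: "connected ?Q" by (intro connected_continuous_image continuous_on_subset[OF cont]) auto
  have "?Q \<inter> ?J' = {}" using disj jg by blast
  then have "?Q \<subseteq> inside ?J' \<or> ?Q \<subseteq> outside ?J'" by (intro connected_subset_inside_or_outside cJ' cQ)
  moreover have "\<not> bounded ?Q"
  proof
    assume "bounded ?Q"
    then obtain M where M: "\<And>z. z \<in> inside ?J - {z0} \<Longrightarrow> norm (\<phi> z) \<le> M" unfolding bounded_iff by auto
    obtain r where r: "r > 0" "ball z0 r \<subseteq> inside ?J" using openE[OF _ z0] jg by metis
    \<comment> \<open>The first bound keeps \<open>z0 + t\<close> in the ball inside the curve, the
      second makes the norm of its image larger than \<open>M\<close>.\<close>
    define t where "t = min (r / 2) (inverse (\<bar>M\<bar> + 1))"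
    have t: "t > 0" "t < r" "t \<le> inverse (\<bar>M\<bar> + 1)" using r unfolding t_def by auto
    have "z0 + of_real t \<in> inside ?J - {z0}" using r t by (auto intro!: subsetD[OF r(2)] simp: dist_norm)
    from M[OF this] have "inverse t \<le> M" unfolding \<phi>_def using t by (simp add: norm_inverse)
    moreover have "\<bar>M\<bar> + 1 \<le> inverse t" using t le_imp_inverse_le[OF t(3,1)] by simp
    ultimately show False by linarith
  qed
  moreover have "bounded (inside ?J')" using jg' by blast
  ultimately have Q: "?Q \<subseteq> outside ?J'" using bounded_subset by metis
  obtain w where w: "w \<in> inside ?J'" using jg' by blast
  have "w \<noteq> 0" using P w jg' by blast
  define z where "z = z0 + inverse w"
  have z: "\<phi> z = w" "z \<noteq> z0" using \<open>w \<noteq> 0\<close> unfolding \<phi>_def z_def by auto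
  have "z \<in> ?J \<union> (inside ?J - {z0}) \<union> outside ?J" using jg z(2) by blast
  then have "\<phi> z \<in> ?J' \<union> ?P \<union> ?Q" unfolding J' by blast
  then have "w \<in> ?J' \<union> ?P \<union> ?Q" unfolding z(1) .
  moreover have "w \<notin> ?J'" "w \<notin> outside ?J'" using w jg' by blast+
  ultimately show False using P Q by blast
qed

text \<open>If \<open>d\<close> is outside the triangle, an inversion about a point inside the triangle brings it inside.\<close>

lemma K4_arcs_no_common_face:
  assumes K: "K4_arcs a b c d ab bc ac ad bd cd"
    and C: "connected C" "C \<inter> (path_image ab \<union> path_image bc \<union> path_image ac \<union>
      path_image ad \<union> path_image bd \<union> path_image cd) = {}"
    and cl: "{a, b, c, d} \<subseteq> closure C"
  shows False
proof -
  note K' = K[unfolded K4_arcs_def]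
  let ?ab = "path_image ab" and ?bc = "path_image bc" and ?ac = "path_image ac"
    and ?ad = "path_image ad" and ?bd = "path_image bd" and ?cd = "path_image cd"
  let ?J = "?ab \<union> ?bc \<union> ?ac"
  have arcs: "arc ab" "arc bc" "arc ac" "arc ad" "arc bd" "arc cd" using K' by simp_all
  have ends: "pathstart ab = a" "pathfinish ab = b" "pathstart bc = b" "pathfinish bc = c"
    "pathstart ac = a" "pathfinish ac = c" "pathstart ad = a" "pathfinish ad = d"
    "pathstart bd = b" "pathfinish bd = d" "pathstart cd = c" "pathfinish cd = d" using K' by simp_all
  have mem: "a \<in> ?ab" "b \<in> ?ab" "b \<in> ?bc" "c \<in> ?bc" "a \<in> ?ac" "c \<in> ?ac" "a \<in> ?ad" "d \<in> ?ad"
     "b \<in> ?bd" "d \<in> ?bd" "c \<in> ?cd" "d \<in> ?cd"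
    using pathstart_in_path_image pathfinish_in_path_image ends by metis+
  have ne: "a \<noteq> d" "b \<noteq> d" "c \<noteq> d" "b \<noteq> c" using arcs ends arc_distinct_ends by metis+
  have clJ: "closed ?J" using arcs by (intro closed_Un closed_arc_image)
  define g where "g = (ab +++ bc) +++ reversepath ac"
  have gim: "path_image g = ?J" unfolding g_def using ends by (simp add: path_image_join)
  have ab_bc: "arc (ab +++ bc)" by (rule arc_join) (use K' in simp_all)
  have "path_image (ab +++ bc) = ?ab \<union> ?bc" using ends by (simp add: path_image_join)
  then have "simple_path g" unfolding g_def using ends arcs ab_bc K'
    by (intro simple_path_join_loop) (auto simp: arc_reversepath)
  moreover have "pathfinish g = pathstart g" unfolding g_def using ends by simp
  ultimately have g: "simple_path g" "pathfinish g = pathstart g" by auto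
  note jg = Jordan_inside_outside[OF g, unfolded gim]
  have "d \<notin> ?J"
  proof
    assume "d \<in> ?J"
    then have "d \<in> ?ab \<inter> ?ad \<or> d \<in> ?bc \<inter> ?bd \<or> d \<in> ?ac \<inter> ?ad" using mem by blast
    then show False using K' ne by simp
  qed
  moreover have "d \<notin> inside ?J" using K4_arcs_inside[OF K _ C cl] by blast
  ultimately have d: "d \<in> outside ?J" using jg by blast
  have out: "S \<subseteq> outside ?J" if "connected S" "S \<inter> ?J = {}" "d \<in> closure S" for S
  proof -
    have "S \<inter> outside ?J \<noteq> {}"
      using that(3)[unfolded closure_iff_nhds_not_empty, rule_format, OF order_refl _ d] jg by blast
    moreover have "inside ?J \<inter> outside ?J = {}" using jg by blast
    ultimately show ?thesis using connected_subset_inside_or_outside[OF that(1,2) clJ] by blast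
  qed
  have sp: "?ad - {a} \<subseteq> outside ?J" "?bd - {b} \<subseteq> outside ?J" "?cd - {c} \<subseteq> outside ?J"
  proof -
    have cs: "?ad - {a} \<subseteq> closure (?ad - {a})" "?bd - {b} \<subseteq> closure (?bd - {b})" "?cd - {c} \<subseteq> closure (?cd - {c})"
      by (rule closure_subset)+
    show "?ad - {a} \<subseteq> outside ?J"
      by (rule out) (use arcs ends connected_arc_endless[of ad "{a}"] K' cs ne mem in auto)
    show "?bd - {b} \<subseteq> outside ?J"
      by (rule out) (use arcs ends connected_arc_endless[of bd "{b}"] K' cs ne mem in auto)
    show "?cd - {c} \<subseteq> outside ?J"
      by (rule out) (use arcs ends connected_arc_endless[of cd "{c}"] K' cs ne mem in auto)
  qed
  have CO: "C \<subseteq> outside ?J" by (rule out) (use C cl in auto)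
  obtain z0 where z0: "z0 \<in> inside ?J" using jg by blast
  define \<phi> where "\<phi> = (\<lambda>z. inverse (z - z0))"
  have cont: "continuous_on (- {z0}) \<phi>" unfolding \<phi>_def by (auto intro!: continuous_intros)
  have inj: "inj_on \<phi> (- {z0})" unfolding \<phi>_def inj_on_def by simp
  let ?A = "?ab \<union> ?bc \<union> ?ac \<union> ?ad \<union> ?bd \<union> ?cd"
  have "z0 \<notin> ?J" "z0 \<notin> outside ?J" using z0 jg by blast+
  \<comment> \<open>The arcs run on or outside the triangle and the pole \<open>z0\<close> lies
    inside, so the inversion is continuous and injective on the whole drawing.\<close>
  then have A: "?A \<subseteq> - {z0}" using sp mem by blast
  have Cz: "C \<subseteq> - {z0}" using z0 jg CO by blast
  have K2: "K4_arcs (\<phi> a) (\<phi> b) (\<phi> c) (\<phi> d) (\<phi> \<circ> ab) (\<phi> \<circ> bc) (\<phi> \<circ> ac) (\<phi> \<circ> ad) (\<phi> \<circ> bd) (\<phi> \<circ> cd)"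
    by (rule K4_arcs_image[OF K cont inj A])
  have "\<phi> d \<in> inside (path_image (\<phi> \<circ> g))"
    unfolding \<phi>_def by (rule inversion_outside_to_inside[OF g]) (use z0 d gim in auto)
  then have "\<phi> d \<in> inside (path_image (\<phi> \<circ> ab) \<union> path_image (\<phi> \<circ> bc) \<union> path_image (\<phi> \<circ> ac))"
    unfolding path_image_compose gim image_Un .
  moreover have "connected (\<phi> ` C)"
    by (rule connected_continuous_image[OF continuous_on_subset[OF cont Cz] C(1)])
  moreover have "\<phi> ` C \<inter> (path_image (\<phi> \<circ> ab) \<union> path_image (\<phi> \<circ> bc) \<union> path_image (\<phi> \<circ> ac) \<union>
      path_image (\<phi> \<circ> ad) \<union> path_image (\<phi> \<circ> bd) \<union> path_image (\<phi> \<circ> cd)) = {}"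
    unfolding path_image_compose image_Un[symmetric] inj_on_image_Int[OF inj Cz A, symmetric] C(2) by simp
  moreover have "{\<phi> a, \<phi> b, \<phi> c, \<phi> d} \<subseteq> closure (\<phi> ` C)"
  proof -
    have "\<phi> ` (closure C \<inter> - {z0}) \<subseteq> closure (\<phi> ` C)"
    proof
      fix w assume "w \<in> \<phi> ` (closure C \<inter> - {z0})"
      then obtain x where x: "x \<in> closure C" "x \<noteq> z0" "w = \<phi> x" by auto
      obtain f where f: "\<And>n. f n \<in> C" "f \<longlonglongrightarrow> x" using x(1) unfolding closure_sequential by auto
      have "(\<lambda>n. \<phi> (f n)) \<longlonglongrightarrow> \<phi> x" unfolding \<phi>_def using f(2) x(2) by (auto intro!: tendsto_intros)
      then show "w \<in> closure (\<phi> ` C)" unfolding closure_sequential x(3) using f(1)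
        by (intro exI[of _ "\<lambda>n. \<phi> (f n)"]) auto
    qed
    moreover have "{a, b, c, d} \<subseteq> closure C \<inter> - {z0}" using cl A mem by blast
    ultimately show ?thesis by blast
  qed
  ultimately show False by (rule K4_arcs_inside[OF K2])
qed

text \<open>Contracting \<open>C\<close> would give a \<open>K\<^sub>5\<close>. Topologically, the
  edges along which \<open>C\<close> is connected stay in one component \<open>Q\<close> of the
  complement of the drawn \<open>K\<^sub>4\<close>; an edge from \<open>C\<close> to a corner,
  without that end, lies in \<open>Q\<close> as well and puts the corner into the closure.\<close>

lemma plane_drawing_no_common_face:
  assumes P: "plane_drawing P p \<gamma>" and dist: "distinct [a, b, c, d]"
    and V: "{a, b, c, d} \<union> C \<subseteq> uverts P" "C \<inter> {a, b, c, d} = {}" "x0 \<in> C"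
    and E: "{a, b} \<in> uedges P" "{b, c} \<in> uedges P" "{a, c} \<in> uedges P"
      "{a, d} \<in> uedges P" "{b, d} \<in> uedges P" "{c, d} \<in> uedges P"
    and con: "\<And>x. x \<in> C \<Longrightarrow> (x0, x) \<in> {(x, y). x \<in> C \<and> y \<in> C \<and> {x, y} \<in> uedges P}\<^sup>*"
    and att: "\<And>k. k \<in> {a, b, c, d} \<Longrightarrow> \<exists>x\<in>C. {x, k} \<in> uedges P"
  shows False
proof -
  let ?E = "uedges P"
  have inj: "inj_on p (uverts P)"
    and arc: "\<And>e. e \<in> ?E \<Longrightarrow> arc (\<gamma> e) \<and> {pathstart (\<gamma> e), pathfinish (\<gamma> e)} = p ` e \<and>
        path_image (\<gamma> e) \<inter> p ` uverts P = p ` e"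
    and meet: "\<And>e f. e \<in> ?E \<Longrightarrow> f \<in> ?E \<Longrightarrow> e \<noteq> f \<Longrightarrow> path_image (\<gamma> e) \<inter> path_image (\<gamma> f) = p ` (e \<inter> f)"
    using P unfolding plane_drawing_def by blast+
  \<comment> \<open>A drawing leaves the direction of an arc open; \<open>g x y\<close> is the arc
    of the edge run from \<open>x\<close> to \<open>y\<close>.\<close>
  define g where "g x y = (if pathstart (\<gamma> {x, y}) = p x then \<gamma> {x, y} else reversepath (\<gamma> {x, y}))" for x y
  have g: "arc (g x y) \<and> pathstart (g x y) = p x \<and> pathfinish (g x y) = p y" "path_image (g x y) = path_image (\<gamma> {x, y})"
    if xy: "{x, y} \<in> ?E" "x \<noteq> y" for x y
  proof -
    have "{pathstart (\<gamma> {x, y}), pathfinish (\<gamma> {x, y})} = {p x, p y}" using arc[OF xy(1)] by simp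
    then consider "pathstart (\<gamma> {x, y}) = p x" "pathfinish (\<gamma> {x, y}) = p y"
      | "pathstart (\<gamma> {x, y}) = p y" "pathfinish (\<gamma> {x, y}) = p x" "p x \<noteq> p y"
      unfolding doubleton_eq_iff by metis
    then show "arc (g x y) \<and> pathstart (g x y) = p x \<and> pathfinish (g x y) = p y" "path_image (g x y) = path_image (\<gamma> {x, y})"
      using arc[OF xy(1)] unfolding g_def by (cases, simp_all add: arc_reversepath)+
  qed
  let ?A = "path_image (g a b) \<union> path_image (g b c) \<union> path_image (g a c) \<union> path_image (g a d) \<union> path_image (g b d) \<union> path_image (g c d)"
  let ?F = "{{a, b}, {b, c}, {a, c}, {a, d}, {b, d}, {c, d}}"
  have gim: "path_image (g a b) = path_image (\<gamma> {a, b})" "path_image (g b c) = path_image (\<gamma> {b, c})"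
    "path_image (g a c) = path_image (\<gamma> {a, c})" "path_image (g a d) = path_image (\<gamma> {a, d})"
    "path_image (g b d) = path_image (\<gamma> {b, d})" "path_image (g c d) = path_image (\<gamma> {c, d})"
    using g(2) E dist by simp_all
  have A: "?A = (\<Union>e\<in>?F. path_image (\<gamma> e))" unfolding gim by (simp add: Un_assoc)
  have F: "e \<in> ?E" "e \<subseteq> {a, b, c, d}" if "e \<in> ?F" for e using that E by auto
  have K: "K4_arcs (p a) (p b) (p c) (p d) (g a b) (g b c) (g a c) (g a d) (g b d) (g c d)"
    unfolding K4_arcs_def gim
    using g(1) E dist by (simp add: meet doubleton_eq_iff Int_insert_left insert_commute) auto
  have off: "path_image (\<gamma> f) \<inter> ?A \<subseteq> p ` (f \<inter> {a, b, c, d})" if "f \<in> ?E" "f \<inter> C \<noteq> {}" for f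
  proof
    fix w assume "w \<in> path_image (\<gamma> f) \<inter> ?A"
    then obtain e where e: "e \<in> ?F" "w \<in> path_image (\<gamma> f)" "w \<in> path_image (\<gamma> e)" unfolding A by blast
    have "e \<noteq> f" using F(2)[OF e(1)] that(2) V(2) by blast
    then show "w \<in> p ` (f \<inter> {a, b, c, d})" using meet[OF that(1) F(1)[OF e(1)]] e F(2)[OF e(1)] by blast
  qed
  have pA: "p x \<notin> ?A" if "x \<in> C" for x
  proof
    assume "p x \<in> ?A"
    then obtain e where e: "e \<in> ?F" "p x \<in> path_image (\<gamma> e)" unfolding A by blast
    then have "p x \<in> p ` e" using arc[OF F(1)[OF e(1)]] that V(1) by blast
    then have "x \<in> e" using inj that V(1) F(2)[OF e(1)] unfolding inj_on_def by blast
    then show False using that V(2) F(2)[OF e(1)] by blast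
  qed
  define Q where "Q = connected_component_set (- ?A) (p x0)"
  have Q: "connected Q" "Q \<inter> ?A = {}" unfolding Q_def using connected_component_subset[of "- ?A" "p x0"] by (simp, blast)
  have grow: "B \<subseteq> Q" if B: "connected B" "B \<inter> ?A = {}" "B \<inter> Q \<noteq> {}" for B
  proof -
    obtain w where w: "w \<in> B" "w \<in> Q" using B(3) by blast
    have "B \<subseteq> connected_component_set (- ?A) w"
      using B(1,2) w(1) by (intro connected_component_maximal) auto
    also have "\<dots> = Q" using w(2) unfolding Q_def by (simp add: connected_component_eq)
    finally show ?thesis .
  qed
  have end_in: "p ` e \<subseteq> path_image (\<gamma> e)" if "e \<in> ?E" for e using arc[OF that] by blast
  have pQ: "p x \<in> Q" if x: "x \<in> C" for x
    using con[OF x]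
  proof induction
    case base then show ?case unfolding Q_def using pA[OF V(3)] by (simp add: connected_component_refl)
  next
    case (step y w)
    then have yw: "y \<in> C" "w \<in> C" "{y, w} \<in> ?E" by auto
    have "path_image (\<gamma> {y, w}) \<subseteq> Q"
    proof (rule grow)
      show "connected (path_image (\<gamma> {y, w}))" using arc[OF yw(3)] by (simp add: connected_arc_image)
      show "path_image (\<gamma> {y, w}) \<inter> ?A = {}" using off[OF yw(3)] yw(1,2) V(2) by blast
      show "path_image (\<gamma> {y, w}) \<inter> Q \<noteq> {}" using end_in[OF yw(3)] step.IH by blast
    qed
    then show ?case using end_in[OF yw(3)] by blast
  qed
  have "p k \<in> closure Q" if k: "k \<in> {a, b, c, d}" for k
  proof -
    obtain x where x: "x \<in> C" "{x, k} \<in> ?E" using att[OF k] by blast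
    note ar = arc[OF x(2)]
    have ne: "p x \<noteq> p k" using inj_onD[OF inj, of x k] x(1) k V by blast
    have ends: "p k \<in> {pathstart (\<gamma> {x, k}), pathfinish (\<gamma> {x, k})}" using ar by blast
    have "path_image (\<gamma> {x, k}) - {p k} \<subseteq> Q"
    proof (rule grow)
      show "connected (path_image (\<gamma> {x, k}) - {p k})" using ar ends by (intro connected_arc_endless) auto
      have "{x, k} \<inter> {a, b, c, d} \<subseteq> {k}" using x(1) V(2) by blast
      then show "(path_image (\<gamma> {x, k}) - {p k}) \<inter> ?A = {}" using off[OF x(2)] x(1) by blast
      show "(path_image (\<gamma> {x, k}) - {p k}) \<inter> Q \<noteq> {}" using end_in[OF x(2)] pQ[OF x(1)] ne by blast
    qed
    then have "path_image (\<gamma> {x, k}) - {pathstart (\<gamma> {x, k}), pathfinish (\<gamma> {x, k})} \<subseteq> Q" using ends by blast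
    from closure_mono[OF this] show ?thesis using closure_arc_endless[of "\<gamma> {x, k}"] ar end_in[OF x(2)] by blast
  qed
  then show False by (intro K4_arcs_no_common_face[OF K Q]) auto
qed

subsection \<open>A triangle with its centroid\<close>

text \<open>The determinant of two plane vectors, zero exactly if they are linearly dependent over
  the reals.\<close>

definition cross2 :: "complex \<Rightarrow> complex \<Rightarrow> real" where
  "cross2 a b = Re a * Im b - Im a * Re b"

text \<open>A line meets a circle in at most two points: if \<open>u\<close> is \<open>t\<close>
  times \<open>b\<close>, the circle equation along the line through \<open>q1\<close> and
  \<open>q2\<close> is quadratic in \<open>t\<close> with the roots 0 and 1, and \<open>q3\<close>
  would coincide with \<open>q1\<close> or \<open>q2\<close>.\<close>

lemma cross2_sphere_nonzero:
  assumes "q1 \<in> sphere c r" "q2 \<in> sphere c r" "q3 \<in> sphere c r" "q1 \<noteq> q2" "q1 \<noteq> q3" "q2 \<noteq> q3"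
  shows "cross2 (q2 - q1) (q3 - q1) \<noteq> 0"
proof
  assume 0: "cross2 (q2 - q1) (q3 - q1) = 0"
  define a b u where "a = q1 - c" and "b = q2 - q1" and "u = q3 - q1"
  have bu: "b \<noteq> 0" "u \<noteq> 0" "b \<noteq> u" using assms by (auto simp: b_def u_def)
  have n: "norm a = r" "norm (a + b) = r" "norm (a + u) = r"
    using assms by (auto simp: a_def b_def u_def dist_norm norm_minus_commute)
  have e: "(norm w)\<^sup>2 = Re w * Re w + Im w * Im w" for w by (simp add: cmod_def power2_eq_square)
  have e1: "2 * (Re a * Re b + Im a * Im b) + (Re b * Re b + Im b * Im b) = 0"
    using e[of a] e[of "a + b"] n(1,2) by (simp add: algebra_simps)
  have e2: "2 * (Re a * Re u + Im a * Im u) + (Re u * Re u + Im u * Im u) = 0"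
    using e[of a] e[of "a + u"] n(1,3) by (simp add: algebra_simps)
  have z: "Re b * Im u = Im b * Re u" using 0 by (simp add: cross2_def b_def u_def)
  obtain t where t: "u = of_real t * b"
  proof -
    \<comment> \<open>The factor is read off from a coordinate of \<open>b\<close> that is not zero;
      the vanishing determinant makes the other coordinate agree.\<close>
    have "u = of_real (if Re b \<noteq> 0 then Re u / Re b else Im u / Im b) * b"
      using z bu by (auto simp: complex_eq_iff field_simps)
    then show ?thesis using that by blast
  qed
  have ru: "Re u = t * Re b" "Im u = t * Im b" using t by auto
  have "t * (2 * (Re a * Re b + Im a * Im b) + t * (Re b * Re b + Im b * Im b)) = 0"
    using e2 unfolding ru by (simp add: algebra_simps)
  moreover have "t \<noteq> 0" using bu ru t by auto
  ultimately have "2 * (Re a * Re b + Im a * Im b) + t * (Re b * Re b + Im b * Im b) = 0" by simp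
  then have "(t - 1) * (Re b * Re b + Im b * Im b) = 0" using e1 by (simp add: algebra_simps)
  moreover have "Re b * Re b + Im b * Im b \<noteq> 0" using bu(1) by (simp add: sum_squares_eq_zero_iff complex_eq_iff)
  ultimately have "t = 1" by auto
  then show False using t bu(3) by simp
qed

text \<open>Cramer's rule for \<open>x - q1\<close> in the basis \<open>q2 - q1\<close>,
  \<open>q3 - q1\<close>. Uniqueness yields the coordinates of given points, and affinity turns
  lying on a segment into equations between coordinates.\<close>

lemma barycentric_coordinates:
  assumes "cross2 (q2 - q1) (q3 - q1) \<noteq> 0"
  obtains m1 m2 m3 :: "complex \<Rightarrow> real" where
    "\<And>x. m1 x + m2 x + m3 x = 1" "\<And>x. x = m1 x *\<^sub>R q1 + m2 x *\<^sub>R q2 + m3 x *\<^sub>R q3"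
    "\<And>x s t u. s + t + u = 1 \<Longrightarrow> x = s *\<^sub>R q1 + t *\<^sub>R q2 + u *\<^sub>R q3 \<Longrightarrow> m1 x = s \<and> m2 x = t \<and> m3 x = u"
    "\<And>x y t. m1 ((1 - t) *\<^sub>R x + t *\<^sub>R y) = (1 - t) * m1 x + t * m1 y"
    "\<And>x y t. m2 ((1 - t) *\<^sub>R x + t *\<^sub>R y) = (1 - t) * m2 x + t * m2 y"
    "\<And>x y t. m3 ((1 - t) *\<^sub>R x + t *\<^sub>R y) = (1 - t) * m3 x + t * m3 y"
proof -
  define D where "D = cross2 (q2 - q1) (q3 - q1)"
  define l2 where "l2 x = cross2 (x - q1) (q3 - q1) / D" for x
  define l3 where "l3 x = cross2 (q2 - q1) (x - q1) / D" for x
  have D: "D \<noteq> 0" using assms by (simp add: D_def)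
  have lin: "l2 ((1 - t) *\<^sub>R x + t *\<^sub>R y) = (1 - t) * l2 x + t * l2 y"
    "l3 ((1 - t) *\<^sub>R x + t *\<^sub>R y) = (1 - t) * l3 x + t * l3 y" for x y t
    using D by (simp_all add: l2_def l3_def cross2_def field_simps)
  have rep: "x - q1 = l2 x *\<^sub>R (q2 - q1) + l3 x *\<^sub>R (q3 - q1)" for x
  proof -
    have Dl: "D * l2 x = cross2 (x - q1) (q3 - q1)" "D * l3 x = cross2 (q2 - q1) (x - q1)"
      unfolding l2_def l3_def using D by simp_all
    have "D *\<^sub>R (x - q1) = (D * l2 x) *\<^sub>R (q2 - q1) + (D * l3 x) *\<^sub>R (q3 - q1)"
      unfolding Dl by (simp add: D_def cross2_def complex_eq_iff algebra_simps)
    then have "D *\<^sub>R (x - q1) = D *\<^sub>R (l2 x *\<^sub>R (q2 - q1) + l3 x *\<^sub>R (q3 - q1))" by (simp add: scaleR_add_right)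
    then show ?thesis using D by (simp only: scaleR_cancel_left) simp
  qed
  have un: "l2 x = t \<and> l3 x = u" if "s + t + u = 1" "x = s *\<^sub>R q1 + t *\<^sub>R q2 + u *\<^sub>R q3" for x s t u
  proof -
    have s: "s = 1 - t - u" using that(1) by simp
    have x: "x - q1 = t *\<^sub>R (q2 - q1) + u *\<^sub>R (q3 - q1)" unfolding that(2) s by (simp add: algebra_simps)
    have "cross2 (t *\<^sub>R (q2 - q1) + u *\<^sub>R (q3 - q1)) (q3 - q1) = t * D"
      "cross2 (q2 - q1) (t *\<^sub>R (q2 - q1) + u *\<^sub>R (q3 - q1)) = u * D"
      by (simp_all add: D_def cross2_def algebra_simps)
    then show ?thesis unfolding l2_def l3_def x using D by simp
  qed
  show ?thesis
  proof (rule that[of "\<lambda>x. 1 - l2 x - l3 x" l2 l3])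
    show "x = (1 - l2 x - l3 x) *\<^sub>R q1 + l2 x *\<^sub>R q2 + l3 x *\<^sub>R q3" for x
      using rep[of x] by (simp add: algebra_simps)
    show "1 - l2 x - l3 x = s \<and> l2 x = t \<and> l3 x = u"
      if "s + t + u = 1" "x = s *\<^sub>R q1 + t *\<^sub>R q2 + u *\<^sub>R q3" for x s t u
      using un[OF that] that(1) by simp
  qed (use lin in \<open>simp_all add: algebra_simps\<close>)
qed

text \<open>In barycentric coordinates the three sides are given by one vanishing coordinate, and the
  spoke to a corner by two equal coordinates below the third.\<close>

definition bary_segment :: "(real \<times> real \<times> real) set \<Rightarrow> real \<Rightarrow> real \<Rightarrow> real \<Rightarrow> bool" where
  "bary_segment W v1 v2 v3 \<longleftrightarrow>
     W = {(1, 0, 0), (0, 1, 0)} \<and> v3 = 0 \<or> W = {(1, 0, 0), (0, 0, 1)} \<and> v2 = 0 \<or>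
     W = {(0, 1, 0), (0, 0, 1)} \<and> v1 = 0 \<or>
     W = {(1, 0, 0), (1/3, 1/3, 1/3)} \<and> v2 = v3 \<and> v2 \<le> v1 \<or>
     W = {(0, 1, 0), (1/3, 1/3, 1/3)} \<and> v1 = v3 \<and> v1 \<le> v2 \<or>
     W = {(0, 0, 1), (1/3, 1/3, 1/3)} \<and> v1 = v2 \<and> v1 \<le> v3"

lemma bary_segmentI:
  fixes w x :: "real \<times> real \<times> real"
  assumes "w \<in> {(1, 0, 0), (0, 1, 0), (0, 0, 1), (1/3, 1/3, 1/3)}"
    "x \<in> {(1, 0, 0), (0, 1, 0), (0, 0, 1), (1/3, 1/3, 1/3)}" "w \<noteq> x" "0 \<le> s" "s \<le> 1"
  shows "bary_segment {w, x} ((1 - s) * fst w + s * fst x)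
    ((1 - s) * fst (snd w) + s * fst (snd x)) ((1 - s) * snd (snd w) + s * snd (snd x))"
  using assms(1-3) unfolding bary_segment_def
  by (elim insertE emptyE) (use assms(4,5) in \<open>simp_all add: doubleton_eq_iff field_simps\<close>)

text \<open>Two different conditions of the list, together with the sum 1, fix the common endpoint
  of the two segments; for a side and the spoke to the opposite corner they contradict each
  other.\<close>

lemma bary_segment_Int:
  assumes "bary_segment W v1 v2 v3" "bary_segment X v1 v2 v3" "W \<noteq> X" "v1 + v2 + v3 = 1"
  shows "(v1, v2, v3) \<in> W \<inter> X"
  using assms unfolding bary_segment_def by (elim disjE conjE) simp_all

text \<open>The straight-line drawing of \<open>K\<^sub>4\<close> to be used inside a disc: three
  corners where the edges leave, and the centroid for a pendant edge. Lying on a circle makes the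
  corners affinely independent, and in barycentric coordinates the absence of crossings is a finite
  check.\<close>

lemma triangle_with_centroid:
  fixes q1 q2 q3 :: complex
  assumes q: "q1 \<in> sphere c r" "q2 \<in> sphere c r" "q3 \<in> sphere c r" "q1 \<noteq> q2" "q1 \<noteq> q3" "q2 \<noteq> q3"
    and Q: "Q = {q1, q2, q3, (q1 + q2 + q3) /\<^sub>R 3}"
    and w: "w \<in> Q" "x \<in> Q" "y \<in> Q" "z \<in> Q" "w \<noteq> x" "y \<noteq> z" "{w, x} \<noteq> {y, z}"
  shows "closed_segment w x \<inter> closed_segment y z \<subseteq> {w, x} \<inter> {y, z}"
proof
  fix v assume v: "v \<in> closed_segment w x \<inter> closed_segment y z"
  obtain s where s: "0 \<le> s" "s \<le> 1" "v = (1 - s) *\<^sub>R w + s *\<^sub>R x" using v by (auto simp: in_segment)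
  obtain t where t: "0 \<le> t" "t \<le> 1" "v = (1 - t) *\<^sub>R y + t *\<^sub>R z" using v by (auto simp: in_segment)
  obtain l1 l2 l3 :: "complex \<Rightarrow> real" where sum1: "\<And>x. l1 x + l2 x + l3 x = 1"
    and rep: "\<And>x. x = l1 x *\<^sub>R q1 + l2 x *\<^sub>R q2 + l3 x *\<^sub>R q3"
    and un: "\<And>x s t u. s + t + u = 1 \<Longrightarrow> x = s *\<^sub>R q1 + t *\<^sub>R q2 + u *\<^sub>R q3 \<Longrightarrow> l1 x = s \<and> l2 x = t \<and> l3 x = u"
    and lin: "\<And>x y t. l1 ((1 - t) *\<^sub>R x + t *\<^sub>R y) = (1 - t) * l1 x + t * l1 y"
      "\<And>x y t. l2 ((1 - t) *\<^sub>R x + t *\<^sub>R y) = (1 - t) * l2 x + t * l2 y"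
      "\<And>x y t. l3 ((1 - t) *\<^sub>R x + t *\<^sub>R y) = (1 - t) * l3 x + t * l3 y"
    by (rule barycentric_coordinates[OF cross2_sphere_nonzero[OF q]]) (rule that)
  let ?m = "(q1 + q2 + q3) /\<^sub>R 3"
  have l: "l1 q1 = 1" "l2 q1 = 0" "l3 q1 = 0" "l1 q2 = 0" "l2 q2 = 1" "l3 q2 = 0"
    "l1 q3 = 0" "l2 q3 = 0" "l3 q3 = 1" "l1 ?m = 1/3" "l2 ?m = 1/3" "l3 ?m = 1/3"
    using un[of 1 0 0 q1] un[of 0 1 0 q2] un[of 0 0 1 q3] un[of "1/3" "1/3" "1/3" ?m] 
    by (simp_all add: scaleR_add_right)
  have eq: "a = b" if "l1 a = l1 b" "l2 a = l2 b" "l3 a = l3 b" for a b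
    using rep[of a] rep[of b] that by metis
  define L where "L a = (l1 a, l2 a, l3 a)" for a
  have Linj: "L a = L b \<longleftrightarrow> a = b" for a b using eq unfolding L_def by auto
  have LQ: "L a \<in> {(1,0,0), (0,1,0), (0,0,1), (1/3,1/3,1/3)}" if "a \<in> Q" for a
    using that l unfolding Q L_def by auto
  have v1: "l1 v = (1 - s) * l1 w + s * l1 x" "l2 v = (1 - s) * l2 w + s * l2 x" "l3 v = (1 - s) * l3 w + s * l3 x"
    and v2: "l1 v = (1 - t) * l1 y + t * l1 z" "l2 v = (1 - t) * l2 y + t * l2 z" "l3 v = (1 - t) * l3 y + t * l3 z"
    using lin s(3) t(3) by metis+
  have "bary_segment {L w, L x} (l1 v) (l2 v) (l3 v)"
    using bary_segmentI[OF LQ[OF w(1)] LQ[OF w(2)] _ s(1,2)] w(5) unfolding Linj v1 by (simp add: L_def)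
  moreover have "bary_segment {L y, L z} (l1 v) (l2 v) (l3 v)"
    using bary_segmentI[OF LQ[OF w(3)] LQ[OF w(4)] _ t(1,2)] w(6) unfolding Linj v2 by (simp add: L_def)
  moreover have "{L w, L x} \<noteq> {L y, L z}" using w(7) by (auto simp: doubleton_eq_iff Linj)
  ultimately have "L v \<in> {L w, L x} \<inter> {L y, L z}" unfolding L_def[of v] by (rule bary_segment_Int[OF _ _ _ sum1])
  then show "v \<in> {w, x} \<inter> {y, z}" by (simp add: Linj)
qed

subsection \<open>Subdivided cubic graphs with pendant edges\<close>

lemma simple_graph_finite_edges: "simple_graph G \<Longrightarrow> finite (uedges G)"
  unfolding simple_graph_def by (rule finite_subset[of _ "Pow (uverts G)"]) auto

lemma simple_graph_edge_Int:
  assumes "simple_graph G" "e \<in> uedges G" "f \<in> uedges G" "e \<noteq> f" "x \<in> e" "x \<in> f"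
  shows "e \<inter> f = {x}"
proof -
  obtain a where "e = {x, a}" using simple_graph_edgeE[OF assms(1,2)] assms(5) by blast
  moreover obtain b where "f = {x, b}" using simple_graph_edgeE[OF assms(1,3)] assms(6) by blast
  ultimately show ?thesis using assms(4) by auto
qed

text \<open>Both operations at once. Pendant edges may be added at the vertices of \<open>H\<close>
  itself, since by \<open>subdivides_then_pendants_iff\<close> these are exactly the vertices of
  degree 3 after the subdivision when \<open>H\<close> is cubic.\<close>

locale decorated_graph =
  fixes H :: "'a ugraph" and S :: "'a set set" and z :: "'a set \<Rightarrow> 'a" and U :: "'a set" and l :: "'a \<Rightarrow> 'a"
  assumes simple: "simple_graph H" and S: "S \<subseteq> uedges H"
    and inj_z: "inj_on z S" and fresh_z: "z ` S \<inter> uverts H = {}"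
    and U: "U \<subseteq> uverts H" and inj_l: "inj_on l U" and fresh_l: "l ` U \<inter> (uverts H \<union> z ` S) = {}"
begin

text \<open>\<open>piece v e\<close> is the part of the edge \<open>e\<close> incident with its endpoint \<open>v\<close> after the subdivision.\<close>

definition piece :: "'a \<Rightarrow> 'a set \<Rightarrow> 'a set" where
  "piece v e = (if e \<in> S then {v, z e} else e)"

definition decorated :: "'a ugraph" where
  "decorated = \<lparr>uverts = uverts H \<union> z ` S \<union> l ` U,
     uedges = {piece v e | v e. e \<in> uedges H \<and> v \<in> e} \<union> {{u, l u} | u. u \<in> U}\<rparr>"

definition star :: "'a \<Rightarrow> 'a set set" where
  "star v = {f \<in> uedges decorated. v \<in> f}"

lemma edge_verts: "e \<in> uedges H \<Longrightarrow> v \<in> e \<Longrightarrow> v \<in> uverts H"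
  using simple unfolding simple_graph_def by blast

lemma decorated_edgeE:
  assumes "f \<in> uedges decorated"
  obtains (piece) v e where "f = piece v e" "e \<in> uedges H" "v \<in> e"
    | (pendant) u where "f = {u, l u}" "u \<in> U"
  using assms unfolding decorated_def by auto

lemma piece_in: "e \<in> uedges H \<Longrightarrow> v \<in> e \<Longrightarrow> piece v e \<in> uedges decorated"
  and pendant_in: "u \<in> U \<Longrightarrow> {u, l u} \<in> uedges decorated"
  unfolding decorated_def by auto

lemma z_notin: "e \<in> S \<Longrightarrow> z e \<notin> uverts H" and l_notin: "u \<in> U \<Longrightarrow> l u \<notin> uverts H"
  and l_neq_z: "u \<in> U \<Longrightarrow> e \<in> S \<Longrightarrow> l u \<noteq> z e"
  using fresh_z fresh_l by auto

lemma piece_Int_verts: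
  assumes "e \<in> uedges H" "v \<in> e"
  shows "piece v e \<inter> uverts H = (if e \<in> S then {v} else e)"
  using assms edge_verts z_notin unfolding piece_def by auto

lemma mem_piece_iff:
  assumes "e \<in> uedges H" "v \<in> e" "x \<in> uverts H"
  shows "x \<in> piece v e \<longleftrightarrow> x \<in> e \<and> piece v e = piece x e"
  using assms z_notin unfolding piece_def by (auto simp: doubleton_eq_iff)

lemma pendant_neq_piece:
  assumes "u \<in> U" "e \<in> uedges H" "v \<in> e"
  shows "{u, l u} \<noteq> piece v e"
  using assms edge_verts[of e] l_notin[of u] l_neq_z[of u] unfolding piece_def by (auto simp: doubleton_eq_iff)

lemma piece_eq_iff:
  assumes "e \<in> uedges H" "v \<in> e" "f \<in> uedges H" "w \<in> f"
  shows "piece v e = piece w f \<longleftrightarrow> e = f \<and> (v = w \<or> e \<notin> S)"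
proof
  assume eq: "piece v e = piece w f"
  have vw: "v \<in> uverts H" "w \<in> uverts H" using assms edge_verts by auto
  show "e = f \<and> (v = w \<or> e \<notin> S)"
  proof (cases "e \<in> S")
    case True
    have "f \<in> S" using eq True z_notin[OF True] edge_verts[OF assms(3)] unfolding piece_def by (auto split: if_splits)
    then show ?thesis using eq True vw z_notin inj_z unfolding piece_def
      by (auto simp: doubleton_eq_iff inj_on_def)
  next
    case False
    have "f \<notin> S" using eq False z_notin edge_verts[OF assms(1)] unfolding piece_def by (auto split: if_splits)
    then show ?thesis using eq False unfolding piece_def by auto
  qed
qed (auto simp: piece_def)

lemma simple_decorated: "simple_graph decorated"
proof -
  have "finite S" using S simple_graph_finite_edges[OF simple] finite_subset by blast
  moreover have "finite U" using U simple finite_subset unfolding simple_graph_def by blast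
  moreover have "f \<subseteq> uverts decorated \<and> card f = 2" if "f \<in> uedges decorated" for f
    using that
  proof (cases rule: decorated_edgeE)
    case (piece v e)
    then have "v \<in> uverts H" "e \<subseteq> uverts H" "card e = 2" using simple unfolding simple_graph_def by auto
    moreover have "v \<noteq> z e" if "e \<in> S" using z_notin[OF that] \<open>v \<in> uverts H\<close> by auto
    ultimately show ?thesis using piece(1) unfolding piece_def decorated_def by auto
  next
    case (pendant u)
    then have "u \<noteq> l u" using U l_notin by (metis subsetD)
    then show ?thesis using pendant U unfolding decorated_def by auto
  qed
  ultimately show ?thesis using simple unfolding simple_graph_def decorated_def by auto
qed

lemma star_eq:
  assumes "v \<in> uverts H"
  shows "star v = piece v ` {e \<in> uedges H. v \<in> e} \<union> (if v \<in> U then {{v, l v}} else {})"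
proof (intro equalityI subsetI)
  fix f assume f: "f \<in> star v"
  then have "f \<in> uedges decorated" "v \<in> f" unfolding star_def by auto
  then show "f \<in> piece v ` {e \<in> uedges H. v \<in> e} \<union> (if v \<in> U then {{v, l v}} else {})"
  proof (cases rule: decorated_edgeE)
    case (piece w e)
    then show ?thesis using mem_piece_iff[OF piece(2,3) assms] \<open>v \<in> f\<close> by auto
  next
    case (pendant u)
    then show ?thesis using \<open>v \<in> f\<close> l_notin assms by auto
  qed
next
  fix f assume f: "f \<in> piece v ` {e \<in> uedges H. v \<in> e} \<union> (if v \<in> U then {{v, l v}} else {})"
  have "v \<in> piece v e" if "v \<in> e" for e using that unfolding piece_def by auto
  then show "f \<in> star v" using f piece_in pendant_in unfolding star_def by (auto split: if_splits)
qed

lemma decorated_edge_in_star: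
  assumes "f \<in> uedges decorated"
  obtains v where "v \<in> uverts H" "f \<in> star v"
  using assms
proof (cases rule: decorated_edgeE)
  case (piece v e)
  then have "v \<in> f" "v \<in> uverts H" using edge_verts unfolding piece_def by auto
  then show ?thesis using that assms unfolding star_def by auto
next
  case (pendant u)
  then show ?thesis using that assms U unfolding star_def by auto
qed

text \<open>The common vertex is a vertex of \<open>H\<close>, a subdivision vertex or a leaf, and a
  leaf lies in one edge only. So the edges of the line graph are those of the cliques at the
  vertices of \<open>H\<close> and one more for each subdivided edge.\<close>

lemma decorated_edge_Int:
  assumes f: "f \<in> uedges decorated" "g \<in> uedges decorated" "f \<noteq> g" "f \<inter> g \<noteq> {}"
  obtains (vertex) v where "v \<in> uverts H" "f \<in> star v" "g \<in> star v" "f \<inter> g = {v}"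
    | (halves) e v w where "e \<in> S" "e = {v, w}" "f = piece v e" "g = piece w e"
proof -
  obtain y where y: "y \<in> f" "y \<in> g" using f(4) by blast
  have fg: "f \<inter> g = {y}" by (rule simple_graph_edge_Int[OF simple_decorated f(1-3) y])
  consider "y \<in> uverts H" | e where "e \<in> S" "y = z e" | u where "u \<in> U" "y = l u"
  proof -
    have "y \<in> uverts decorated" using simple_decorated f(1) y(1) unfolding simple_graph_def by blast
    then show ?thesis using that unfolding decorated_def by auto
  qed
  then show ?thesis
  proof cases
    case 1 then show ?thesis using vertex fg f y unfolding star_def by blast
  next
    case (2 e)
    have *: "\<exists>v\<in>e. h = piece v e" if h: "h \<in> uedges decorated" "y \<in> h" for h
      using h(1)
    proof (cases rule: decorated_edgeE)
      case (piece v e')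
      have "y \<noteq> v" "y \<notin> e'" using 2 z_notin edge_verts[OF piece(2)] piece(3) by blast+
      then have "e' \<in> S" "y = z e'" using h(2) piece(1) unfolding piece_def by (auto split: if_splits)
      then show ?thesis using piece 2 inj_z by (auto dest: inj_onD)
    next
      case (pendant u)
      then have "y \<noteq> u" "y \<noteq> l u" using 2 U z_notin[OF 2(1)] l_neq_z[of u e] by auto
      then show ?thesis using h(2) pendant by simp
    qed
    obtain v w where vw: "v \<in> e" "f = piece v e" "w \<in> e" "g = piece w e" using *[OF f(1) y(1)] *[OF f(2) y(2)] by blast
    then have "v \<noteq> w" using f(3) by blast
    then have "e = {v, w}" using simple_graph_edgeE[OF simple, of e] S 2(1) vw by blast
    then show ?thesis using halves 2(1) vw by blast
  next
    case (3 u)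
    have "h = {u, l u}" if h: "h \<in> uedges decorated" "y \<in> h" for h
      using h(1)
    proof (cases rule: decorated_edgeE)
      case (piece v e')
      then show ?thesis using h(2) 3 l_notin[OF 3(1)] l_neq_z[OF 3(1)] edge_verts[OF piece(2)] unfolding piece_def
        by (auto split: if_splits)
    next
      case (pendant u')
      then show ?thesis using h(2) 3 U l_notin inj_l by (auto dest: inj_onD)
    qed
    then show ?thesis using f y by blast
  qed
qed

lemma pieces_eq: "{piece v e | v e. e \<in> uedges H \<and> v \<in> e} = (uedges H - S) \<union> {{x, z e} | x e. e \<in> S \<and> x \<in> e}"
proof (intro equalityI subsetI)
  fix f assume "f \<in> (uedges H - S) \<union> {{x, z e} | x e. e \<in> S \<and> x \<in> e}"
  then consider "f \<in> uedges H - S" | x e where "e \<in> S" "x \<in> e" "f = {x, z e}" by blast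
  then show "f \<in> {piece v e | v e. e \<in> uedges H \<and> v \<in> e}"
  proof cases
    case 1
    then obtain x y where "f = {x, y}" using simple_graph_edgeE[OF simple, of f] by blast
    then have "x \<in> f" "f = piece x f" using 1 unfolding piece_def by auto
    then show ?thesis using 1 by blast
  next
    case 2
    then have "f = piece x e" "e \<in> uedges H" using S unfolding piece_def by auto
    then show ?thesis using 2(2) by blast
  qed
qed (auto simp: piece_def split: if_splits)

lemma card_star:
  assumes "v \<in> uverts H"
  shows "card (star v) = vdegree H v + (if v \<in> U then 1 else 0)"
proof -
  have fin: "finite {e \<in> uedges H. v \<in> e}" using simple_graph_finite_edges[OF simple] by simp
  have "inj_on (piece v) {e \<in> uedges H. v \<in> e}" by (rule inj_onI) (auto simp: piece_eq_iff)
  then have c: "card (piece v ` {e \<in> uedges H. v \<in> e}) = vdegree H v"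
    unfolding vdegree_def by (rule card_image)
  show ?thesis
  proof (cases "v \<in> U")
    case True
    then have "{v, l v} \<notin> piece v ` {e \<in> uedges H. v \<in> e}" using pendant_neq_piece by blast
    then show ?thesis using True c fin unfolding star_eq[OF assms] by simp
  qed (use c star_eq[OF assms] in simp)
qed

end

text \<open>Subdividing keeps the degree 3 of the old vertices and gives the new ones degree at most
  2. Hence the intermediate graph \<open>K\<close> restricts the choice of \<open>U\<close> to
  subsets of \<open>uverts H\<close> and to nothing smaller.\<close>

lemma subdivides_then_pendants_iff:
  fixes H :: "'a ugraph"
  assumes H: "simple_graph H" "cubic H"
  shows "(\<exists>K. subdivides_edges_at_most_once H K \<and> adds_pendants_at_degree_3 K G) \<longleftrightarrow>
    (\<exists>S z U l. decorated_graph H S z U l \<and> G = decorated_graph.decorated H S z U l)"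
proof -
  have deg: "(u \<in> uverts H \<union> z ` S \<and> vdegree K u = 3) \<longleftrightarrow> u \<in> uverts H"
    and un: "decorated_graph.decorated H S z U l = \<lparr>uverts = uverts K \<union> l ` U, uedges = uedges K \<union> {{u, l u} | u. u \<in> U}\<rparr>"
    if D: "decorated_graph H S z U l" and K: "K = \<lparr>uverts = uverts H \<union> z ` S, uedges = (uedges H - S) \<union> {{x, z e} | x e. e \<in> S \<and> x \<in> e}\<rparr>"
    for S z U l K u
  proof -
    interpret decorated_graph H S z U l by (rule D)
    \<comment> \<open>Without pendant edges the decorated graph has the edges of \<open>K\<close>,
      so \<open>card_star\<close> gives degrees in \<open>K\<close>.\<close>
    interpret K: decorated_graph H S z "{}" l using D unfolding decorated_graph_def by auto
    have e: "uedges K = {K.piece v e | v e. e \<in> uedges H \<and> v \<in> e}" unfolding K K.pieces_eq by simp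
    have Kd: "uedges K = uedges K.decorated" unfolding e K.decorated_def by simp
    show "decorated = \<lparr>uverts = uverts K \<union> l ` U, uedges = uedges K \<union> {{u, l u} | u. u \<in> U}\<rparr>"
      unfolding e decorated_def by (simp add: K)
    have "vdegree K u = card (K.star u)" for u unfolding vdegree_def K.star_def Kd ..
    then have d3: "vdegree K u = 3" if "u \<in> uverts H" for u
      using K.card_star[OF that] H(2) that unfolding cubic_def by simp
    \<comment> \<open>By injectivity of \<open>z\<close>, every edge at \<open>z e\<close> joins it
      to one of the two ends of \<open>e\<close>.\<close>
    have "vdegree K (z e) \<le> 2" if "e \<in> S" for e
    proof -
      have "{f \<in> uedges K. z e \<in> f} \<subseteq> (\<lambda>x. {x, z e}) ` e"
      proof
        fix f assume "f \<in> {f \<in> uedges K. z e \<in> f}"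
        then obtain v e' where f: "f = K.piece v e'" "e' \<in> uedges H" "v \<in> e'" "z e \<in> f" unfolding e by blast
        have "z e \<notin> e'" "z e \<noteq> v" using f that z_notin edge_verts by blast+
        then have "e' \<in> S" "z e = z e'" using f unfolding K.piece_def by (auto split: if_splits)
        then show "f \<in> (\<lambda>x. {x, z e}) ` e" using f that inj_z unfolding K.piece_def by (auto dest: inj_onD)
      qed
      moreover have "card e = 2" using that S simple unfolding simple_graph_def by blast
      moreover have "finite e" using calculation(2) by (metis card.infinite zero_neq_numeral)
      ultimately have "card {f \<in> uedges K. z e \<in> f} \<le> card ((\<lambda>x. {x, z e}) ` e)"
        "card ((\<lambda>x. {x, z e}) ` e) \<le> 2" using card_mono[of "(\<lambda>x. {x, z e}) ` e"] card_image_le[of e "\<lambda>x. {x, z e}"] by auto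
      then show ?thesis unfolding vdegree_def by linarith
    qed
    then show "(u \<in> uverts H \<union> z ` S \<and> vdegree K u = 3) \<longleftrightarrow> u \<in> uverts H" using d3 by fastforce
  qed
  show ?thesis
  proof
    assume "\<exists>K. subdivides_edges_at_most_once H K \<and> adds_pendants_at_degree_3 K G"
    then obtain K S z U l where K: "K = \<lparr>uverts = uverts H \<union> z ` S, uedges = (uedges H - S) \<union> {{x, z e} | x e. e \<in> S \<and> x \<in> e}\<rparr>"
      and S: "S \<subseteq> uedges H" "inj_on z S" "z ` S \<inter> uverts H = {}"
      and U: "U \<subseteq> {u \<in> uverts K. vdegree K u = 3}" "inj_on l U" "l ` U \<inter> uverts K = {}"
      and G: "G = \<lparr>uverts = uverts K \<union> l ` U, uedges = uedges K \<union> {{u, l u} | u. u \<in> U}\<rparr>"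
      unfolding subdivides_edges_at_most_once_def adds_pendants_at_degree_3_def by blast
    have "decorated_graph H S z {} l" using H(1) S unfolding decorated_graph_def by auto
    then have "U \<subseteq> uverts H" using deg[OF _ K] U(1) by (auto simp: K)
    then have D: "decorated_graph H S z U l" using H(1) S U K unfolding decorated_graph_def by auto
    then show "\<exists>S z U l. decorated_graph H S z U l \<and> G = decorated_graph.decorated H S z U l"
      by (intro exI[of _ S] exI[of _ z] exI[of _ U] exI[of _ l]) (simp only: D un[OF D K] G)
  next
    assume "\<exists>S z U l. decorated_graph H S z U l \<and> G = decorated_graph.decorated H S z U l"
    then obtain S z U l where D: "decorated_graph H S z U l" and G: "G = decorated_graph.decorated H S z U l" by blast
    define K where "K = \<lparr>uverts = uverts H \<union> z ` S, uedges = (uedges H - S) \<union> {{x, z e} | x e. e \<in> S \<and> x \<in> e}\<rparr>"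
    note D' = D[unfolded decorated_graph_def]
    have "subdivides_edges_at_most_once H K"
      unfolding subdivides_edges_at_most_once_def K_def using D' by (intro exI[of _ S] exI[of _ z]) auto
    moreover have "adds_pendants_at_degree_3 K G"
      unfolding adds_pendants_at_degree_3_def
    proof (intro exI[of _ U] exI[of _ l] conjI)
      show "U \<subseteq> {u \<in> uverts K. vdegree K u = 3}" using deg[OF D K_def] D' by (auto simp: K_def)
      show "l ` U \<inter> uverts K = {}" using D' by (simp add: K_def)
      show "G = \<lparr>uverts = uverts K \<union> l ` U, uedges = uedges K \<union> {{u, l u} | u. u \<in> U}\<rparr>"
        unfolding G by (rule un[OF D K_def])
    qed (use D' in auto)
    ultimately show "\<exists>K. subdivides_edges_at_most_once H K \<and> adds_pendants_at_degree_3 K G" by blast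
  qed
qed

subsection \<open>Drawing the line graph\<close>

lemma line_graph_simps [simp]:
  "uverts (line_graph G) = uedges G"
  "uedges (line_graph G) = {{e, f} | e f. e \<in> uedges G \<and> f \<in> uedges G \<and> e \<noteq> f \<and> e \<inter> f \<noteq> {}}"
  unfolding line_graph_def by simp_all

lemma line_graph_edgeI:
  "e \<in> uedges G \<Longrightarrow> f \<in> uedges G \<Longrightarrow> e \<noteq> f \<Longrightarrow> x \<in> e \<Longrightarrow> x \<in> f \<Longrightarrow> {e, f} \<in> uedges (line_graph G)"
  by auto

lemma simple_line_graph: "simple_graph G \<Longrightarrow> simple_graph (line_graph G)"
  using simple_graph_finite_edges[of G] unfolding simple_graph_def[of "line_graph G"] line_graph_simps by (auto intro!: card_2_iff[THEN iffD2])

text \<open>A mean, with weights 2/3 and 1/3, of the midpoint of a chord, which is strictly inside,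
  and of a point on the circle.\<close>

lemma centroid_in_ball:
  fixes q1 q2 q3 c :: complex
  assumes q: "q1 \<in> sphere c r" "q2 \<in> sphere c r" "q3 \<in> sphere c r" "q1 \<noteq> q2"
  shows "(q1 + q2 + q3) /\<^sub>R 3 \<in> ball c r"
proof -
  let ?m = "(1/2) *\<^sub>R q1 + (1/2) *\<^sub>R q2"
  have "?m \<in> open_segment q1 q2" unfolding in_segment using q(4) by (intro conjI exI[of _ "1/2"]) auto
  from dist_decreases_open_segment[OF this, of c] have m: "dist c ?m < r" using q by auto
  have "(q1 + q2 + q3) /\<^sub>R 3 - c = (2/3) *\<^sub>R (?m - c) + (1/3) *\<^sub>R (q3 - c)"
    by (simp add: algebra_simps flip: scaleR_add_left)
  then have "norm ((q1 + q2 + q3) /\<^sub>R 3 - c) \<le> 2/3 * norm (?m - c) + 1/3 * norm (q3 - c)"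
    using norm_triangle_ineq[of "(2/3) *\<^sub>R (?m - c)" "(1/3) *\<^sub>R (q3 - c)"] by simp
  also have "\<dots> < r" using m q(3) by (simp add: dist_norm norm_minus_commute)
  finally show ?thesis by (simp add: dist_norm norm_minus_commute)
qed

text \<open>Near a vertex a drawn arc may be arbitrarily wild; cutting it at small circles around
  its ends leaves room for straight segments in the discs. The cut arcs are disjoint because arcs of
  a drawing meet only in vertices, the centres of the discs.\<close>

lemma truncated_drawing:
  assumes H: "simple_graph H" and P: "plane_drawing H p \<gamma>"
  obtains r A q where "r > 0" "\<And>v w. v \<in> uverts H \<Longrightarrow> w \<in> uverts H \<Longrightarrow> v \<noteq> w \<Longrightarrow> cball (p v) r \<inter> cball (p w) r = {}"
    "\<And>e. e \<in> uedges H \<Longrightarrow> arc (A e) \<and> {pathstart (A e), pathfinish (A e)} = (\<lambda>v. q v e) ` e"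
    "\<And>e f. e \<in> uedges H \<Longrightarrow> f \<in> uedges H \<Longrightarrow> e \<noteq> f \<Longrightarrow> path_image (A e) \<inter> path_image (A f) = {}"
    "\<And>e v. e \<in> uedges H \<Longrightarrow> v \<in> e \<Longrightarrow> q v e \<in> sphere (p v) r \<and> path_image (A e) \<inter> cball (p v) r = {q v e}"
    "\<And>e v. e \<in> uedges H \<Longrightarrow> v \<in> uverts H \<Longrightarrow> v \<notin> e \<Longrightarrow> path_image (A e) \<inter> cball (p v) r = {}"
proof -
  let ?V = "uverts H" and ?E = "uedges H"
  have finV: "finite ?V" using H unfolding simple_graph_def by blast
  have finE: "finite ?E" using H by (rule simple_graph_finite_edges)
  have EV: "e \<in> ?E \<Longrightarrow> x \<in> e \<Longrightarrow> x \<in> ?V" for e x using H unfolding simple_graph_def by blast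
  have inj: "inj_on p ?V"
    and arc: "\<And>e. e \<in> ?E \<Longrightarrow> arc (\<gamma> e) \<and> {pathstart (\<gamma> e), pathfinish (\<gamma> e)} = p ` e \<and>
        path_image (\<gamma> e) \<inter> p ` ?V = p ` e"
    and meet: "\<And>e f. e \<in> ?E \<Longrightarrow> f \<in> ?E \<Longrightarrow> e \<noteq> f \<Longrightarrow> path_image (\<gamma> e) \<inter> path_image (\<gamma> f) = p ` (e \<inter> f)"
    using P unfolding plane_drawing_def by auto
  define B where "B v = p ` (?V - {v}) \<union> (\<Union>e\<in>{e \<in> ?E. v \<notin> e}. path_image (\<gamma> e))" for v
  have "\<exists>d>0. \<forall>t\<in>B v. d \<le> dist (p v) t" if v: "v \<in> ?V" for v
  proof -
    have "closed (B v)" unfolding B_def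
      using finV finE arc by (intro closed_Un closed_UN) (auto intro: closed_arc_image finite_imp_closed)
    moreover have "p v \<notin> B v"
    proof
      assume "p v \<in> B v"
      moreover have "p v \<notin> p ` (?V - {v})" using inj v by (auto dest: inj_onD)
      ultimately obtain e where e: "e \<in> ?E" "v \<notin> e" "p v \<in> path_image (\<gamma> e)" unfolding B_def by blast
      then have "p v \<in> p ` e" using arc[OF e(1)] v by blast
      then show False using e inj v EV[OF e(1)] unfolding inj_on_def by blast
    qed
    ultimately show ?thesis using separate_point_closed[of "B v" "p v"] by blast
  qed
  then obtain d where d: "\<And>v. v \<in> ?V \<Longrightarrow> d v > 0 \<and> (\<forall>t\<in>B v. d v \<le> dist (p v) t)" by metis
  \<comment> \<open>As \<open>3 * r\<close> is at most every \<open>d v\<close>, two closed discs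
    cannot touch and no foreign arc enters a disc. The element 1 keeps \<open>Min\<close> meaningful
    for a graph without vertices.\<close>
  define r where "r = Min (insert 1 (d ` ?V)) / 3"
  have r0: "r > 0" unfolding r_def using finV d by (simp add: Min_gr_iff)
  have rd: "3 * r \<le> d v" if "v \<in> ?V" for v unfolding r_def using finV that by auto
  have disj: "cball (p v) r \<inter> cball (p w) r = {}" if vw: "v \<in> ?V" "w \<in> ?V" "v \<noteq> w" for v w
  proof (rule ccontr)
    assume "cball (p v) r \<inter> cball (p w) r \<noteq> {}"
    then obtain t where t: "dist (p v) t \<le> r" "dist (p w) t \<le> r" by auto
    have "p w \<in> B v" unfolding B_def using vw by blast
    then have "3 * r \<le> dist (p v) (p w)" using d[OF vw(1)] rd[OF vw(1)] by force
    then show False using t dist_triangle2[of "p v" "p w" t] r0 by linarith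
  qed
  have off: "path_image (\<gamma> e) \<inter> cball (p v) r = {}" if ev: "e \<in> ?E" "v \<in> ?V" "v \<notin> e" for e v
  proof (rule ccontr)
    assume "path_image (\<gamma> e) \<inter> cball (p v) r \<noteq> {}"
    then obtain t where t: "t \<in> path_image (\<gamma> e)" "dist (p v) t \<le> r" by auto
    have "t \<in> B v" unfolding B_def using ev t by blast
    then have "3 * r \<le> dist (p v) t" using d[OF ev(2)] rd[OF ev(2)] by force
    then show False using t r0 by linarith
  qed
  define R where "R e A q \<longleftrightarrow> arc A \<and> {pathstart A, pathfinish A} = q ` e \<and> path_image A \<subseteq> path_image (\<gamma> e) \<and>
     (\<forall>v\<in>e. q v \<in> sphere (p v) r \<and> path_image A \<inter> cball (p v) r = {q v})" for e A and q :: "'a \<Rightarrow> complex"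
  have "\<exists>A q. R e A q" if e: "e \<in> ?E" for e
  proof -
    obtain x y where xy: "e = {x, y}" "x \<noteq> y" "x \<in> ?V" "y \<in> ?V" by (rule simple_graph_edgeE[OF H e])
    have "{pathstart (\<gamma> e), pathfinish (\<gamma> e)} = {p x, p y}" using arc[OF e] xy by simp
    then obtain g where g: "arc g" "pathstart g = p x" "pathfinish g = p y" "path_image g = path_image (\<gamma> e)"
      using arc[OF e] unfolding doubleton_eq_iff
      by (metis arc_reversepath path_image_reversepath pathfinish_reversepath pathstart_reversepath)
    have pre: "pathstart g \<in> ball (p x) r" "pathfinish g \<in> ball (p y) r" using g r0 by simp_all
    obtain A where A: "arc A" "path_image A \<subseteq> path_image g"
      "pathstart A \<in> cball (p x) r - ball (p x) r" "pathfinish A \<in> cball (p y) r - ball (p y) r"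
      "path_image A \<inter> cball (p x) r = {pathstart A}" "path_image A \<inter> cball (p y) r = {pathfinish A}"
      by (rule truncate_arc[OF g(1) pre open_ball open_ball ball_subset_cball ball_subset_cball
          closed_cball closed_cball disj[OF xy(3,4,2)]])
    define q where "q v = (if v = x then pathstart A else pathfinish A)" for v
    have "R e A q" unfolding R_def using A g(4) xy by (auto simp: q_def cball_diff_eq_sphere)
    then show ?thesis by blast
  qed
  then obtain A q where R: "\<And>e. e \<in> ?E \<Longrightarrow> R e (A e) (q e)" by metis
  have Ag: "path_image (A e) \<subseteq> path_image (\<gamma> e)" and Aq: "arc (A e)" "{pathstart (A e), pathfinish (A e)} = q e ` e" if "e \<in> ?E" for e
    using R[OF that] unfolding R_def by simp_all
  have qs: "q e v \<in> sphere (p v) r" "path_image (A e) \<inter> cball (p v) r = {q e v}" if "e \<in> ?E" "v \<in> e" for e v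
    using R[OF that(1)] that(2) unfolding R_def by simp_all
  show ?thesis
  proof (rule that[of r A "\<lambda>v e. q e v"])
    show "path_image (A e) \<inter> path_image (A f) = {}" if ef: "e \<in> ?E" "f \<in> ?E" "e \<noteq> f" for e f
    proof (rule ccontr)
      assume "path_image (A e) \<inter> path_image (A f) \<noteq> {}"
      then obtain t where t: "t \<in> path_image (A e)" "t \<in> path_image (A f)" by blast
      then have "t \<in> p ` (e \<inter> f)" using meet[OF ef] Ag[OF ef(1)] Ag[OF ef(2)] by blast
      then obtain v where v: "v \<in> e" "t = p v" by blast
      then have "p v \<in> path_image (A e) \<inter> cball (p v) r" using t r0 by simp
      then have "p v = q e v" using qs(2)[OF ef(1) v(1)] by simp
      then show False using qs(1)[OF ef(1) v(1)] r0 by simp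
    qed
    show "path_image (A e) \<inter> cball (p v) r = {}" if "e \<in> ?E" "v \<in> ?V" "v \<notin> e" for e v
      using off[OF that] Ag[OF that(1)] by blast
  qed (use r0 disj Aq qs in simp_all)
qed

context decorated_graph
begin

text \<open>Around a vertex \<open>v\<close> of \<open>H\<close> the line graph is a triangle of chords between the points \<open>q v e\<close> where the
  edges leave a small disc; a pendant edge sits at the centroid. A vertex of the line graph is spread over the whole
  arc outside the discs if the edge is not subdivided; otherwise this arc joins the two halves.\<close>

lemma planar_line_graph_decorated:
  assumes cub: "cubic H" and pl: "planar H"
  shows "planar (line_graph decorated)"
proof -
  let ?V = "uverts H" and ?E = "uedges H" and ?L = "line_graph decorated"
  obtain p \<gamma> where P: "plane_drawing H p \<gamma>" using pl unfolding planar_def by blast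
  obtain r A q where r: "r > 0" and disj: "\<And>v w. v \<in> ?V \<Longrightarrow> w \<in> ?V \<Longrightarrow> v \<noteq> w \<Longrightarrow> cball (p v) r \<inter> cball (p w) r = {}"
    and A: "\<And>e. e \<in> ?E \<Longrightarrow> arc (A e) \<and> {pathstart (A e), pathfinish (A e)} = (\<lambda>v. q v e) ` e"
    and AA: "\<And>e f. e \<in> ?E \<Longrightarrow> f \<in> ?E \<Longrightarrow> e \<noteq> f \<Longrightarrow> path_image (A e) \<inter> path_image (A f) = {}"
    and Aq: "\<And>e v. e \<in> ?E \<Longrightarrow> v \<in> e \<Longrightarrow> q v e \<in> sphere (p v) r \<and> path_image (A e) \<inter> cball (p v) r = {q v e}"
    and Aoff: "\<And>e v. e \<in> ?E \<Longrightarrow> v \<in> ?V \<Longrightarrow> v \<notin> e \<Longrightarrow> path_image (A e) \<inter> cball (p v) r = {}"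
    by (rule truncated_drawing[OF simple P]) (rule that)
  have qA: "q v e \<in> path_image (A e)" if "e \<in> ?E" "v \<in> e" for e v using Aq[OF that] by blast
  \<comment> \<open>The centroid: in a cubic graph the sum has three terms.\<close>
  define m where "m v = (\<Sum>e | e \<in> ?E \<and> v \<in> e. q v e) /\<^sub>R 3" for v
  \<comment> \<open>\<open>pt v f\<close> is the place of the line graph vertex \<open>f\<close> in
    the disc around \<open>v\<close>. The chosen \<open>e\<close> is unique because a piece
    determines its edge.\<close>
  define pt where "pt v f = (if f = {v, l v} \<and> v \<in> U then m v else q v (SOME e. e \<in> ?E \<and> v \<in> e \<and> f = piece v e))" for v f
  have pt_pend: "pt v {v, l v} = m v" if "v \<in> U" for v using that unfolding pt_def by simp
  have pt_piece: "pt v (piece v e) = q v e" if e: "e \<in> ?E" "v \<in> e" for v e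
  proof -
    have "(SOME e'. e' \<in> ?E \<and> v \<in> e' \<and> piece v e = piece v e') = e"
      using e by (intro some_equality) (auto simp: piece_eq_iff)
    then show ?thesis unfolding pt_def using pendant_neq_piece[of v e v] e by metis
  qed
  have three: "\<exists>e1 e2 e3. {e \<in> ?E. v \<in> e} = {e1, e2, e3} \<and> e1 \<noteq> e2 \<and> e1 \<noteq> e3 \<and> e2 \<noteq> e3" if "v \<in> ?V" for v
  proof -
    have "card {e \<in> ?E. v \<in> e} = 3" using cub that unfolding cubic_def vdegree_def by blast
    then show ?thesis unfolding card_3_iff by blast
  qed
  define Q where "Q v = insert (m v) ((\<lambda>e. q v e) ` {e \<in> ?E. v \<in> e})" for v
  have q_neq: "q v e \<noteq> q v f" if "e \<in> ?E" "f \<in> ?E" "v \<in> e" "v \<in> f" "e \<noteq> f" for v e f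
    using AA[OF that(1,2,5)] qA[OF that(1,3)] qA[OF that(2,4)] by auto
  have mball: "m v \<in> ball (p v) r"
    and geo: "\<And>w x y y'. w \<in> Q v \<Longrightarrow> x \<in> Q v \<Longrightarrow> y \<in> Q v \<Longrightarrow> y' \<in> Q v \<Longrightarrow> w \<noteq> x \<Longrightarrow> y \<noteq> y' \<Longrightarrow> {w, x} \<noteq> {y, y'} \<Longrightarrow>
      closed_segment w x \<inter> closed_segment y y' \<subseteq> {w, x} \<inter> {y, y'}" if v: "v \<in> ?V" for v
  proof -
    obtain e1 e2 e3 where e: "{e \<in> ?E. v \<in> e} = {e1, e2, e3}" "e1 \<noteq> e2" "e1 \<noteq> e3" "e2 \<noteq> e3" using three[OF v] by blast
    have E: "e1 \<in> ?E" "v \<in> e1" "e2 \<in> ?E" "v \<in> e2" "e3 \<in> ?E" "v \<in> e3" using e(1) by blast+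
    have sph: "q v e1 \<in> sphere (p v) r" "q v e2 \<in> sphere (p v) r" "q v e3 \<in> sphere (p v) r" using Aq E by simp_all
    have ne: "q v e1 \<noteq> q v e2" "q v e1 \<noteq> q v e3" "q v e2 \<noteq> q v e3" using q_neq E e by simp_all
    have mm: "m v = (q v e1 + q v e2 + q v e3) /\<^sub>R 3" unfolding m_def e(1) using e(2-4) by (simp add: add.assoc)
    show "m v \<in> ball (p v) r" unfolding mm by (rule centroid_in_ball[OF sph ne(1)])
    have "Q v = {q v e1, q v e2, q v e3, (q v e1 + q v e2 + q v e3) /\<^sub>R 3}" unfolding Q_def e(1) mm by auto
    note triangle_with_centroid[OF sph ne this]
    then show "closed_segment w x \<inter> closed_segment y y' \<subseteq> {w, x} \<inter> {y, y'}"
      if "w \<in> Q v" "x \<in> Q v" "y \<in> Q v" "y' \<in> Q v" "w \<noteq> x" "y \<noteq> y'" "{w, x} \<noteq> {y, y'}" for w x y y'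
      using that by blast
  qed
  have star_cases: "(\<exists>e\<in>?E. v \<in> e \<and> f = piece v e) \<or> (v \<in> U \<and> f = {v, l v})" if "v \<in> ?V" "f \<in> star v" for v f
    using that(2) unfolding star_eq[OF that(1)] by (auto split: if_splits)
  have Q_ball: "Q v \<subseteq> cball (p v) r" if v: "v \<in> ?V" for v
    using mball[OF v] Aq unfolding Q_def by fastforce
  have ptQ: "pt v f \<in> Q v" if v: "v \<in> ?V" "f \<in> star v" for v f
    using star_cases[OF v] unfolding Q_def by (auto simp: pt_piece pt_pend)
  have m_neq_q: "m v \<noteq> q v e" if "v \<in> ?V" "e \<in> ?E" "v \<in> e" for v e
    using mball[OF that(1)] Aq[OF that(2,3)] by auto
  have pt_inj: "f = g" if v: "v \<in> ?V" "f \<in> star v" "g \<in> star v" "pt v f = pt v g" for v f g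
    using star_cases[OF v(1,2)] star_cases[OF v(1,3)] v(4) q_neq m_neq_q[OF v(1)]
    by (elim disjE bexE conjE) (simp_all add: pt_piece pt_pend, metis+)
  \<comment> \<open>A half of a subdivided edge and a pendant edge each contain one vertex of
    \<open>H\<close>, so the second case gives a single point.\<close>
  define T where "T f = (if f \<in> ?E - S then path_image (A f) else (\<lambda>v. pt v f) ` (f \<inter> ?V))" for f
  have T_half: "T (piece v e) = {q v e}" if e: "e \<in> S" "v \<in> e" for v e
  proof -
    have "piece v e \<notin> ?E" using edge_verts[of "piece v e" "z e"] z_notin[OF e(1)] e(1) unfolding piece_def by auto
    moreover have eE: "e \<in> ?E" using e S by blast
    ultimately show ?thesis unfolding T_def
      using piece_Int_verts[OF eE e(2)] e(1) pt_piece[OF eE e(2)] by simp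
  qed
  have T_whole: "T (piece v e) = path_image (A e)" if e: "e \<in> ?E" "e \<notin> S" for v e
    using e unfolding T_def piece_def by simp
  have T_pend: "T {u, l u} = {m u}" if u: "u \<in> U" for u
  proof -
    have "{u, l u} \<notin> ?E" using edge_verts[of "{u, l u}" "l u"] l_notin[OF u] by auto
    moreover have "{u, l u} \<inter> ?V = {u}" using u U l_notin[OF u] by auto
    ultimately show ?thesis unfolding T_def using pt_pend[OF u] by simp
  qed
  have T_piece: "T (piece v e) \<subseteq> path_image (A e)" if "e \<in> ?E" "v \<in> e" for v e
    using T_half[of e v] T_whole[of e v] qA[OF that] that by (cases "e \<in> S") auto
  \<comment> \<open>Inside the disc around \<open>v\<close> the set of \<open>f\<close> shrinks to
    \<open>pt v f\<close> or to nothing. This reduces questions about chords to comparing points of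
    one disc.\<close>
  have T_ball: "T f \<inter> cball (p v) r = (if f \<in> star v then {pt v f} else {})" if f: "f \<in> uedges decorated" and v: "v \<in> ?V" for f v
    using f
  proof (cases rule: decorated_edgeE)
    case (piece w e)
    have w: "w \<in> ?V" using edge_verts piece by blast
    have st: "f \<in> star v \<longleftrightarrow> v \<in> e \<and> f = piece v e"
      unfolding star_def using f mem_piece_iff[OF piece(2,3) v] piece(1) by simp
    show ?thesis
    proof (cases "e \<in> S")
      case True
      have "q w e \<in> cball (p w) r" using Aq[OF piece(2,3)] by auto
      then have "T f \<inter> cball (p v) r = (if v = w then {q v e} else {})"
        using T_half[OF True piece(3)] disj[OF v w] unfolding piece(1) by (cases "v = w") auto
      moreover have "f \<in> star v \<longleftrightarrow> v = w"
        unfolding st using piece True piece_eq_iff[of e w e v] by auto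
      ultimately show ?thesis using pt_piece[OF piece(2,3)] piece(1) by simp
    next
      case False
      then have fe: "f = e" "f = piece v e" using piece(1) unfolding piece_def by simp_all
      have "T f = path_image (A e)" using T_whole[OF piece(2) False] piece(1) by simp
      moreover have "pt v f = q v e" if "v \<in> e" using pt_piece[OF piece(2) that] fe(2) by simp
      ultimately show ?thesis using st fe(2) Aq[OF piece(2)] Aoff[OF piece(2) v] by (cases "v \<in> e") simp_all
    qed
  next
    case (pendant u)
    have u: "u \<in> ?V" using U pendant by blast
    have "f \<in> star v \<longleftrightarrow> u = v" unfolding star_def using f pendant v l_notin by auto
    moreover have "T f \<inter> cball (p v) r = (if u = v then {m u} else {})"
    proof -
      have "m u \<in> cball (p u) r" using mball[OF u] by auto
      then show ?thesis using T_pend[OF pendant(2)] disj[OF u v] unfolding pendant(1) by (cases "u = v") auto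
    qed
    ultimately show ?thesis using pt_pend pendant by auto
  qed
  have pt_cball: "pt v f \<in> cball (p v) r" if "v \<in> ?V" "f \<in> star v" for v f using ptQ[OF that] Q_ball[OF that(1)] by blast
  have star_edge: "f \<in> uedges decorated" if "f \<in> star v" for f v using that unfolding star_def by simp
  have ptT: "pt v f \<in> T f" if "v \<in> ?V" "f \<in> star v" for v f
    using T_ball[OF star_edge[OF that(2)] that(1)] that(2) by auto
  have pend_star: "{u, l u} \<in> star u" if "u \<in> U" for u unfolding star_def using pendant_in[OF that] by simp
  have TT_pend: "T f \<inter> T {u, l u} = {}" if f: "f \<in> uedges decorated" "f \<noteq> {u, l u}" and u: "u \<in> U" for f u
  proof -
    have uV: "u \<in> ?V" using u U by blast
    have "m u \<in> cball (p u) r" using mball[OF uV] by auto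
    moreover have "m u \<noteq> pt u f" if "f \<in> star u"
      using pt_inj[OF uV that pend_star[OF u]] f(2) pt_pend[OF u] by metis
    ultimately have "m u \<notin> T f" using T_ball[OF f(1) uV] by (metis IntI empty_iff singletonD)
    then show ?thesis unfolding T_pend[OF u] by simp
  qed
  have TT: "T f \<inter> T g = {}" if fg: "f \<in> uedges decorated" "g \<in> uedges decorated" "f \<noteq> g" for f g
    using fg(1)
  proof (cases rule: decorated_edgeE)
    case (pendant u)
    then show ?thesis using TT_pend[OF fg(2) _ pendant(2)] fg(3) by auto
  next
    case fp: (piece v e)
    show ?thesis using fg(2)
    proof (cases rule: decorated_edgeE)
      case (pendant u)
      then show ?thesis using TT_pend[OF fg(1) _ pendant(2)] fg(3) by auto
    next
      case gp: (piece w e')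
      show ?thesis
      proof (cases "e = e'")
        case True
        then have eS: "e \<in> S" "v \<noteq> w" using fg(3) fp gp piece_eq_iff[of e v e w] by auto
        have vw: "v \<in> ?V" "w \<in> ?V" using edge_verts fp gp by auto
        have "q v e \<in> cball (p v) r" "q w e \<in> cball (p w) r" using Aq[OF fp(2,3)] Aq[OF gp(2,3)] True by auto
        then have "q v e \<noteq> q w e" using disj[OF vw eS(2)] by auto
        then show ?thesis using T_half[OF eS(1) fp(3)] T_half[OF eS(1), of w] gp(3) True fp(1) gp(1) by simp
      next
        case False
        then show ?thesis using T_piece[OF fp(2,3)] T_piece[OF gp(2,3)] AA[OF fp(2) gp(2)] fp(1) gp(1) by blast
      qed
    qed
  qed
  have TA: "T f \<inter> path_image (A e) = {}" if f: "f \<in> uedges decorated" "f \<notin> (\<lambda>v. piece v e) ` e" and e: "e \<in> S" for f e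
    using f(1)
  proof (cases rule: decorated_edgeE)
    case (piece v e')
    then have "e' \<noteq> e" using f(2) by blast
    then show ?thesis using AA[of e' e] e S piece T_piece[OF piece(2,3)] by blast
  next
    case (pendant u)
    have uV: "u \<in> ?V" using pendant U by blast
    have eE: "e \<in> ?E" using e S by blast
    have mb: "m u \<in> cball (p u) r" using mball[OF uV] by auto
    have "m u \<notin> path_image (A e)"
    proof (cases "u \<in> e")
      case True
      then show ?thesis using Aq[OF eE True] m_neq_q[OF uV eE True] mb by blast
    next
      case False
      then show ?thesis using Aoff[OF eE uV False] mb by blast
    qed
    then show ?thesis using T_pend[OF pendant(2)] pendant(1) by simp
  qed
  \<comment> \<open>The two kinds of adjacency from \<open>decorated_edge_Int\<close>: a chord in
    the disc of the common vertex, or the truncated arc between the halves of a subdivided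
    edge.\<close>
  define R where "R k g \<longleftrightarrow>
      (\<exists>v f f'. v \<in> ?V \<and> f \<in> star v \<and> f' \<in> star v \<and> f \<noteq> f' \<and> k = {f, f'} \<and> g = linepath (pt v f) (pt v f')) \<or>
      (\<exists>e\<in>S. k = (\<lambda>v. piece v e) ` e \<and> g = A e)" for k g
  have "\<exists>g. R k g" if k: "k \<in> uedges ?L" for k
  proof -
    obtain f f' where f: "k = {f, f'}" "f \<in> uedges decorated" "f' \<in> uedges decorated" "f \<noteq> f'" "f \<inter> f' \<noteq> {}" using k by auto
    from f(2-5) show ?thesis
    proof (cases rule: decorated_edge_Int)
      case (vertex v)
      then have "R k (linepath (pt v f) (pt v f'))" unfolding R_def using f by blast
      then show ?thesis by blast
    next
      case (halves e v w)
      then have "R k (A e)" unfolding R_def using f(1) by blast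
      then show ?thesis by blast
    qed
  qed
  then obtain \<Gamma> where \<Gamma>: "\<And>k. k \<in> uedges ?L \<Longrightarrow> R k (\<Gamma> k)" by metis
  have off: "path_image (\<Gamma> k) \<inter> T h = {}" if k: "k \<in> uedges ?L" and h: "h \<in> uedges decorated" "h \<notin> k" for k h
    using \<Gamma>[OF k] unfolding R_def
  proof (elim disjE exE bexE conjE)
    fix v f f' assume v: "v \<in> ?V" "f \<in> star v" "f' \<in> star v" "f \<noteq> f'" "k = {f, f'}" and g: "\<Gamma> k = linepath (pt v f) (pt v f')"
    have sub: "path_image (\<Gamma> k) \<subseteq> cball (p v) r"
      unfolding g path_image_linepath using pt_cball[OF v(1,2)] pt_cball[OF v(1,3)] by (intro closed_segment_subset) auto
    have "pt v h \<notin> closed_segment (pt v f) (pt v f')" if hs: "h \<in> star v"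
    proof
      assume a: "pt v h \<in> closed_segment (pt v f) (pt v f')"
      have ne: "pt v f \<noteq> pt v f'" "pt v h \<noteq> pt v f" "pt v h \<noteq> pt v f'"
        using pt_inj[OF v(1)] v hs h(2) by blast+
      have "closed_segment (pt v f) (pt v f') \<inter> closed_segment (pt v h) (pt v f) \<subseteq> {pt v f, pt v f'} \<inter> {pt v h, pt v f}"
        using ne by (intro geo[OF v(1)] ptQ v hs) (auto simp: doubleton_eq_iff)
      then show False using a ne by auto
    qed
    then have "path_image (\<Gamma> k) \<inter> (T h \<inter> cball (p v) r) = {}"
      unfolding T_ball[OF h(1) v(1)] unfolding g path_image_linepath by simp
    then show ?thesis using sub by blast
  next
    fix e assume "e \<in> S" "k = (\<lambda>v. piece v e) ` e" "\<Gamma> k = A e"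
    then show ?thesis using TA[OF h(1)] h(2) by (simp add: Int_commute)
  qed
  show ?thesis
  proof (rule planar_of_model[OF simple_line_graph[OF simple_decorated], of T \<Gamma>])
    fix f assume "f \<in> uverts ?L"
    then have f: "f \<in> uedges decorated" by simp
    have "(\<exists>e\<in>?E. T f = path_image (A e)) \<or> (\<exists>t. T f = {t})"
      using f
    proof (cases rule: decorated_edgeE)
      case (piece v e) then show ?thesis using T_half[of e v] T_whole[of e v] by (cases "e \<in> S") auto
    next
      case (pendant u) then show ?thesis using T_pend by auto
    qed
    then show "compact (T f) \<and> connected (T f) \<and> T f \<noteq> {} \<and> connected (- T f)"
    proof (elim disjE bexE exE)
      fix e assume "e \<in> ?E" "T f = path_image (A e)"
      then show ?thesis using A[of e] by (simp add: compact_arc_image connected_arc_image connected_arc_complement)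
    next
      fix t assume "T f = {t}"
      then show ?thesis by (simp add: connected_punctured_universe)
    qed
  next
    show "T f \<inter> T g = {}" if "f \<in> uverts ?L" "g \<in> uverts ?L" "f \<noteq> g" for f g using TT that by simp
  next
    fix k assume k: "k \<in> uedges ?L"
    show "arc (\<Gamma> k) \<and> (\<exists>x y. k = {x, y} \<and> pathstart (\<Gamma> k) \<in> T x \<and> pathfinish (\<Gamma> k) \<in> T y)"
      using \<Gamma>[OF k] unfolding R_def
    proof (elim disjE exE bexE conjE)
      fix v f f' assume v: "v \<in> ?V" "f \<in> star v" "f' \<in> star v" "f \<noteq> f'" "k = {f, f'}" and g: "\<Gamma> k = linepath (pt v f) (pt v f')"
      have "pt v f \<noteq> pt v f'" using pt_inj[OF v(1-3)] v(4) by blast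
      then have "arc (\<Gamma> k)" unfolding g by simp
      moreover have "pathstart (\<Gamma> k) \<in> T f" "pathfinish (\<Gamma> k) \<in> T f'" unfolding g using ptT v by simp_all
      ultimately show ?thesis using v(5) by blast
    next
      fix e assume e: "e \<in> S" "k = (\<lambda>v. piece v e) ` e" "\<Gamma> k = A e"
      then have eE: "e \<in> ?E" using S by blast
      obtain v w where vw: "e = {v, w}" by (rule simple_graph_edgeE[OF simple eE])
      have T: "T (piece v e) = {q v e}" "T (piece w e) = {q w e}" using T_half[OF e(1)] vw by auto
      have "{pathstart (A e), pathfinish (A e)} = {q v e, q w e}" using A[OF eE] vw by auto
      then consider "pathstart (A e) = q v e" "pathfinish (A e) = q w e" | "pathstart (A e) = q w e" "pathfinish (A e) = q v e"
        unfolding doubleton_eq_iff by blast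
      moreover have "k = {piece v e, piece w e}" "k = {piece w e, piece v e}" using e(2) vw by auto
      ultimately show ?thesis unfolding e(3) using A[OF eE] T by (metis insertI1)
    qed
  next
    show "path_image (\<Gamma> k) \<inter> T h = {}" if "k \<in> uedges ?L" "h \<in> uverts ?L" "h \<notin> k" for k h
      using off that by simp
  next
    fix k k' assume k: "k \<in> uedges ?L" "k' \<in> uedges ?L" "k \<noteq> k'"
    \<comment> \<open>In a disc an arc \<open>A e\<close> has only the point of the half
      \<open>piece v e\<close>. By \<open>off\<close>, a drawn edge through that point must have
      this half as an end.\<close>
    have mixed: "t \<in> (\<Union>x\<in>k1 \<inter> k2. T x)" if k1: "k1 \<in> uedges ?L" and k2: "k2 = (\<lambda>v. piece v e) ` e" "e \<in> S"
      and v: "v \<in> ?V" and t: "t \<in> cball (p v) r" "t \<in> path_image (\<Gamma> k1)" "t \<in> path_image (A e)" for k1 k2 e v t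
    proof -
      have eE: "e \<in> ?E" using k2 S by blast
      have ve: "v \<in> e" using Aoff[OF eE v] t by blast
      have "t = q v e" using Aq[OF eE ve] t by blast
      then have "t \<in> T (piece v e)" using T_half[OF k2(2) ve] by simp
      moreover from this have "piece v e \<in> k1" using off[OF k1 piece_in[OF eE ve]] t(2) by blast
      ultimately show ?thesis using k2(1) ve by blast
    qed
    have in_ball: "path_image (linepath (pt v f) (pt v f')) \<subseteq> cball (p v) r" if "v \<in> ?V" "f \<in> star v" "f' \<in> star v" for v f f'
      unfolding path_image_linepath using pt_cball[OF that(1,2)] pt_cball[OF that(1,3)] by (intro closed_segment_subset) auto
    show "path_image (\<Gamma> k) \<inter> path_image (\<Gamma> k') \<subseteq> (\<Union>x\<in>k \<inter> k'. T x)"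
    proof
      fix t assume t: "t \<in> path_image (\<Gamma> k) \<inter> path_image (\<Gamma> k')"
      show "t \<in> (\<Union>x\<in>k \<inter> k'. T x)"
        using \<Gamma>[OF k(1)] unfolding R_def
      proof (elim disjE exE bexE conjE)
        fix v f f' assume v: "v \<in> ?V" "f \<in> star v" "f' \<in> star v" "f \<noteq> f'" "k = {f, f'}" and g: "\<Gamma> k = linepath (pt v f) (pt v f')"
        have tv: "t \<in> cball (p v) r" using in_ball[OF v(1-3)] t g by auto
        show ?thesis
          using \<Gamma>[OF k(2)] unfolding R_def
        proof (elim disjE exE bexE conjE)
          fix w h h' assume w: "w \<in> ?V" "h \<in> star w" "h' \<in> star w" "h \<noteq> h'" "k' = {h, h'}" and g': "\<Gamma> k' = linepath (pt w h) (pt w h')"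
          have "t \<in> cball (p w) r" using in_ball[OF w(1-3)] t g' by auto
          then have wv: "w = v" using disj[OF v(1) w(1)] tv by blast
          note w = w[unfolded wv] and g' = g'[unfolded wv]
          have ne: "pt v f \<noteq> pt v f'" "pt v h \<noteq> pt v h'" using pt_inj[OF v(1)] v w by blast+
          have inj: "inj_on (pt v) (star v)" using pt_inj[OF v(1)] by (intro inj_onI) blast
          have "pt v ` k \<noteq> pt v ` k'" using inj_on_image_eq_iff[OF inj, of k k'] v w k(3) by blast
          then have "closed_segment (pt v f) (pt v f') \<inter> closed_segment (pt v h) (pt v h') \<subseteq> {pt v f, pt v f'} \<inter> {pt v h, pt v h'}"
            using ne v(5) w(5) by (intro geo[OF v(1)] ptQ v w) auto
          then have "t \<in> pt v ` k \<inter> pt v ` k'" using t v(5) w(5) unfolding g g' path_image_linepath by auto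
          then have "t \<in> pt v ` (k \<inter> k')" using inj_on_image_Int[OF inj, of k k'] v w by blast
          then show ?thesis using ptT[OF v(1)] v(2,3,5) by blast
        next
          fix e assume "e \<in> S" "k' = (\<lambda>v. piece v e) ` e" "\<Gamma> k' = A e"
          then show ?thesis using mixed[OF k(1) _ _ v(1) tv] t by auto
        qed
      next
        fix e assume e: "e \<in> S" "k = (\<lambda>v. piece v e) ` e" "\<Gamma> k = A e"
        show ?thesis
          using \<Gamma>[OF k(2)] unfolding R_def
        proof (elim disjE exE bexE conjE)
          fix w h h' assume w: "w \<in> ?V" "h \<in> star w" "h' \<in> star w" "h \<noteq> h'" "k' = {h, h'}" and g': "\<Gamma> k' = linepath (pt w h) (pt w h')"
          have "t \<in> cball (p w) r" using in_ball[OF w(1-3)] t g' by auto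
          then show ?thesis using mixed[OF k(2) e(2,1) w(1)] t e(3) by auto
        next
          fix e' assume e': "e' \<in> S" "k' = (\<lambda>v. piece v e') ` e'" "\<Gamma> k' = A e'"
          then have "e \<noteq> e'" using k(3) e(2) by blast
          moreover have "e \<in> ?E" "e' \<in> ?E" using e(1) e'(1) S by auto
          ultimately have "path_image (A e) \<inter> path_image (A e') = {}" by (intro AA)
          then show ?thesis using t unfolding e(3) e'(3) by simp
        qed
      qed
    qed
  qed
qed

end

subsection \<open>Connectivity and edge cuts\<close>

definition edges_between :: "'a ugraph \<Rightarrow> 'a set \<Rightarrow> 'a set \<Rightarrow> 'a set set" where
  "edges_between G X Y = {e \<in> uedges G. e \<inter> X \<noteq> {} \<and> e \<inter> Y \<noteq> {}}"

text \<open>The vertices reachable from \<open>u\<close> form one side of an empty cut unless they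
  are all vertices; conversely a walk cannot change sides without an edge across.\<close>

lemma graph_connected_iff:
  assumes G: "simple_graph G"
  shows "graph_connected G \<longleftrightarrow>
    (\<forall>X Y. X \<union> Y = uverts G \<longrightarrow> X \<inter> Y = {} \<longrightarrow> X \<noteq> {} \<longrightarrow> Y \<noteq> {} \<longrightarrow> edges_between G X Y \<noteq> {})"
proof (intro iffI allI impI notI)
  fix X Y assume con: "graph_connected G" and XY: "X \<union> Y = uverts G" "X \<inter> Y = {}" "X \<noteq> {}" "Y \<noteq> {}"
    and no: "edges_between G X Y = {}"
  obtain u v where uv: "u \<in> X" "v \<in> Y" using XY by blast
  have "(u, v) \<in> {(x, y). {x, y} \<in> uedges G}\<^sup>*" using con uv XY unfolding graph_connected_def by blast
  then have "v \<in> X"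
  proof induction
    case base show ?case by (rule uv(1))
  next
    case (step y w)
    then have yw: "{y, w} \<in> uedges G" by simp
    then have "w \<in> uverts G" using G unfolding simple_graph_def by auto
    then show ?case using no yw step.IH XY(1) unfolding edges_between_def by blast
  qed
  then show False using uv(2) XY(2) by blast
next
  assume a: "\<forall>X Y. X \<union> Y = uverts G \<longrightarrow> X \<inter> Y = {} \<longrightarrow> X \<noteq> {} \<longrightarrow> Y \<noteq> {} \<longrightarrow> edges_between G X Y \<noteq> {}"
  show "graph_connected G"
    unfolding graph_connected_def
  proof (intro ballI)
    fix u v assume uv: "u \<in> uverts G" "v \<in> uverts G"
    let ?R = "{(x, y). {x, y} \<in> uedges G}\<^sup>*"
    define X where "X = {w \<in> uverts G. (u, w) \<in> ?R}"
    have "edges_between G X (uverts G - X) = {}"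
    proof (rule ccontr)
      assume "edges_between G X (uverts G - X) \<noteq> {}"
      then obtain e x y where e: "e \<in> uedges G" "x \<in> e" "x \<in> X" "y \<in> e" "y \<in> uverts G" "y \<notin> X"
        unfolding edges_between_def by blast
      obtain a b where "e = {a, b}" by (rule simple_graph_edgeE[OF G e(1)])
      moreover have "x \<noteq> y" using e by blast
      ultimately have "e = {x, y}" using e by auto
      then have "(u, y) \<in> ?R" using e unfolding X_def by (auto intro: rtrancl_into_rtrancl)
      then show False using e unfolding X_def by blast
    qed
    moreover have "u \<in> X" using uv unfolding X_def by simp
    ultimately have "uverts G - X = {}" using a[rule_format, of X "uverts G - X"] X_def by blast
    then show "(u, v) \<in> ?R" using uv unfolding X_def by blast
  qed
qed

lemma simple_delete_verts: "simple_graph G \<Longrightarrow> simple_graph (delete_verts G S)"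
  unfolding simple_graph_def delete_verts_def by auto

text \<open>An edge that meets both \<open>X\<close> and \<open>Y\<close> has its two ends there and
  avoids \<open>S\<close>. So deletion of \<open>S\<close> can be expressed by a partition of the
  vertices of the original graph.\<close>

lemma k_connected_iff:
  assumes G: "simple_graph G"
  shows "k_connected k G \<longleftrightarrow> k + 1 \<le> card (uverts G) \<and>
    (\<forall>X Y S. X \<union> Y \<union> S = uverts G \<longrightarrow> X \<inter> Y = {} \<longrightarrow> X \<inter> S = {} \<longrightarrow> Y \<inter> S = {} \<longrightarrow> X \<noteq> {} \<longrightarrow> Y \<noteq> {} \<longrightarrow>
      card S < k \<longrightarrow> edges_between G X Y \<noteq> {})"
proof -
  have eq: "edges_between (delete_verts G S) X Y = edges_between G X Y"
    if "X \<inter> Y = {}" "X \<inter> S = {}" "Y \<inter> S = {}" for X Y S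
  proof -
    have "e \<inter> S = {}" if e: "e \<in> uedges G" "e \<inter> X \<noteq> {}" "e \<inter> Y \<noteq> {}" for e
    proof -
      obtain a b where "e = {a, b}" by (rule simple_graph_edgeE[OF G e(1)])
      then show ?thesis using e(2,3) \<open>X \<inter> Y = {}\<close> \<open>X \<inter> S = {}\<close> \<open>Y \<inter> S = {}\<close> by auto
    qed
    then show ?thesis unfolding edges_between_def delete_verts_def by auto
  qed
  have key: "graph_connected (delete_verts G S) \<longleftrightarrow>
      (\<forall>X Y. X \<union> Y \<union> S = uverts G \<longrightarrow> X \<inter> Y = {} \<longrightarrow> X \<inter> S = {} \<longrightarrow> Y \<inter> S = {} \<longrightarrow> X \<noteq> {} \<longrightarrow> Y \<noteq> {} \<longrightarrow>
        edges_between G X Y \<noteq> {})" if S: "S \<subseteq> uverts G" for S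
  proof -
    have V: "X \<union> Y = uverts (delete_verts G S) \<longleftrightarrow> X \<union> Y \<union> S = uverts G \<and> X \<inter> S = {} \<and> Y \<inter> S = {}" for X Y
      unfolding delete_verts_def using S by auto
    show ?thesis
      unfolding graph_connected_iff[OF simple_delete_verts[OF G]] V
      by (intro iff_allI) (auto simp: eq)
  qed
  show ?thesis
    unfolding k_connected_def
  proof (intro conj_cong refl iffI allI impI)
    fix X Y S
    assume a: "\<forall>S\<subseteq>uverts G. card S < k \<longrightarrow> graph_connected (delete_verts G S)"
      and b: "X \<union> Y \<union> S = uverts G" "X \<inter> Y = {}" "X \<inter> S = {}" "Y \<inter> S = {}" "X \<noteq> {}" "Y \<noteq> {}" "card S < k"
    have S: "S \<subseteq> uverts G" using b(1) by blast
    then have "graph_connected (delete_verts G S)" using a b(7) by blast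
    then show "edges_between G X Y \<noteq> {}" unfolding key[OF S] using b by simp
  next
    fix S
    assume a: "\<forall>X Y S. X \<union> Y \<union> S = uverts G \<longrightarrow> X \<inter> Y = {} \<longrightarrow> X \<inter> S = {} \<longrightarrow> Y \<inter> S = {} \<longrightarrow> X \<noteq> {} \<longrightarrow> Y \<noteq> {} \<longrightarrow>
      card S < k \<longrightarrow> edges_between G X Y \<noteq> {}" and S: "S \<subseteq> uverts G" "card S < k"
    show "graph_connected (delete_verts G S)" unfolding key[OF S(1)] using a S(2) by simp
  qed
qed

lemma k_connected_edges_between:
  assumes "k_connected k G" "simple_graph G" "X \<union> Y \<union> S = uverts G" "X \<inter> Y = {}" "X \<inter> S = {}" "Y \<inter> S = {}"
    "X \<noteq> {}" "Y \<noteq> {}" "card S < k"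
  shows "edges_between G X Y \<noteq> {}"
  using assms(1) unfolding k_connected_iff[OF assms(2)] using assms(3-) by blast

lemma finite_edges_between: "simple_graph G \<Longrightarrow> finite (edges_between G X Y)"
  using simple_graph_finite_edges[of G] unfolding edges_between_def by simp

text \<open>Of the three edges at \<open>s\<close>, at most one leads to \<open>X\<close> or at most
  one leads to \<open>Y\<close>. The vertex \<open>s\<close> joins the opposite side, which adds at
  most one edge to the cut.\<close>

lemma cubic_extend_cut:
  assumes G: "simple_graph G" "cubic G" and "finite S"
    and "X \<union> Y \<union> S = uverts G" "X \<inter> Y = {}" "X \<inter> S = {}" "Y \<inter> S = {}"
  shows "\<exists>X' Y'. X \<subseteq> X' \<and> Y \<subseteq> Y' \<and> X' \<union> Y' = uverts G \<and> X' \<inter> Y' = {} \<and>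
    card (edges_between G X' Y') \<le> card (edges_between G X Y) + card S"
  using assms(3-)
proof (induction S arbitrary: X Y rule: finite_induct)
  case empty
  then show ?case by (intro exI[of _ X] exI[of _ Y]) auto
next
  case (insert s S)
  let ?N = "\<lambda>Z. edges_between G {s} Z"
  have "?N X \<inter> ?N Y = {}"
  proof (rule ccontr)
    assume "?N X \<inter> ?N Y \<noteq> {}"
    then obtain e where e: "e \<in> uedges G" "s \<in> e" "e \<inter> X \<noteq> {}" "e \<inter> Y \<noteq> {}" unfolding edges_between_def by blast
    obtain a b where "e = {a, b}" by (rule simple_graph_edgeE[OF G(1) e(1)])
    then show False using e(2-) insert.prems by auto
  qed
  then have "card (?N X) + card (?N Y) = card (?N X \<union> ?N Y)"
    by (intro card_Un_disjoint[symmetric] finite_edges_between G)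
  also have "\<dots> \<le> card {e \<in> uedges G. s \<in> e}"
    using simple_graph_finite_edges[OF G(1)] by (intro card_mono) (auto simp: edges_between_def)
  also have "\<dots> = 3" using G(2) insert.prems unfolding cubic_def vdegree_def by blast
  finally have "card (?N X) \<le> 1 \<or> card (?N Y) \<le> 1" by linarith
  then show ?case
  proof
    assume "card (?N X) \<le> 1"
    moreover have "edges_between G X (insert s Y) = edges_between G X Y \<union> ?N X" unfolding edges_between_def by blast
    ultimately have le: "card (edges_between G X (insert s Y)) \<le> card (edges_between G X Y) + 1"
      by (metis add_left_mono card_Un_le order_trans)
    have "\<exists>X' Y'. X \<subseteq> X' \<and> insert s Y \<subseteq> Y' \<and> X' \<union> Y' = uverts G \<and> X' \<inter> Y' = {} \<and>
        card (edges_between G X' Y') \<le> card (edges_between G X (insert s Y)) + card S"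
      using insert.prems insert.hyps by (intro insert.IH) auto
    then obtain X' Y' where XY: "X \<subseteq> X'" "insert s Y \<subseteq> Y'" "X' \<union> Y' = uverts G" "X' \<inter> Y' = {}"
        "card (edges_between G X' Y') \<le> card (edges_between G X (insert s Y)) + card S" by blast
    then show ?case using le insert.hyps by (intro exI[of _ X'] exI[of _ Y']) auto
  next
    assume "card (?N Y) \<le> 1"
    moreover have "edges_between G (insert s X) Y = edges_between G X Y \<union> ?N Y" unfolding edges_between_def by blast
    ultimately have le: "card (edges_between G (insert s X) Y) \<le> card (edges_between G X Y) + 1"
      by (metis add_left_mono card_Un_le order_trans)
    have "\<exists>X' Y'. insert s X \<subseteq> X' \<and> Y \<subseteq> Y' \<and> X' \<union> Y' = uverts G \<and> X' \<inter> Y' = {} \<and>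
        card (edges_between G X' Y') \<le> card (edges_between G (insert s X) Y) + card S"
      using insert.prems insert.hyps by (intro insert.IH) auto
    then obtain X' Y' where XY: "insert s X \<subseteq> X'" "Y \<subseteq> Y'" "X' \<union> Y' = uverts G" "X' \<inter> Y' = {}"
        "card (edges_between G X' Y') \<le> card (edges_between G (insert s X) Y) + card S" by blast
    then show ?case using le insert.hyps by (intro exI[of _ X'] exI[of _ Y']) auto
  qed
qed

lemma cubic_card_verts:
  assumes G: "simple_graph G" "cubic G" and v: "v \<in> uverts G"
  shows "4 \<le> card (uverts G)"
proof -
  have fin: "finite (uverts G)" using G unfolding simple_graph_def by blast
  have "{e \<in> uedges G. v \<in> e} \<subseteq> (\<lambda>w. {v, w}) ` (uverts G - {v})"
  proof
    fix e assume e: "e \<in> {e \<in> uedges G. v \<in> e}"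
    obtain a b where "e = {a, b}" "a \<noteq> b" "a \<in> uverts G" "b \<in> uverts G" using simple_graph_edgeE[OF G(1)] e by blast
    then show "e \<in> (\<lambda>w. {v, w}) ` (uverts G - {v})" using e by auto
  qed
  then have "card {e \<in> uedges G. v \<in> e} \<le> card (uverts G - {v})" using fin by (meson finite_Diff surj_card_le)
  moreover have "card {e \<in> uedges G. v \<in> e} = 3" using G(2) v unfolding cubic_def vdegree_def by blast
  ultimately show ?thesis using v fin by (simp add: card_Diff_singleton)
qed

text \<open>A vertex cut with at most two vertices extends to an edge cut of at most that size by
  \<open>cubic_extend_cut\<close>. Conversely, given at most two cut edges and three vertices in
  \<open>X\<close>, the ends in \<open>X\<close> of the cut edges separate the rest of
  \<open>X\<close> from \<open>Y\<close>. If \<open>X\<close> has one or two vertices, counting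
  degrees gives at least three or four cut edges.\<close>

lemma cubic_3_connected_iff:
  assumes G: "simple_graph G" "cubic G" and ne: "uverts G \<noteq> {}"
  shows "k_connected 3 G \<longleftrightarrow>
    (\<forall>X Y. X \<union> Y = uverts G \<longrightarrow> X \<inter> Y = {} \<longrightarrow> X \<noteq> {} \<longrightarrow> Y \<noteq> {} \<longrightarrow> 3 \<le> card (edges_between G X Y))"
proof (intro iffI allI impI)
  assume cut: "\<forall>X Y. X \<union> Y = uverts G \<longrightarrow> X \<inter> Y = {} \<longrightarrow> X \<noteq> {} \<longrightarrow> Y \<noteq> {} \<longrightarrow> 3 \<le> card (edges_between G X Y)"
  obtain v where v: "v \<in> uverts G" using ne by blast
  show "k_connected 3 G"
    unfolding k_connected_iff[OF G(1)]
  proof (intro conjI allI impI notI)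
    show "3 + 1 \<le> card (uverts G)" using cubic_card_verts[OF G v] by simp
    fix X Y S
    assume XYS: "X \<union> Y \<union> S = uverts G" "X \<inter> Y = {}" "X \<inter> S = {}" "Y \<inter> S = {}" "X \<noteq> {}" "Y \<noteq> {}" "card S < 3"
      and no: "edges_between G X Y = {}"
    have "finite S" using XYS(1) G(1) unfolding simple_graph_def by (metis finite_Un)
    from cubic_extend_cut[OF G this XYS(1-4)] obtain X' Y' where
      "X \<subseteq> X'" "Y \<subseteq> Y'" "X' \<union> Y' = uverts G" "X' \<inter> Y' = {}" "card (edges_between G X' Y') \<le> card (edges_between G X Y) + card S"
      by blast
    moreover from this have "3 \<le> card (edges_between G X' Y')" using cut XYS(5,6) by blast
    ultimately show False using no XYS(7) by simp
  qed
next
  fix X Y assume con: "k_connected 3 G" and XY: "X \<union> Y = uverts G" "X \<inter> Y = {}" "X \<noteq> {}" "Y \<noteq> {}"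
  show "3 \<le> card (edges_between G X Y)"
  proof (rule ccontr)
    assume "\<not> 3 \<le> card (edges_between G X Y)"
    then have le2: "card (edges_between G X Y) \<le> 2" by simp
    let ?C = "edges_between G X Y"
    have finC: "finite ?C" by (rule finite_edges_between[OF G(1)])
    have finV: "finite (uverts G)" using G(1) unfolding simple_graph_def by blast
    have finX: "finite X" using finV XY(1) by (metis finite_Un)
    have deg: "card {e \<in> uedges G. x \<in> e} = 3" if "x \<in> X" for x
      using G(2) XY(1) that unfolding cubic_def vdegree_def by blast
    have inner: "{e \<in> uedges G. x \<in> e} - ?C \<subseteq> (\<lambda>w. {x, w}) ` (X - {x})" if x: "x \<in> X" for x
    proof
      fix e assume e: "e \<in> {e \<in> uedges G. x \<in> e} - ?C"
      obtain a b where ab: "e = {a, b}" "a \<noteq> b" "a \<in> uverts G" "b \<in> uverts G" using simple_graph_edgeE[OF G(1)] e by blast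
      then show "e \<in> (\<lambda>w. {x, w}) ` (X - {x})" using e x XY(1) unfolding edges_between_def by auto
    qed
    \<comment> \<open>The graph is simple, so at most \<open>card X - 1\<close> edges at
      \<open>x\<close> stay inside \<open>X\<close>; the others are in the cut.\<close>
    have inner_card: "3 - (card X - 1) \<le> card ({e \<in> uedges G. x \<in> e} \<inter> ?C)" if x: "x \<in> X" for x
    proof -
      have "card ({e \<in> uedges G. x \<in> e} - ?C) \<le> card (X - {x})" using inner[OF x] finX by (meson finite_Diff surj_card_le)
      moreover have "card {e \<in> uedges G. x \<in> e} = card ({e \<in> uedges G. x \<in> e} - ?C) + card ({e \<in> uedges G. x \<in> e} \<inter> ?C)"
        using simple_graph_finite_edges[OF G(1)] by (subst card_Un_disjoint[symmetric]) (auto intro: arg_cong[where f = card])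
      ultimately show ?thesis using deg[OF x] x finX by (simp add: card_Diff_singleton)
    qed
    show False
    proof (cases "3 \<le> card X")
      case True
      define S where "S = \<Union>?C \<inter> X"
      have one: "\<exists>x. e \<inter> X = {x}" if "e \<in> ?C" for e
      proof -
        have e: "e \<in> uedges G" "e \<inter> X \<noteq> {}" "e \<inter> Y \<noteq> {}" using that unfolding edges_between_def by auto
        obtain a b where "e = {a, b}" by (rule simple_graph_edgeE[OF G(1) e(1)])
        then show ?thesis using e(2,3) XY(2) by (cases "a \<in> X"; cases "b \<in> X") auto
      qed
      have "S \<subseteq> (\<lambda>e. the_elem (e \<inter> X)) ` ?C"
      proof
        fix x assume "x \<in> S"
        then obtain e where "e \<in> ?C" "x \<in> e \<inter> X" unfolding S_def by blast
        then show "x \<in> (\<lambda>e. the_elem (e \<inter> X)) ` ?C" using one[of e] by (intro image_eqI[of _ _ e]) auto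
      qed
      then have cS: "card S \<le> 2" using le2 finC by (meson le_trans surj_card_le)
      have "X - S \<noteq> {}"
      proof
        assume "X - S = {}"
        then have "card X \<le> card S" using finX unfolding S_def by (intro card_mono) auto
        then show False using True cS by simp
      qed
      then have "edges_between G (X - S) Y \<noteq> {}"
        using XY cS by (intro k_connected_edges_between[OF con G(1), of _ _ S]) (auto simp: S_def)
      then show False unfolding S_def edges_between_def by blast
    next
      case False
      obtain x where x: "x \<in> X" using XY by blast
      have "card X \<noteq> 0" using x finX by auto
      then consider "card X = 1" | "card X = 2" using False by linarith
      then show False
      proof cases
        case 1
        then have "3 \<le> card ({e \<in> uedges G. x \<in> e} \<inter> ?C)" using inner_card[OF x] by simp
        then show False using le2 card_mono[OF finC, of "{e \<in> uedges G. x \<in> e} \<inter> ?C"] by simp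
      next
        case 2
        then obtain y where y: "X = {x, y}" "x \<noteq> y" using x by (auto simp: card_2_iff)
        have "({e \<in> uedges G. x \<in> e} \<inter> ?C) \<inter> ({e \<in> uedges G. y \<in> e} \<inter> ?C) = {}"
        proof (rule ccontr)
          assume "({e \<in> uedges G. x \<in> e} \<inter> ?C) \<inter> ({e \<in> uedges G. y \<in> e} \<inter> ?C) \<noteq> {}"
          then obtain e where e: "e \<in> uedges G" "x \<in> e" "y \<in> e" "e \<inter> Y \<noteq> {}" unfolding edges_between_def by blast
          obtain a b where "e = {a, b}" by (rule simple_graph_edgeE[OF G(1) e(1)])
          then show False using e(2-) y XY(2) by auto
        qed
        then have "card ({e \<in> uedges G. x \<in> e} \<inter> ?C) + card ({e \<in> uedges G. y \<in> e} \<inter> ?C) =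
            card (({e \<in> uedges G. x \<in> e} \<inter> ?C) \<union> ({e \<in> uedges G. y \<in> e} \<inter> ?C))"
          using finC by (intro card_Un_disjoint[symmetric]) auto
        also have "\<dots> \<le> card ?C" using finC by (intro card_mono) auto
        finally show False using inner_card[of x] inner_card[of y] 2 y le2 by simp
      qed
    qed
  qed
qed

context decorated_graph
begin

text \<open>The edges at a vertex of \<open>H\<close> that survive the deletion of \<open>F\<close> stay on one side, so a separation of
  the line graph induces a cut of \<open>H\<close> in which every edge has a piece in \<open>F\<close>.\<close>

lemma line_graph_decorated_3_connected:
  assumes cub: "cubic H" and con: "k_connected 3 H"
  shows "k_connected 3 (line_graph decorated)"
  unfolding k_connected_iff[OF simple_line_graph[OF simple_decorated]]
proof (intro conjI allI impI notI)
  let ?V = "uverts H" and ?E = "uedges H"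
  have finE: "finite (uedges decorated)" by (rule simple_graph_finite_edges[OF simple_decorated])
  have star3: "3 \<le> card (star v)" if "v \<in> ?V" for v using card_star[OF that] cub that unfolding cubic_def by simp
  have fin_star: "finite (star v)" for v using finE unfolding star_def by simp
  have c4: "4 \<le> card ?V" using con unfolding k_connected_def by simp
  then obtain v where v: "v \<in> ?V" by fastforce
  have "\<exists>w\<in>?V. w \<noteq> v"
  proof (rule ccontr)
    assume "\<not> (\<exists>w\<in>?V. w \<noteq> v)"
    then have "?V = {v}" using v by blast
    then show False using c4 by simp
  qed
  then obtain w where w: "w \<in> ?V" "w \<noteq> v" by blast
  \<comment> \<open>Two stars with at least three edges each share at most one, so there are at
    least five edges.\<close>
  have "card (star v \<inter> star w) \<le> 1"
  proof -
    have "f = g" if fg: "f \<in> star v \<inter> star w" "g \<in> star v \<inter> star w" for f g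
      using simple_graph_edge_Int[OF simple_decorated, of f g v] fg w(2) unfolding star_def by blast
    then show ?thesis by (metis card_le_Suc0_iff_eq fin_star finite_Int One_nat_def)
  qed
  moreover have "card (star v \<union> star w) + card (star v \<inter> star w) = card (star v) + card (star w)"
    using card_Un_Int[OF fin_star fin_star] by simp
  moreover have "card (star v \<union> star w) \<le> card (uedges decorated)"
    using finE unfolding star_def by (intro card_mono) auto
  ultimately show "3 + 1 \<le> card (uverts (line_graph decorated))" using star3[OF v] star3[OF w(1)] by simp
  fix A B F
  assume AB: "A \<union> B \<union> F = uverts (line_graph decorated)" "A \<inter> B = {}" "A \<inter> F = {}" "B \<inter> F = {}" "A \<noteq> {}" "B \<noteq> {}" "card F < 3"
    and no: "edges_between (line_graph decorated) A B = {}"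
  have EG: "uedges decorated = A \<union> B \<union> F" using AB(1) by simp
  have finF: "finite F" using finE EG by simp
  have sep: "f \<inter> g = {}" if "f \<in> A" "g \<in> B" for f g
  proof (rule ccontr)
    assume "f \<inter> g \<noteq> {}"
    moreover have "f \<noteq> g" using that AB(2) by blast
    ultimately have "{f, g} \<in> uedges (line_graph decorated)" using that EG by auto
    then show False using no that unfolding edges_between_def by auto
  qed
  have star_ne: "star v \<inter> (A \<union> B) \<noteq> {}" if v: "v \<in> ?V" for v
  proof
    assume "star v \<inter> (A \<union> B) = {}"
    then have "star v \<subseteq> F" using EG unfolding star_def by blast
    then show False using star3[OF v] card_mono[OF finF, of "star v"] AB(7) by simp
  qed
  have star_one: "star v \<inter> A = {} \<or> star v \<inter> B = {}" for v using sep unfolding star_def by blast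
  define X where "X = {v \<in> ?V. star v \<inter> A \<noteq> {}}"
  define Y where "Y = {v \<in> ?V. star v \<inter> B \<noteq> {}}"
  have XY: "X \<union> Y = ?V" "X \<inter> Y = {}" unfolding X_def Y_def using star_ne star_one by blast+
  have "X \<noteq> {}" "Y \<noteq> {}"
  proof -
    obtain a b where ab: "a \<in> A" "b \<in> B" using AB(5,6) by blast
    then have "a \<in> uedges decorated" "b \<in> uedges decorated" using EG by auto
    then obtain x y where "x \<in> ?V" "a \<in> star x" "y \<in> ?V" "b \<in> star y" by (metis decorated_edge_in_star)
    then have "x \<in> X" "y \<in> Y" unfolding X_def Y_def using ab by auto
    then show "X \<noteq> {}" "Y \<noteq> {}" by auto
  qed
  with XY con have cut: "3 \<le> card (edges_between H X Y)"
    using cubic_3_connected_iff[OF simple cub] v by blast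
  have "\<exists>v\<in>e. piece v e \<in> F" if e: "e \<in> edges_between H X Y" for e
  proof (rule ccontr)
    assume n: "\<not> (\<exists>v\<in>e. piece v e \<in> F)"
    obtain x y where xy: "e \<in> ?E" "x \<in> e" "x \<in> X" "y \<in> e" "y \<in> Y" using e unfolding edges_between_def by blast
    have st: "piece x e \<in> star x" "piece y e \<in> star y" using xy star_eq[of x] star_eq[of y] edge_verts by auto
    have "piece x e \<in> A \<union> B" "piece y e \<in> A \<union> B" using n xy EG piece_in by blast+
    then have "piece x e \<in> A" "piece y e \<in> B" using st xy star_one unfolding X_def Y_def by blast+
    moreover have "piece x e \<inter> piece y e \<noteq> {}" using xy(2) unfolding piece_def by auto
    ultimately show False using sep by blast
  qed
  then obtain \<phi> where \<phi>: "\<And>e. e \<in> edges_between H X Y \<Longrightarrow> \<phi> e \<in> e \<and> piece (\<phi> e) e \<in> F" by metis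
  \<comment> \<open>A piece determines its edge, so \<open>F\<close> has at least as many elements
    as the cut.\<close>
  have "inj_on (\<lambda>e. piece (\<phi> e) e) (edges_between H X Y)"
    by (rule inj_onI) (use \<phi> piece_eq_iff in \<open>auto simp: edges_between_def\<close>)
  then have "card (edges_between H X Y) \<le> card F" using \<phi> finF by (intro card_inj_on_le) auto
  then show False using cut AB(7) by simp
qed

end

subsection \<open>From the line graph back to the cubic graph\<close>

text \<open>Being consecutive becomes membership in a set that simplification can compute for an
  explicit list.\<close>

lemma consecutive_in_zip_tl: "(x, y) \<in> set (zip (ys @ x # y # zs) (tl (ys @ x # y # zs)))"
  by (induction ys) (auto simp: neq_Nil_conv split: list.splits, (case_tac ys; simp)+)

text \<open>The first vertex occurs in no later edge of the walk, so the arc of the first edge meets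
  the rest only in the second vertex. The set \<open>F\<close> records which edges were used, as is
  needed to compare the arcs of different walks.\<close>

lemma plane_drawing_walk_arc:
  assumes P: "plane_drawing P p \<gamma>" and xs: "distinct xs" "2 \<le> length xs" "set xs \<subseteq> uverts P"
    and adj: "successively (\<lambda>x y. {x, y} \<in> uedges P) xs"
  shows "\<exists>g F. arc g \<and> pathstart g = p (hd xs) \<and> pathfinish g = p (last xs) \<and>
    path_image g = (\<Union>f\<in>F. path_image (\<gamma> f)) \<and> F \<subseteq> uedges P \<and>
    (\<forall>f\<in>F. \<exists>ys zs x y. xs = ys @ x # y # zs \<and> f = {x, y})"
proof -
  have meet: "\<And>e f. e \<in> uedges P \<Longrightarrow> f \<in> uedges P \<Longrightarrow> e \<noteq> f \<Longrightarrow> path_image (\<gamma> e) \<inter> path_image (\<gamma> f) = p ` (e \<inter> f)"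
    using P unfolding plane_drawing_def by simp
  show ?thesis using xs adj
  proof (induction xs rule: induct_list012)
    case (3 x y ys)
    have xy: "{x, y} \<in> uedges P" "x \<noteq> y" using 3 by auto
    have ends: "{pathstart (\<gamma> {x, y}), pathfinish (\<gamma> {x, y})} = {p x, p y}" and arc: "arc (\<gamma> {x, y})"
      using P xy unfolding plane_drawing_def by auto
    have "\<exists>h. arc h \<and> pathstart h = p x \<and> pathfinish h = p y \<and> path_image h = path_image (\<gamma> {x, y})"
      using ends arc unfolding doubleton_eq_iff
      by (metis arc_reversepath path_image_reversepath pathfinish_reversepath pathstart_reversepath)
    then obtain h where h: "arc h" "pathstart h = p x" "pathfinish h = p y" "path_image h = path_image (\<gamma> {x, y})" by blast
    show ?case
    proof (cases ys)
      case Nil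
      have "\<exists>us zs a b. [x, y] = us @ a # b # zs \<and> {x, y} = {a, b}"
        by (intro exI[of _ "[]"] exI[of _ x] exI[of _ y]) simp
      then show ?thesis using h xy Nil by (intro exI[of _ h] exI[of _ "{{x, y}}"]) simp
    next
      case (Cons a as)
      have "\<exists>g F. arc g \<and> pathstart g = p (hd (y # ys)) \<and> pathfinish g = p (last (y # ys)) \<and>
        path_image g = (\<Union>f\<in>F. path_image (\<gamma> f)) \<and> F \<subseteq> uedges P \<and>
        (\<forall>f\<in>F. \<exists>us zs a b. y # ys = us @ a # b # zs \<and> f = {a, b})"
        by (rule "3.IH"(2)) (use "3.prems" Cons in auto)
      then obtain g F where g: "arc g" "pathstart g = p y" "pathfinish g = p (last ys)"
        "path_image g = (\<Union>f\<in>F. path_image (\<gamma> f))" "F \<subseteq> uedges P"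
        and F: "\<And>f. f \<in> F \<Longrightarrow> \<exists>us zs a b. y # ys = us @ a # b # zs \<and> f = {a, b}"
        using Cons by auto
      have Fy: "f \<subseteq> set (y # ys)" if f: "f \<in> F" for f
      proof -
        obtain us zs a b where "y # ys = us @ a # b # zs" "f = {a, b}" using F[OF f] by blast
        then show ?thesis by (metis Un_iff empty_subsetI insert_subset list.set_intros set_append)
      qed
      have xF: "x \<notin> f" if "f \<in> F" for f using Fy[OF that] "3.prems"(1) by auto
      have "path_image h \<inter> path_image g \<subseteq> {pathstart g}"
      proof
        fix t assume t: "t \<in> path_image h \<inter> path_image g"
        then obtain f where f: "f \<in> F" "t \<in> path_image (\<gamma> f)" unfolding g(4) by blast
        have "{x, y} \<noteq> f" using xF[OF f(1)] by blast
        then have "path_image (\<gamma> {x, y}) \<inter> path_image (\<gamma> f) = p ` ({x, y} \<inter> f)"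
          by (intro meet xy(1) subsetD[OF g(5) f(1)]) simp
        then have "t \<in> p ` ({x, y} \<inter> f)" using t f(2) h(4) by blast
        then show "t \<in> {pathstart g}" using xF[OF f(1)] g(2) by auto
      qed
      then have "arc (h +++ g)" using h g by (intro arc_join) auto
      moreover have "path_image (h +++ g) = (\<Union>f\<in>insert {x, y} F. path_image (\<gamma> f))"
        using h g by (subst path_image_join) auto
      moreover have "\<exists>us zs a b. x # y # ys = us @ a # b # zs \<and> f = {a, b}" if f: "f \<in> insert {x, y} F" for f
      proof (cases "f = {x, y}")
        case True then show ?thesis by (intro exI[of _ "[]"] exI[of _ ys] exI[of _ x] exI[of _ y]) simp
      next
        case False
        then obtain us zs a b where "y # ys = us @ a # b # zs" "f = {a, b}" using F f by blast
        then show ?thesis by (intro exI[of _ "x # us"] exI[of _ zs] exI[of _ a] exI[of _ b]) simp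
      qed
      ultimately show ?thesis using h g xy Cons
        by (intro exI[of _ "h +++ g"] exI[of _ "insert {x, y} F"]) auto
    qed
  qed auto
qed

text \<open>The tree grown from \<open>a\<close> without the edge \<open>e\<^sub>0\<close> assigns to every new vertex the edge that reached it.\<close>

lemma injective_edge_choice:
  assumes G: "simple_graph G" and e0: "e0 \<in> uedges G" "a \<in> e0"
    and cut: "\<And>X Y. X \<union> Y = uverts G \<Longrightarrow> X \<inter> Y = {} \<Longrightarrow> X \<noteq> {} \<Longrightarrow> Y \<noteq> {} \<Longrightarrow> 2 \<le> card (edges_between G X Y)"
  shows "\<exists>c. inj_on c (uverts G) \<and> (\<forall>v\<in>uverts G. c v \<in> uedges G \<and> v \<in> c v)"
proof -
  have finV: "finite (uverts G)" and aV: "a \<in> uverts G" using G e0 unfolding simple_graph_def by auto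
  \<comment> \<open>Invariant of the growth: the edge assigned to a vertex of \<open>W\<close> other
    than \<open>a\<close> has both ends in \<open>W\<close>. An edge that leaves \<open>W\<close>
    and differs from \<open>e0\<close> is therefore still free.\<close>
  have "\<exists>c. inj_on c (uverts G) \<and> (\<forall>v\<in>uverts G. c v \<in> uedges G \<and> v \<in> c v)"
    if "a \<in> W" "W \<subseteq> uverts G" "inj_on c W" "\<forall>v\<in>W. c v \<in> uedges G \<and> v \<in> c v" "c a = e0" "\<forall>v\<in>W - {a}. c v \<subseteq> W"
    for W c
    using that
  proof (induction "card (uverts G - W)" arbitrary: W c rule: less_induct)
    case less
    note W = less.prems
    show ?case
    proof (cases "W = uverts G")
      case True then show ?thesis using W by blast
    next
      case False
      have "2 \<le> card (edges_between G W (uverts G - W))" using W False by (intro cut) auto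
      \<comment> \<open>At least two edges leave \<open>W\<close>, so one of them is not
        \<open>e0\<close>, which is reserved for \<open>a\<close>.\<close>
      then have "\<not> edges_between G W (uverts G - W) \<subseteq> {e0}"
        using card_mono[of "{e0}" "edges_between G W (uverts G - W)"] by auto
      then obtain e where e: "e \<in> uedges G" "e \<inter> W \<noteq> {}" "e \<inter> (uverts G - W) \<noteq> {}" "e \<noteq> e0"
        unfolding edges_between_def by blast
      obtain b d where "e = {b, d}" by (rule simple_graph_edgeE[OF G e(1)])
      then obtain w x where wx: "e = {w, x}" "w \<in> W" "x \<in> uverts G" "x \<notin> W" using e(2,3) by auto
      let ?c = "c(x := e)"
      have "e \<notin> c ` W"
      proof
        assume "e \<in> c ` W"
        then obtain v where "v \<in> W" "e = c v" by blast
        then have "e \<subseteq> W" using W(5,6) e(4) by (cases "v = a") auto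
        then show False using wx by auto
      qed
      then have "inj_on ?c (insert x W)" using W(3) wx(4) by (auto simp: inj_on_def)
      moreover have "card (uverts G - insert x W) < card (uverts G - W)"
        using wx finV by (intro psubset_card_mono) auto
      moreover have "x \<noteq> a" using wx(4) W(1) by blast
      ultimately show ?thesis using W wx e(1)
        by (intro less.hyps[of "insert x W" ?c]) auto
    qed
  qed
  from this[of "{a}" "\<lambda>_. e0"] show ?thesis using e0 aV by auto
qed

context decorated_graph
begin

lemma piece_in_star: "e \<in> uedges H \<Longrightarrow> v \<in> e \<Longrightarrow> piece v e \<in> star v"
  unfolding star_def using piece_in unfolding piece_def by auto

text \<open>Given a cut with at most two edges, \<open>F\<close> takes from every cut edge the piece
  at its end in \<open>X\<close>. The stars of \<open>X\<close> without \<open>F\<close> form a side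
  \<open>A\<close> that is adjacent to nothing in \<open>B\<close>, and both sides are nonempty
  because every star has at least three edges.\<close>

lemma three_connected_of_line_graph_decorated:
  assumes cub: "cubic H" and ne: "uverts H \<noteq> {}" and con: "k_connected 3 (line_graph decorated)"
  shows "k_connected 3 H"
  unfolding cubic_3_connected_iff[OF simple cub ne]
proof (intro allI impI)
  let ?V = "uverts H"
  fix X Y assume XY: "X \<union> Y = ?V" "X \<inter> Y = {}" "X \<noteq> {}" "Y \<noteq> {}"
  show "3 \<le> card (edges_between H X Y)"
  proof (rule ccontr)
    assume "\<not> 3 \<le> card (edges_between H X Y)"
    then have le: "card (edges_between H X Y) < 3" by simp
    let ?C = "edges_between H X Y"
    have "\<exists>x. x \<in> e \<and> x \<in> X" if "e \<in> ?C" for e using that unfolding edges_between_def by blast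
    then obtain \<psi> where \<psi>: "\<And>e. e \<in> ?C \<Longrightarrow> \<psi> e \<in> e \<and> \<psi> e \<in> X" by metis
    have C_X: "e \<in> ?C \<Longrightarrow> v \<in> e \<Longrightarrow> v \<in> X \<Longrightarrow> v = \<psi> e" for e v
    proof -
      assume e: "e \<in> ?C" "v \<in> e" "v \<in> X"
      have "e \<in> uedges H" "e \<inter> Y \<noteq> {}" using e(1) unfolding edges_between_def by auto
      moreover obtain a b where "e = {a, b}" by (rule simple_graph_edgeE[OF simple \<open>e \<in> uedges H\<close>])
      ultimately show "v = \<psi> e" using e(2,3) \<psi>[OF e(1)] XY(2) by auto
    qed
    define F where "F = (\<lambda>e. piece (\<psi> e) e) ` ?C"
    have finC: "finite ?C" by (rule finite_edges_between[OF simple])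
    have cF: "card F < 3" unfolding F_def using le card_image_le[OF finC] by (meson le_less_trans)
    have finF: "finite F" unfolding F_def using finC by simp
    have star3: "\<not> star v \<subseteq> F" if "v \<in> ?V" for v
    proof
      assume "star v \<subseteq> F"
      then have "card (star v) \<le> card F" by (rule card_mono[OF finF])
      then show False using card_star[OF that] cub that cF unfolding cubic_def by simp
    qed
    have FE: "F \<subseteq> uedges decorated" unfolding F_def edges_between_def using \<psi> piece_in by (auto simp: edges_between_def)
    have sE: "star v \<subseteq> uedges decorated" for v unfolding star_def by blast
    define A where "A = (\<Union>x\<in>X. star x) - F"
    define B where "B = uedges decorated - A - F"
    \<comment> \<open>An edge in a star of \<open>X\<close> and in a star of \<open>Y\<close> is an
      unsubdivided cut edge, which is its own piece and so belongs to \<open>F\<close>.\<close>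
    have both: "f \<in> F" if f: "f \<in> star x" "x \<in> X" "f \<in> star y" "y \<in> Y" for f x y
    proof -
      have V: "x \<in> ?V" "y \<in> ?V" "x \<noteq> y" using XY f by auto
      have fx: "f \<in> uedges decorated" "x \<in> f" "y \<in> f" using f unfolding star_def by auto
      from fx(1) show ?thesis
      proof (cases rule: decorated_edgeE)
        case (piece v e)
        have xe: "x \<in> e" "piece v e = piece x e" "y \<in> e" "piece v e = piece y e"
          using mem_piece_iff[OF piece(2,3)] V fx piece(1) by auto
        then have "e \<in> ?C" unfolding edges_between_def using piece f by blast
        then show ?thesis unfolding F_def using C_X[of e x] xe(1,2) f(2) piece(1) by blast
      next
        case (pendant u)
        then show ?thesis using fx V l_notin by auto
      qed
    qed
    have "A \<noteq> {}" using XY(1,3) star3 unfolding A_def by blast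
    moreover have "B \<noteq> {}"
    proof -
      obtain y where y: "y \<in> Y" using XY by blast
      then obtain f where f: "f \<in> star y" "f \<notin> F" using star3 XY by blast
      then have "f \<notin> A" using both y unfolding A_def by blast
      then show ?thesis using f sE unfolding B_def by blast
    qed
    ultimately have "edges_between (line_graph decorated) A B \<noteq> {}"
      using cF FE sE by (intro k_connected_edges_between[OF con simple_line_graph[OF simple_decorated], of _ _ F])
        (auto simp: A_def B_def)
    then obtain f g k where fg: "f \<in> A" "g \<in> B" "k \<in> uedges (line_graph decorated)" "f \<in> k" "g \<in> k"
      unfolding edges_between_def by blast
    have "f \<noteq> g" using fg(1,2) unfolding B_def by blast
    then have int: "f \<inter> g \<noteq> {}" using fg(3-5) by auto
    have fE: "f \<in> uedges decorated" "g \<in> uedges decorated" using fg sE unfolding A_def B_def by auto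
    from fE \<open>f \<noteq> g\<close> int show False
    proof (cases rule: decorated_edge_Int)
      case (vertex v)
      have "v \<notin> X" using vertex(3) fg(2) unfolding A_def B_def by blast
      then have "v \<in> Y" using XY(1) vertex(1) by blast
      then show False using both vertex(2) fg(1) unfolding A_def by blast
    next
      case (halves e v w)
      have eE: "e \<in> uedges H" "v \<in> e" "w \<in> e" using halves S by auto
      have vw: "v \<in> ?V" "w \<in> ?V" using edge_verts eE by auto
      have "w \<notin> X" using fg(2) halves(4) piece_in_star[OF eE(1,3)] unfolding A_def B_def by blast
      then have w: "w \<in> Y" using XY(1) vw by blast
      obtain x where x: "x \<in> X" "f \<in> star x" using fg(1) unfolding A_def by blast
      have "x \<in> piece v e \<inter> ?V" using x XY(1) halves(3) unfolding star_def by blast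
      then have "x = v" using piece_Int_verts[OF eE(1,2)] halves(1) by simp
      then have v: "v \<in> X" using x by simp
      then have "e \<in> ?C" unfolding edges_between_def using eE w by blast
      then have "f \<in> F" unfolding F_def halves(3) using C_X[of e v] eE(2) v by blast
      then show False using fg(1) unfolding A_def by blast
    qed
  qed
qed

text \<open>A subdivision of \<open>H\<close> in its line graph: \<open>v\<close> is drawn at the vertex of its chosen edge \<open>c v\<close>, and every
  edge of \<open>H\<close> follows a path of the triangles. Injectivity of \<open>c\<close> keeps these paths internally disjoint.\<close>

lemma planar_of_line_graph_decorated:
  assumes pl: "planar (line_graph decorated)"
    and c: "inj_on c (uverts H)" "\<And>v. v \<in> uverts H \<Longrightarrow> c v \<in> uedges H \<and> v \<in> c v"
  shows "planar H"
proof -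
  let ?V = "uverts H" and ?E = "uedges H" and ?L = "line_graph decorated"
  obtain p \<gamma> where P: "plane_drawing ?L p \<gamma>" using pl unfolding planar_def by blast
  have pinj: "inj_on p (uedges decorated)" using P unfolding plane_drawing_def by simp
  have pm: "path_image (\<gamma> k) \<inter> p ` uedges decorated = p ` k" if "k \<in> uedges ?L" for k
    using P that unfolding plane_drawing_def by (metis line_graph_simps(1))
  have pk: "path_image (\<gamma> k) \<inter> path_image (\<gamma> k') = p ` (k \<inter> k')" if "k \<in> uedges ?L" "k' \<in> uedges ?L" "k \<noteq> k'" for k k'
    using P that unfolding plane_drawing_def by blast
  define h where "h v = piece v (c v)" for v
  \<comment> \<open>The line graph vertices that the path for \<open>e\<close> may visit: the chosen
    ones at its ends and the pieces of \<open>e\<close>.\<close>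
  define N where "N e = h ` e \<union> (\<lambda>u. piece u e) ` e" for e
  have hD: "h v \<in> uedges decorated" if "v \<in> ?V" for v unfolding h_def using c(2)[OF that] piece_in by blast
  have adj: "{piece u e, piece u f} \<in> uedges ?L" if "e \<in> ?E" "f \<in> ?E" "u \<in> e" "u \<in> f" "e \<noteq> f" for e f u
  proof -
    have "piece u e \<noteq> piece u f" using piece_eq_iff[OF that(1,3,2,4)] that(5) by simp
    moreover have "u \<in> piece u e \<inter> piece u f" using that(3,4) unfolding piece_def by auto
    ultimately show ?thesis using piece_in[OF that(1,3)] piece_in[OF that(2,4)] by (intro line_graph_edgeI[of _ _ _ u]) auto
  qed
  have adj2: "{piece u e, piece v e} \<in> uedges ?L" if "e \<in> S" "u \<in> e" "v \<in> e" "u \<noteq> v" for e u v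
  proof -
    have e: "e \<in> ?E" using that S by blast
    have "piece u e \<noteq> piece v e" using piece_eq_iff[OF e that(2) e that(3)] that by simp
    moreover have "z e \<in> piece u e \<inter> piece v e" using that(1) unfolding piece_def by auto
    ultimately show ?thesis using piece_in[OF e that(2)] piece_in[OF e that(3)] by (intro line_graph_edgeI[of _ _ _ "z e"]) auto
  qed
  define R where "R e g F \<longleftrightarrow> arc g \<and> {pathstart g, pathfinish g} = (p \<circ> h) ` e \<and>
      path_image g = (\<Union>k\<in>F. path_image (\<gamma> k)) \<and> F \<subseteq> uedges ?L \<and>
      (\<forall>k\<in>F. (\<exists>u\<in>e. k = {h u, piece u e}) \<or> k = (\<lambda>u. piece u e) ` e)" for e g F
  have "\<exists>g F. R e g F" if e: "e \<in> ?E" for e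
  proof -
    obtain u v where uv: "e = {u, v}" "u \<noteq> v" "u \<in> ?V" "v \<in> ?V" by (rule simple_graph_edgeE[OF simple e])
    define mid where "mid = (if e \<in> S then [piece u e, piece v e] else [piece u e])"
    \<comment> \<open>The path runs from \<open>h u\<close> in the clique at \<open>u\<close>,
      across \<open>e\<close>, to \<open>h v\<close> in the clique at \<open>v\<close>. A chosen
      vertex is not repeated if it already is a piece of \<open>e\<close>.\<close>
    define xs where "xs = (if c u = e then [] else [h u]) @ mid @ (if c v = e then [] else [h v])"
    have cu: "c u \<in> ?E" "u \<in> c u" "c v \<in> ?E" "v \<in> c v" using c(2) uv by auto
    have cne: "c u \<noteq> c v" using c(1) uv by (auto dest: inj_onD)
    have whole: "piece v e = piece u e" if "e \<notin> S" using that unfolding piece_def by simp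
    have ue: "u \<in> e" "v \<in> e" using uv by auto
    have "piece u e = piece v e \<longleftrightarrow> e \<notin> S" using piece_eq_iff[OF e ue(1) e ue(2)] uv(2) by simp
    moreover have "h u = piece u e \<longleftrightarrow> c u = e" unfolding h_def using piece_eq_iff[OF cu(1,2) e ue(1)] by simp
    moreover have "h v = piece v e \<longleftrightarrow> c v = e" unfolding h_def using piece_eq_iff[OF cu(3,4) e ue(2)] by simp
    moreover have "h u = piece v e \<longleftrightarrow> c u = e \<and> e \<notin> S"
      unfolding h_def using piece_eq_iff[OF cu(1,2) e ue(2)] uv(2) by metis
    moreover have "h v = piece u e \<longleftrightarrow> c v = e \<and> e \<notin> S"
      unfolding h_def using piece_eq_iff[OF cu(3,4) e ue(1)] uv(2) by metis
    moreover have "h u \<noteq> h v" unfolding h_def using piece_eq_iff[OF cu] cne by simp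
    ultimately have peq: "piece u e = piece v e \<longleftrightarrow> e \<notin> S" "h u = piece u e \<longleftrightarrow> c u = e" "h v = piece v e \<longleftrightarrow> c v = e"
      "h u = piece v e \<longleftrightarrow> c u = e \<and> e \<notin> S" "h v = piece u e \<longleftrightarrow> c v = e \<and> e \<notin> S" "h u \<noteq> h v" by simp_all
    have dist: "distinct xs" unfolding xs_def mid_def using peq by (cases "e \<in> S"; cases "c u = e"; cases "c v = e"; simp; metis)
    \<comment> \<open>If both ends had chosen an unsubdivided \<open>e\<close>, the path would
      shrink to one vertex; injectivity of \<open>c\<close> prevents this.\<close>
    have len: "2 \<le> length xs" unfolding xs_def mid_def using cne by (cases "e \<in> S"; cases "c u = e"; cases "c v = e"; simp)
    have hd: "hd xs = h u" unfolding xs_def mid_def using peq(2) by (cases "e \<in> S"; cases "c u = e"; simp)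
    have last: "last xs = h v" unfolding xs_def mid_def using peq(1,3) by (cases "e \<in> S"; cases "c v = e"; simp)
    have sub: "set xs \<subseteq> uverts ?L" unfolding xs_def mid_def using hD uv(3,4) piece_in[OF e] ue by auto
    have hu: "{h u, piece u e} \<in> uedges ?L" if "c u \<noteq> e" unfolding h_def using adj[OF cu(1) e cu(2) ue(1) that] .
    have hv: "{piece v e, h v} \<in> uedges ?L" if "c v \<noteq> e" unfolding h_def using adj[OF e cu(3) ue(2) cu(4)] that by blast
    have suc: "successively (\<lambda>x y. {x, y} \<in> uedges ?L) xs"
      unfolding xs_def mid_def using hu hv adj2[OF _ ue uv(2)] whole
      by (cases "e \<in> S"; cases "c u = e"; cases "c v = e"; simp del: line_graph_simps)
    obtain g F where g: "arc g" "pathstart g = p (hd xs)" "pathfinish g = p (last xs)"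
      "path_image g = (\<Union>f\<in>F. path_image (\<gamma> f))" "F \<subseteq> uedges ?L"
      and F: "\<forall>f\<in>F. \<exists>ys zs x y. xs = ys @ x # y # zs \<and> f = {x, y}"
      using plane_drawing_walk_arc[OF P dist len sub suc] by (elim exE conjE) (rule that)
    have "(\<exists>u\<in>e. k = {h u, piece u e}) \<or> k = (\<lambda>u. piece u e) ` e" if k: "k \<in> F" for k
    proof -
      obtain ys zs x y where xs: "xs = ys @ x # y # zs" "k = {x, y}"
        using F[rule_format, OF k] by (elim exE conjE) (rule that)
      have "(x = h u \<and> y = piece u e) \<or> (x = piece u e \<and> y = piece v e \<and> e \<in> S) \<or> (x = piece v e \<and> y = h v)"
        using consecutive_in_zip_tl[of x y ys zs, folded xs(1)] whole unfolding xs_def mid_def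
        by (cases "e \<in> S"; cases "c u = e"; cases "c v = e"; auto)
      then consider "k = {h u, piece u e}" | "k = {h v, piece v e}" | "k = {piece u e, piece v e}"
        using xs(2) by (elim disjE conjE) (simp_all add: insert_commute)
      then show ?thesis
        by cases (use ue in blast, use ue in blast, simp add: uv(1))
    qed
    then have "R e g F" unfolding R_def using g hd last uv(1) by simp
    then show ?thesis by blast
  qed
  then obtain g F where R: "\<And>e. e \<in> ?E \<Longrightarrow> R e (g e) (F e)" by metis
  have g: "arc (g e)" "{pathstart (g e), pathfinish (g e)} = (p \<circ> h) ` e" "path_image (g e) = (\<Union>k\<in>F e. path_image (\<gamma> k))"
    "F e \<subseteq> uedges ?L" if "e \<in> ?E" for e using R[OF that] unfolding R_def by simp_all
  have F: "(\<exists>u\<in>e. k = {h u, piece u e}) \<or> k = (\<lambda>u. piece u e) ` e" if "e \<in> ?E" "k \<in> F e" for e k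
    using R[OF that(1)] that(2) unfolding R_def by blast
  have FN: "k \<subseteq> N e" if "e \<in> ?E" "k \<in> F e" for e k using F[OF that] unfolding N_def by blast
  have hN: "w \<in> e" if e: "e \<in> ?E" and w: "w \<in> ?V" "h w \<in> N e" for w e
  proof -
    note cw = c(2)[OF w(1)]
    from w(2) consider u where "u \<in> e" "h w = h u" | u where "u \<in> e" "h w = piece u e" unfolding N_def by blast
    then show ?thesis
    proof cases
      case (1 u)
      have u: "u \<in> ?V" using edge_verts[OF e 1(1)] .
      have "c w = c u" using 1(2) piece_eq_iff[of "c w" w "c u" u] cw c(2)[OF u] unfolding h_def by blast
      then have "w = u" using c(1) w(1) u by (auto dest: inj_onD)
      then show ?thesis using 1 by simp
    next
      case (2 u)
      then have "c w = e" using piece_eq_iff[of "c w" w e u] cw e unfolding h_def by blast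
      then show ?thesis using cw by simp
    qed
  qed
  \<comment> \<open>A piece of \<open>e\<close> is never a piece of \<open>f\<close>, so a common
    vertex is some \<open>h w\<close>, and \<open>hN\<close> puts \<open>w\<close> on both
    edges.\<close>
  have NN: "N e \<inter> N f \<subseteq> h ` (e \<inter> f)" if ef: "e \<in> ?E" "f \<in> ?E" "e \<noteq> f" for e f
  proof
    fix x assume x: "x \<in> N e \<inter> N f"
    have "\<not> (\<exists>u\<in>e. \<exists>v\<in>f. x = piece u e \<and> x = piece v f)" using piece_eq_iff ef by metis
    then obtain w where w: "w \<in> ?V" "x = h w" using x ef edge_verts unfolding N_def by blast
    then show "x \<in> h ` (e \<inter> f)" using hN[OF ef(1) w(1)] hN[OF ef(2) w(1)] x by blast
  qed
  \<comment> \<open>An edge of the line graph has two ends, but two distinct edges of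
    \<open>H\<close> share at most one vertex \<open>w\<close> and their paths at most one
    \<open>h w\<close>.\<close>
  have FF: "F e \<inter> F f = {}" if ef: "e \<in> ?E" "f \<in> ?E" "e \<noteq> f" for e f
  proof (rule ccontr)
    assume "F e \<inter> F f \<noteq> {}"
    then obtain k where k: "k \<in> F e" "k \<in> F f" by blast
    have "k \<subseteq> h ` (e \<inter> f)" using NN[OF ef] FN[OF ef(1) k(1)] FN[OF ef(2) k(2)] by blast
    moreover have "\<exists>x. e \<inter> f \<subseteq> {x}"
      using simple_graph_edge_Int[OF simple ef] by (cases "e \<inter> f = {}") auto
    ultimately obtain x where "k \<subseteq> {h x}" by blast
    moreover have "card k = 2" using k(1) g(4)[OF ef(1)] simple_line_graph[OF simple_decorated] unfolding simple_graph_def by blast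
    ultimately show False using card_mono[of "{h x}" k] by simp
  qed
  have hinj: "inj_on (p \<circ> h) ?V"
  proof (intro comp_inj_on inj_on_subset[OF pinj])
    show "inj_on h ?V"
    proof (rule inj_onI)
      fix u w assume uw: "u \<in> ?V" "w \<in> ?V" "h u = h w"
      then have "c u = c w" using piece_eq_iff[of "c u" u "c w" w] c(2)[OF uw(1)] c(2)[OF uw(2)] unfolding h_def by blast
      then show "u = w" using c(1) uw by (auto dest: inj_onD)
    qed
  qed (use hD in auto)
  have ge: "(p \<circ> h) ` e \<subseteq> path_image (g e)" if "e \<in> ?E" for e
    using g(2)[OF that] pathstart_in_path_image[of "g e"] pathfinish_in_path_image[of "g e"] by (metis empty_subsetI insert_subset)
  have "plane_drawing H (p \<circ> h) g"
    unfolding plane_drawing_def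
  proof (intro conjI ballI impI hinj)
    fix e assume e: "e \<in> ?E"
    show "arc (g e)" "{pathstart (g e), pathfinish (g e)} = (p \<circ> h) ` e" by (rule g[OF e])+
    have "w \<in> e" if w: "w \<in> ?V" "p (h w) \<in> path_image (g e)" for w
    proof -
      obtain k where k: "k \<in> F e" "p (h w) \<in> path_image (\<gamma> k)" using w(2) g(3)[OF e] by blast
      have kL: "k \<in> uedges ?L" using k g(4)[OF e] by blast
      then have "p (h w) \<in> p ` k" using pm[OF kL] k(2) hD[OF w(1)] by blast
      moreover have "k \<subseteq> uedges decorated" using kL by auto
      ultimately have "h w \<in> k" using pinj hD[OF w(1)] unfolding inj_on_def by blast
      then show ?thesis using FN[OF e k(1)] hN[OF e w(1)] by blast
    qed
    then show "path_image (g e) \<inter> (p \<circ> h) ` ?V = (p \<circ> h) ` e" using ge[OF e] edge_verts[OF e] by auto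
    fix f assume f: "f \<in> ?E" and ef: "e \<noteq> f"
    have "path_image (g e) \<inter> path_image (g f) \<subseteq> (p \<circ> h) ` (e \<inter> f)"
    proof
      fix t assume "t \<in> path_image (g e) \<inter> path_image (g f)"
      then obtain k k' where k: "k \<in> F e" "k' \<in> F f" "t \<in> path_image (\<gamma> k)" "t \<in> path_image (\<gamma> k')"
        unfolding g(3)[OF e] g(3)[OF f] by blast
      have "k \<noteq> k'" using FF[OF e f ef] k by blast
      then have "t \<in> p ` (k \<inter> k')" using pk[of k k'] k g(4)[OF e] g(4)[OF f] by blast
      moreover have "k \<inter> k' \<subseteq> h ` (e \<inter> f)" using NN[OF e f ef] FN[OF e k(1)] FN[OF f k(2)] by blast
      ultimately show "t \<in> (p \<circ> h) ` (e \<inter> f)" by auto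
    qed
    then show "path_image (g e) \<inter> path_image (g f) = (p \<circ> h) ` (e \<inter> f)" using ge[OF e] ge[OF f] by blast
  qed
  then show ?thesis unfolding planar_def by blast
qed

end

subsection \<open>Line graphs that are polyhedral\<close>

lemma finite_inc: "simple_graph G \<Longrightarrow> finite {e \<in> uedges G. v \<in> e}"
  using simple_graph_finite_edges[of G] by simp

lemma edge_unique:
  "simple_graph G \<Longrightarrow> e \<in> uedges G \<Longrightarrow> f \<in> uedges G \<Longrightarrow> u \<in> e \<Longrightarrow> v \<in> e \<Longrightarrow> u \<in> f \<Longrightarrow> v \<in> f \<Longrightarrow> u \<noteq> v \<Longrightarrow> e = f"
  by (metis IntI singletonD simple_graph_edge_Int)

lemma line_graph_separation:
  assumes G: "simple_graph G" and con: "k_connected k (line_graph G)"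
    and "A \<union> B \<union> F = uedges G" "A \<inter> B = {}" "A \<inter> F = {}" "B \<inter> F = {}" "A \<noteq> {}" "B \<noteq> {}" "card F < k"
  obtains a b x where "a \<in> A" "b \<in> B" "x \<in> a" "x \<in> b"
proof -
  have "edges_between (line_graph G) A B \<noteq> {}"
    using assms(3-) by (intro k_connected_edges_between[OF con simple_line_graph[OF G], of _ _ F]) auto
  then obtain k a b where k: "k \<in> uedges (line_graph G)" "a \<in> k" "a \<in> A" "b \<in> k" "b \<in> B" unfolding edges_between_def by blast
  then have "a \<inter> b \<noteq> {}" using assms(4) by auto
  then show ?thesis using that k by blast
qed

text \<open>The line graph does not see isolated vertices, while the construction from a cubic graph
  never produces one; hence \<open>no_isolated\<close>.\<close>

locale polyhedral_line_graph =
  fixes G :: "'a ugraph"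
  assumes simple: "simple_graph G" and no_isolated: "\<And>v. v \<in> uverts G \<Longrightarrow> vdegree G v \<noteq> 0"
    and planar_L: "planar (line_graph G)" and con_L: "k_connected 3 (line_graph G)"
    and not_exceptional: "\<not> exceptional G"
begin

abbreviation inc :: "'a \<Rightarrow> 'a set set" where
  "inc v \<equiv> {e \<in> uedges G. v \<in> e}"

lemma finE: "finite (uedges G)" and fin_inc: "finite (inc v)"
  using simple_graph_finite_edges[OF simple] by simp_all

lemma edge_verts: "e \<in> uedges G \<Longrightarrow> v \<in> e \<Longrightarrow> v \<in> uverts G"
  using simple unfolding simple_graph_def by blast

lemma card_E: "4 \<le> card (uedges G)"
  using con_L unfolding k_connected_def by simp

text \<open>In the line graph the edge between \<open>u\<close> and \<open>v\<close> has
  \<open>vdegree G u + vdegree G v - 2\<close> neighbours. If there were fewer than three, their set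
  \<open>?F\<close> would separate it from the remaining edges, which exist by
  \<open>card_E\<close>.\<close>

lemma degree_sum:
  assumes e: "{u, v} \<in> uedges G" "u \<noteq> v"
  shows "5 \<le> vdegree G u + vdegree G v"
proof (rule ccontr)
  assume less: "\<not> 5 \<le> vdegree G u + vdegree G v"
  let ?F = "inc u \<union> inc v - {{u, v}}"
  have "f = {u, v}" if "f \<in> uedges G" "u \<in> f" "v \<in> f" for f
    by (rule edge_unique[OF simple that(1) e(1) that(2,3) _ _ e(2)]) simp_all
  then have "inc u \<inter> inc v = {{u, v}}" using e by blast
  then have "card (inc u \<union> inc v) + 1 = vdegree G u + vdegree G v"
    using card_Un_Int[OF fin_inc fin_inc, of u v] unfolding vdegree_def by simp
  moreover have "{u, v} \<in> inc u \<union> inc v" using e by simp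
  ultimately have F: "card ?F < 3" using less fin_inc by (simp add: card_Diff_singleton)
  let ?B = "uedges G - {{u, v}} - ?F"
  have finF: "finite ?F" using fin_inc by simp
  have "card (insert {u, v} ?F) = Suc (card ?F)" using finF by (intro card_insert_disjoint) simp_all
  then have "card (insert {u, v} ?F) \<le> 3" using F by simp
  then have "\<not> uedges G \<subseteq> insert {u, v} ?F" using card_E card_mono[of "insert {u, v} ?F" "uedges G"] finF by auto
  then have B: "?B \<noteq> {}" by blast
  show False
  proof (rule line_graph_separation[OF simple con_L, of "{{u, v}}" ?B ?F])
    show "{{u, v}} \<union> ?B \<union> ?F = uedges G" using e by auto
    fix a b x assume "a \<in> {{u, v}}" "b \<in> ?B" "x \<in> a" "x \<in> b"
    then show False by auto
  qed (use F B in auto)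
qed

text \<open>The edges away from \<open>v\<close>, grouped into the components of the line graph minus the clique of edges at \<open>v\<close>.\<close>

definition outer_step :: "'a \<Rightarrow> ('a set \<times> 'a set) set" where
  "outer_step v = {(e, f). e \<in> uedges G - inc v \<and> f \<in> uedges G - inc v \<and> {e, f} \<in> uedges (line_graph G)}"

definition outer_component :: "'a \<Rightarrow> 'a set \<Rightarrow> 'a set set" where
  "outer_component v g = {f. (g, f) \<in> (outer_step v)\<^sup>*}"

definition attached :: "'a set set \<Rightarrow> 'a \<Rightarrow> 'a set set" where
  "attached C v = {k \<in> inc v. \<exists>f\<in>C. f \<inter> k \<noteq> {}}"

text \<open>Edges at a common vertex are pairwise adjacent in the line graph, so
  \<open>plane_drawing_no_common_face\<close> applies to any four of them.\<close>

lemma no_common_face: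
  assumes k: "distinct [k1, k2, k3, k4]" "{k1, k2, k3, k4} \<subseteq> inc v"
    and C: "C \<subseteq> uedges G" "C \<inter> {k1, k2, k3, k4} = {}" "g \<in> C"
    and con: "\<And>f. f \<in> C \<Longrightarrow> (g, f) \<in> {(e, f). e \<in> C \<and> f \<in> C \<and> {e, f} \<in> uedges (line_graph G)}\<^sup>*"
    and att: "\<And>k. k \<in> {k1, k2, k3, k4} \<Longrightarrow> \<exists>f\<in>C. f \<inter> k \<noteq> {}"
  shows False
proof -
  obtain p \<gamma> where P: "plane_drawing (line_graph G) p \<gamma>" using planar_L unfolding planar_def by blast
  have E: "{k, k'} \<in> uedges (line_graph G)" if "k \<in> {k1, k2, k3, k4}" "k' \<in> {k1, k2, k3, k4}" "k \<noteq> k'" for k k'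
    by (rule line_graph_edgeI[of _ _ _ v]) (use that k(2) in auto)
  show False
  proof (rule plane_drawing_no_common_face[OF P k(1), of C g])
    show "\<exists>x\<in>C. {x, k} \<in> uedges (line_graph G)" if k0: "k \<in> {k1, k2, k3, k4}" for k
    proof -
      obtain f x where f: "f \<in> C" "x \<in> f" "x \<in> k" using att[OF k0] by blast
      have "f \<noteq> k" using f(1) k0 C(2) by blast
      then have "{f, k} \<in> uedges (line_graph G)" using f k0 k(2) C(1) by (intro line_graph_edgeI[of _ _ _ x]) auto
      then show ?thesis using f(1) by blast
    qed
  qed (use k C E con in \<open>auto simp del: line_graph_simps simp: line_graph_simps(1)\<close>)
qed

lemma four_elements:
  assumes "4 \<le> card A"
  obtains a b c d where "distinct [a, b, c, d]" "{a, b, c, d} \<subseteq> A"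
proof -
  obtain T where T: "T \<subseteq> A" "card T = 4" "finite T" using obtain_subset_with_card_n[OF assms] by metis
  obtain xs where xs: "set xs = T" "distinct xs" using finite_distinct_list[OF T(3)] by blast
  then have "length xs = 4" using T(2) distinct_card by metis
  then obtain a b c d where "xs = [a, b, c, d]" by (auto simp: numeral_eq_Suc length_Suc_conv)
  then show ?thesis using that[of a b c d] xs T(1) by auto
qed

text \<open>A fifth edge at \<open>v\<close> is adjacent to four others and serves alone as the
  connected set.\<close>

lemma degree_le_4: "vdegree G v \<le> 4"
proof (rule ccontr)
  assume "\<not> vdegree G v \<le> 4"
  then have c5: "5 \<le> card (inc v)" unfolding vdegree_def by simp
  obtain k1 k2 k3 k4 where k: "distinct [k1, k2, k3, k4]" "{k1, k2, k3, k4} \<subseteq> inc v"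
    by (rule four_elements[of "inc v"]) (use c5 in simp)
  have "card {k1, k2, k3, k4} = 4" using k(1) by simp
  then have "\<not> inc v \<subseteq> {k1, k2, k3, k4}" using c5 card_mono[of "{k1, k2, k3, k4}" "inc v"] by auto
  then obtain g where g: "g \<in> inc v" "g \<notin> {k1, k2, k3, k4}" by blast
  show False
    by (rule no_common_face[OF k, of "{g}" g]) (use g k(2) in auto)
qed

lemma outer_component_edges:
  assumes "g \<in> uedges G - inc v" "f \<in> outer_component v g"
  shows "f \<in> uedges G - inc v"
proof -
  have "(g, f) \<in> (outer_step v)\<^sup>*" using assms(2) unfolding outer_component_def by simp
  then show ?thesis by (induction rule: rtrancl_induct) (use assms(1) in \<open>auto simp: outer_step_def\<close>)
qed

lemma outer_component_closed:
  assumes "g \<in> uedges G - inc v" "f \<in> outer_component v g" "h \<in> uedges G - inc v" "x \<in> f" "x \<in> h"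
  shows "h \<in> outer_component v g"
proof (cases "f = h")
  case False
  have "{f, h} \<in> uedges (line_graph G)"
    using outer_component_edges[OF assms(1,2)] assms(3-5) False by (intro line_graph_edgeI[of _ _ _ x]) auto
  then have "(f, h) \<in> outer_step v" unfolding outer_step_def using outer_component_edges[OF assms(1,2)] assms(3) by blast
  then show ?thesis using assms(2) unfolding outer_component_def by (auto intro: rtrancl_into_rtrancl)
qed (use assms in simp)

lemma outer_component_sym:
  assumes "f \<in> outer_component v g"
  shows "g \<in> outer_component v f"
proof -
  have "sym (outer_step v)" unfolding sym_def outer_step_def by (auto simp del: line_graph_simps simp: insert_commute)
  then show ?thesis using assms unfolding outer_component_def by (auto dest: symD[OF sym_rtrancl])
qed

lemma outer_component_trans:
  "f \<in> outer_component v g \<Longrightarrow> h \<in> outer_component v f \<Longrightarrow> h \<in> outer_component v g"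
  unfolding outer_component_def by (auto intro: rtrancl_trans)

text \<open>At least 3 by 3-connectedness, and not 4 because the four edges at \<open>v\<close> form a drawn \<open>K\<^sub>4\<close>.\<close>

lemma card_attached:
  assumes v: "vdegree G v = 4" and g: "g \<in> uedges G - inc v"
  shows "card (attached (outer_component v g) v) = 3"
proof -
  let ?C = "outer_component v g" and ?K = "attached (outer_component v g) v"
  have gC: "g \<in> ?C" unfolding outer_component_def by simp
  have CE: "?C \<subseteq> uedges G - inc v" using outer_component_edges[OF g] by blast
  have Ki: "?K \<subseteq> inc v" unfolding attached_def by blast
  have ci: "card (inc v) = 4" using v unfolding vdegree_def .
  have le: "card ?K \<le> 4" using card_mono[OF fin_inc Ki] ci by simp
  have "?K \<noteq> inc v"
  proof
    assume all: "?K = inc v"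
    obtain k1 k2 k3 k4 where k: "distinct [k1, k2, k3, k4]" "{k1, k2, k3, k4} \<subseteq> inc v"
      by (rule four_elements[of "inc v"]) (simp add: ci)
    show False
    proof (rule no_common_face[OF k, of ?C g])
      show "?C \<inter> {k1, k2, k3, k4} = {}" using CE k(2) by blast
      show "?C \<subseteq> uedges G" "g \<in> ?C" using CE gC by auto
      show "\<exists>f\<in>?C. f \<inter> k \<noteq> {}" if "k \<in> {k1, k2, k3, k4}" for k using that k(2) all unfolding attached_def by blast
      fix f assume "f \<in> ?C"
      then have "(g, f) \<in> (outer_step v)\<^sup>*" unfolding outer_component_def by simp
      then show "(g, f) \<in> {(e, f). e \<in> ?C \<and> f \<in> ?C \<and> {e, f} \<in> uedges (line_graph G)}\<^sup>*"
      proof induction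
        case (step y w)
        then have "y \<in> ?C" "w \<in> ?C" "{y, w} \<in> uedges (line_graph G)"
          unfolding outer_component_def by (auto simp: outer_step_def simp del: line_graph_simps intro: rtrancl_into_rtrancl)
        then show ?case using step.IH by (auto simp del: line_graph_simps intro: rtrancl_into_rtrancl)
      qed simp
    qed
  qed
  then have "card ?K < card (inc v)" using Ki by (intro psubset_card_mono fin_inc) blast
  then have "card ?K < 4" using ci by simp
  \<comment> \<open>Otherwise \<open>?K\<close> separates the component from an edge at
    \<open>v\<close> to which it is not attached; such an edge exists because \<open>?K\<close> is
    not all of \<open>inc v\<close>.\<close>
  moreover have "\<not> card ?K < 3"
  proof
    assume lt: "card ?K < 3"
    let ?B = "uedges G - ?C - ?K"
    have "?B \<noteq> {}"
    proof -
      obtain k where "k \<in> inc v" "k \<notin> ?K" using \<open>?K \<noteq> inc v\<close> Ki by blast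
      then show ?thesis using CE by blast
    qed
    show False
    proof (rule line_graph_separation[OF simple con_L, of ?C ?B ?K])
      show "?C \<union> ?B \<union> ?K = uedges G" using CE Ki by blast
      show "?C \<inter> ?K = {}" using CE Ki by blast
      show "?C \<noteq> {}" using gC by blast
      fix a b x assume ab: "a \<in> ?C" "b \<in> ?B" "x \<in> a" "x \<in> b"
      show False
      proof (cases "b \<in> inc v")
        case True then show False using ab unfolding attached_def by blast
      next
        case False
        then have "b \<in> ?C" using outer_component_closed[OF g ab(1) _ ab(3,4)] ab(2) by blast
        then show False using ab(2) by blast
      qed
    qed (use lt \<open>?B \<noteq> {}\<close> in auto)
  qed
  ultimately show ?thesis by linarith
qed

lemma graph_isoI:
  assumes "bij_betw f (uverts X) (uverts Y)" "uedges Y = (\<lambda>e. f ` e) ` uedges X"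
  shows "graph_iso X Y"
  using assms unfolding graph_iso_def by blast

text \<open>By \<open>no_isolated\<close> every vertex is an end of an edge, so the graph is exactly
  the star \<open>K\<^sub>1\<^sub>,\<^sub>4\<close>, without further vertices.\<close>

lemma star_exceptional:
  assumes v: "vdegree G v = 4" and all: "uedges G = inc v"
  shows False
proof -
  obtain k1 k2 k3 k4 where k: "distinct [k1, k2, k3, k4]" "{k1, k2, k3, k4} \<subseteq> inc v"
    by (rule four_elements[of "inc v"]) (use v in \<open>simp add: vdegree_def\<close>)
  have "inc v = {k1, k2, k3, k4}"
    using k v card_subset_eq[OF fin_inc k(2)] unfolding vdegree_def by simp
  then have E: "uedges G = {k1, k2, k3, k4}" using all by simp
  have "\<exists>w. k = {v, w} \<and> w \<noteq> v" if "k \<in> inc v" for k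
    using simple_graph_edgeE[OF simple, of k] that by (metis (no_types, lifting) CollectD doubleton_eq_iff insertE singletonD)
  then obtain w where w: "\<And>k. k \<in> inc v \<Longrightarrow> k = {v, w k} \<and> w k \<noteq> v" by metis
  define a b c d where "a = w k1" and "b = w k2" and "c = w k3" and "d = w k4"
  have ks: "k1 = {v, a}" "k2 = {v, b}" "k3 = {v, c}" "k4 = {v, d}" "v \<notin> {a, b, c, d}"
    using w k(2) unfolding a_def b_def c_def d_def by blast+
  have dist: "distinct [v, a, b, c, d]" using k(1) ks by auto
  have V: "uverts G = {v, a, b, c, d}"
  proof (intro equalityI subsetI)
    fix x assume "x \<in> uverts G"
    then have "inc x \<noteq> {}" using no_isolated[of x] unfolding vdegree_def by (metis card.empty)
    then show "x \<in> {v, a, b, c, d}" using E ks by auto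
  next
    fix x assume "x \<in> {v, a, b, c, d}"
    then obtain k where "k \<in> uedges G" "x \<in> k" unfolding E ks by blast
    then show "x \<in> uverts G" by (rule edge_verts)
  qed
  define f where "f = (\<lambda>x. if x = v then 0 else if x = a then 1 else if x = b then 2 else if x = c then 3 else (4::nat))"
  have fv: "f v = 0" "f a = 1" "f b = 2" "f c = 3" "f d = 4" unfolding f_def using dist by auto
  have "graph_iso G (complete_bipartite 1 4)"
  proof (rule graph_isoI[of f])
    show "bij_betw f (uverts G) (uverts (complete_bipartite 1 4))"
      unfolding bij_betw_def V complete_bipartite_def using fv by (auto simp: inj_on_def)
    have "uedges (complete_bipartite 1 4) = {{0, 1}, {0, 2}, {0, 3}, {0, 4}}"
    proof -
      have "1 \<le> j \<and> j < 1 + 4 \<longleftrightarrow> j \<in> {1, 2, 3, 4}" for j :: nat by auto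
      then show ?thesis unfolding complete_bipartite_def by auto
    qed
    then show "uedges (complete_bipartite 1 4) = (\<lambda>e. f ` e) ` uedges G" unfolding E ks using fv by simp
  qed
  then show False using not_exceptional unfolding exceptional_def by blast
qed

text \<open>Two components are attached to three of the four edges at \<open>v\<close> each, hence
  to a common one, and they meet at its far end. So there is only one component. The edge that is
  not attached to it has nothing else at its far end, while each of the three attached edges
  has.\<close>

lemma degree_4_unique_leaf:
  assumes v: "vdegree G v = 4"
  shows "\<exists>!w. {v, w} \<in> uedges G \<and> vdegree G w = 1"
proof -
  have "\<not> uedges G \<subseteq> inc v" using star_exceptional[OF v] by blast
  then obtain g where g: "g \<in> uedges G - inc v" by blast
  let ?C = "outer_component v g" and ?K = "attached (outer_component v g) v"
  have cK: "card ?K = 3" by (rule card_attached[OF v g])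
  have CE: "?C \<subseteq> uedges G - inc v" using outer_component_edges[OF g] by blast
  have Ki: "?K \<subseteq> inc v" unfolding attached_def by blast
  have ci: "card (inc v) = 4" using v unfolding vdegree_def .
  have "card (inc v - ?K) = 1" using card_Diff_subset[OF finite_subset[OF Ki fin_inc] Ki] ci cK by simp
  then obtain k where k: "inc v - ?K = {k}" by (auto simp: card_1_singleton_iff)
  then have kv: "k \<in> uedges G" "v \<in> k" "k \<notin> ?K" by auto
  obtain w where w: "k = {v, w}" "v \<noteq> w"
    using simple_graph_edgeE[OF simple kv(1)] kv(2) by (metis doubleton_eq_iff insertE singletonD)
  have "inc w = {k}"
  proof (rule ccontr)
    assume "inc w \<noteq> {k}"
    then obtain g' where g': "g' \<in> uedges G" "w \<in> g'" "g' \<noteq> k" using kv w(1) by blast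
    have "v \<notin> g'" using edge_unique[OF simple g'(1) kv(1), of v w] g' w kv(2) by blast
    then have g'': "g' \<in> uedges G - inc v" using g' by blast
    let ?K' = "attached (outer_component v g') v"
    have "card ?K' = 3" by (rule card_attached[OF v g''])
    have K'i: "?K' \<subseteq> inc v" unfolding attached_def by blast
    have "?K \<inter> ?K' \<noteq> {}"
    proof
      assume "?K \<inter> ?K' = {}"
      then have "card (?K \<union> ?K') = 6" using cK \<open>card ?K' = 3\<close> finite_subset[OF Ki fin_inc] finite_subset[OF K'i fin_inc]
        by (simp add: card_Un_disjoint)
      moreover have "card (?K \<union> ?K') \<le> 4" using card_mono[OF fin_inc, of "?K \<union> ?K'" v] Ki K'i ci by simp
      ultimately show False by simp
    qed
    then obtain k' x y where k': "k' \<in> inc v" "x \<in> ?C" "x \<inter> k' \<noteq> {}" "y \<in> outer_component v g'" "y \<inter> k' \<noteq> {}"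
      unfolding attached_def by blast
    have xy: "x \<in> uedges G - inc v" "y \<in> uedges G - inc v" using CE k'(2) outer_component_edges[OF g'' k'(4)] by auto
    obtain w' where w': "k' = {v, w'}"
      using simple_graph_edgeE[OF simple, of k'] k'(1) by (metis (no_types, lifting) CollectD doubleton_eq_iff insertE singletonD)
    have "w' \<in> x" "w' \<in> y" using xy k' w' by auto
    then have "y \<in> ?C" using outer_component_closed[OF g k'(2) xy(2)] by blast
    then have "g' \<in> ?C" using outer_component_trans outer_component_sym[OF k'(4)] by blast
    then have "k \<in> ?K" unfolding attached_def using kv g' w by blast
    then show False using kv by simp
  qed
  then have dw: "vdegree G w = 1" unfolding vdegree_def by simp
  show ?thesis
  proof (rule ex1I[of _ w])
    show "{v, w} \<in> uedges G \<and> vdegree G w = 1" using dw kv w by simp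
    fix u assume u: "{v, u} \<in> uedges G \<and> vdegree G u = 1"
    show "u = w"
    proof (rule ccontr)
      assume "u \<noteq> w"
      then have "{v, u} \<noteq> k" using w by (auto simp: doubleton_eq_iff)
      moreover have "{v, u} \<in> inc v" using u by simp
      ultimately have "{v, u} \<notin> inc v - ?K" unfolding k by simp
      then have "{v, u} \<in> ?K" using u by simp
      then obtain f where f: "f \<in> ?C" "f \<inter> {v, u} \<noteq> {}" unfolding attached_def by auto
      have "f \<in> uedges G" "v \<notin> f" using CE f(1) by auto
      then have "f \<in> inc u" "{v, u} \<in> inc u" "f \<noteq> {v, u}" using f(2) u by auto
      moreover have "\<exists>h. inc u = {h}" using u unfolding vdegree_def by (simp add: card_1_singleton_iff)
      ultimately show False by (metis singletonD)
    qed
  qed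
qed

end

subsection \<open>The underlying cubic graph\<close>

context polyhedral_line_graph
begin

definition leaves :: "'a set" where
  "leaves = {w \<in> uverts G. vdegree G w = 1}"

abbreviation core :: "'a ugraph" where
  "core \<equiv> delete_verts G leaves"

lemma simple_core: "simple_graph core"
  using simple by (rule simple_delete_verts)

lemma core_edges: "uedges core = {e \<in> uedges G. e \<inter> leaves = {}}"
  and core_verts: "uverts core = uverts G - leaves"
  unfolding delete_verts_def by simp_all

lemma edge_at:
  assumes "e \<in> inc v"
  obtains w where "e = {v, w}" "v \<noteq> w" "w \<in> uverts G"
proof -
  obtain a b where "e = {a, b}" "a \<noteq> b" "a \<in> uverts G" "b \<in> uverts G" by (rule simple_graph_edgeE[OF simple, of e]) (use assms in auto)
  then show ?thesis using that[of a] that[of b] assms by (auto simp: insert_commute)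
qed

lemma degree_of_leaf_neighbour:
  assumes "{u, w} \<in> uedges G" "w \<in> leaves"
  shows "vdegree G u = 4"
proof -
  have "u \<noteq> w" using simple assms(1) unfolding simple_graph_def by auto
  then show ?thesis using degree_sum[OF assms(1)] degree_le_4[of u] assms(2) unfolding leaves_def by simp
qed

lemma unique_leaf: "{v, w} \<in> uedges G \<Longrightarrow> w \<in> leaves \<Longrightarrow> {v, w'} \<in> uedges G \<Longrightarrow> w' \<in> leaves \<Longrightarrow> w = w'"
  using degree_4_unique_leaf[OF degree_of_leaf_neighbour] unfolding leaves_def by blast

lemma core_inc:
  assumes v: "v \<in> uverts core"
  shows "{e \<in> uedges core. v \<in> e} = inc v - {{v, w} | w. w \<in> leaves}"
proof (intro equalityI subsetI)
  fix e assume "e \<in> inc v - {{v, w} | w. w \<in> leaves}"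
  then have e: "e \<in> inc v" "e \<notin> {{v, w} | w. w \<in> leaves}" by auto
  obtain w where "e = {v, w}" by (rule edge_at[OF e(1)])
  then show "e \<in> {e \<in> uedges core. v \<in> e}" using e v unfolding core_edges core_verts by auto
qed (auto simp: core_edges)

text \<open>A vertex of degree 4 loses exactly its one leaf, and no vertex of smaller degree has a
  leaf as neighbour.\<close>

lemma core_degree:
  assumes v: "v \<in> uverts core"
  shows "vdegree core v = (if vdegree G v = 4 then 3 else vdegree G v)" "vdegree G v \<in> {2, 3, 4}"
proof -
  show "vdegree core v = (if vdegree G v = 4 then 3 else vdegree G v)"
  proof (cases "vdegree G v = 4")
    case True
    from degree_4_unique_leaf[OF True] obtain w where w: "{v, w} \<in> uedges G" "vdegree G w = 1" by blast
    then have wl: "w \<in> leaves" unfolding leaves_def using edge_verts[OF w(1), of w] by simp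
    have "{e \<in> uedges core. v \<in> e} = inc v - {{v, w}}"
      unfolding core_inc[OF v] using wl w(1) unique_leaf[OF w(1) wl] by blast
    then show ?thesis using True w(1) fin_inc unfolding vdegree_def by (simp add: card_Diff_singleton)
  next
    case False
    then have "{e \<in> uedges core. v \<in> e} = inc v"
      unfolding core_inc[OF v] using degree_of_leaf_neighbour[of v] by blast
    then show ?thesis using False unfolding vdegree_def by simp
  qed
  have "v \<in> uverts G" "v \<notin> leaves" using v unfolding core_verts by auto
  then have "vdegree G v \<noteq> 0" "vdegree G v \<noteq> 1" using no_isolated[of v] unfolding leaves_def by auto
  then show "vdegree G v \<in> {2, 3, 4}" using degree_le_4[of v] by auto
qed

text \<open>The witnesses are the vertices of degree 4 with their unique leaves. Besides undoing the
  second operation, this exposes \<open>G\<close> as exceptional when its core is the diamond or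
  \<open>K\<^sub>2\<^sub>,\<^sub>3\<close>.\<close>

lemma adds_pendants_core: "adds_pendants_at_degree_3 core G"
proof -
  define U where "U = {v \<in> uverts G. vdegree G v = 4}"
  define l where "l v = (THE w. {v, w} \<in> uedges G \<and> vdegree G w = 1)" for v
  have l: "{v, l v} \<in> uedges G \<and> vdegree G (l v) = 1" if "v \<in> U" for v
    unfolding l_def by (rule theI'[OF degree_4_unique_leaf]) (use that in \<open>simp add: U_def\<close>)
  have ll: "l v \<in> leaves" if "v \<in> U" for v using l[OF that] edge_verts[of "{v, l v}" "l v"] unfolding leaves_def by simp
  have l_eq: "w = l v \<and> v \<in> U" if vw: "{v, w} \<in> uedges G" "w \<in> leaves" for v w
  proof -
    have "v \<in> U" unfolding U_def using degree_of_leaf_neighbour[OF vw] edge_verts[OF vw(1), of v] by simp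
    then show ?thesis using unique_leaf[OF vw] l ll by blast
  qed
  have nl: "v \<notin> leaves" if "v \<in> U" for v using that unfolding U_def leaves_def by simp
  have inj: "inj_on l U"
  proof (rule inj_onI)
    fix u v assume uv: "u \<in> U" "v \<in> U" "l u = l v"
    have "card (inc (l u)) = 1" using l[OF uv(1)] unfolding vdegree_def by simp
    then obtain e where "inc (l u) = {e}" by (auto simp: card_1_singleton_iff)
    moreover have "{u, l u} \<in> inc (l u)" "{v, l u} \<in> inc (l u)" using l[OF uv(1)] l[OF uv(2)] uv(3) by auto
    ultimately have "{u, l u} = {v, l u}" by (metis singletonD)
    then show "u = v" by (auto simp: doubleton_eq_iff)
  qed
  have V: "uverts G = uverts core \<union> l ` U"
  proof (intro equalityI subsetI)
    fix w assume w: "w \<in> uverts G"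
    show "w \<in> uverts core \<union> l ` U"
    proof (cases "w \<in> leaves")
      case True
      then have "inc w \<noteq> {}" using no_isolated[OF w] unfolding vdegree_def by (metis card.empty)
      then obtain e where e: "e \<in> inc w" by blast
      obtain v where "e = {w, v}" by (rule edge_at[OF e])
      then have "{v, w} \<in> uedges G" using e by (simp add: insert_commute)
      then show ?thesis using l_eq True by blast
    qed (use w in \<open>simp add: core_verts\<close>)
  qed (use l edge_verts in \<open>auto simp: core_verts\<close>)
  have E: "uedges G = uedges core \<union> {{u, l u} | u. u \<in> U}"
  proof (intro equalityI subsetI)
    fix e assume e: "e \<in> uedges G"
    show "e \<in> uedges core \<union> {{u, l u} | u. u \<in> U}"
    proof (cases "e \<inter> leaves = {}")
      case False
      then obtain w where w: "w \<in> leaves" "e \<in> inc w" using e by blast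
      obtain v where v: "e = {w, v}" by (rule edge_at[OF w(2)])
      then have "w = l v \<and> v \<in> U" using l_eq[of v w] w e by (simp add: insert_commute)
      then show ?thesis using v by blast
    qed (use e in \<open>simp add: core_edges\<close>)
  qed (use l in \<open>auto simp: core_edges\<close>)
  show ?thesis
    unfolding adds_pendants_at_degree_3_def
  proof (intro exI[of _ U] exI[of _ l] conjI inj)
    show "U \<subseteq> {u \<in> uverts core. vdegree core u = 3}"
    proof
      fix u assume u: "u \<in> U"
      then have "u \<in> uverts core" using nl unfolding U_def core_verts by blast
      then show "u \<in> {u \<in> uverts core. vdegree core u = 3}" using core_degree(1) u unfolding U_def by simp
    qed
    show "l ` U \<inter> uverts core = {}" using ll unfolding core_verts by blast
    show "G = \<lparr>uverts = uverts core \<union> l ` U, uedges = uedges core \<union> {{u, l u} | u. u \<in> U}\<rparr>"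
      using V E by simp
  qed
qed

lemma core_covered:
  assumes "v \<in> uverts core" "e \<in> uedges core" "v \<in> e"
  shows "\<exists>f\<in>uedges core. v \<in> f \<and> f \<noteq> e"
proof (rule ccontr)
  assume "\<not> ?thesis"
  then have "{f \<in> uedges core. v \<in> f} \<subseteq> {e}" by blast
  then have "vdegree core v \<le> 1" unfolding vdegree_def using card_mono[of "{e}"] by force
  then show False using core_degree[OF assms(1)] by (auto split: if_splits)
qed

lemma core_verts_eq: "uverts core = \<Union>(uedges core)"
proof (intro equalityI subsetI)
  fix v assume v: "v \<in> uverts core"
  then have "vdegree core v \<noteq> 0" using core_degree[OF v] by (auto split: if_splits)
  then have "{f \<in> uedges core. v \<in> f} \<noteq> {}" unfolding vdegree_def by (metis card.empty)
  then show "v \<in> \<Union>(uedges core)" by blast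
qed (use simple_core in \<open>auto simp: simple_graph_def\<close>)

section \<open>Cores that would make the graph exceptional\<close>

lemma core_not_diamond:
  assumes d: "distinct [u, v, a, b]" and E: "uedges core = {{u, v}, {u, a}, {u, b}, {v, a}, {v, b}}"
  shows False
proof -
  have V: "uverts core = {u, v, a, b}" unfolding core_verts_eq E by auto
  define f where "f = (\<lambda>x. if x = u then 0 else if x = v then 1 else if x = a then 2 else (3::nat))"
  have f: "f u = 0" "f v = 1" "f a = 2" "f b = 3" unfolding f_def using d by auto
  have "graph_iso core diamond"
  proof (rule graph_isoI[of f])
    show "bij_betw f (uverts core) (uverts diamond)"
      unfolding bij_betw_def V diamond_def using f by (auto simp: inj_on_def)
    show "uedges diamond = (\<lambda>e. f ` e) ` uedges core" unfolding E diamond_def using f by simp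
  qed
  then show False using not_exceptional adds_pendants_core simple_core unfolding exceptional_def by blast
qed

lemma core_not_K23:
  assumes d: "distinct [u, v, a, b, c]" and E: "uedges core = {{u, a}, {u, b}, {u, c}, {v, a}, {v, b}, {v, c}}"
  shows False
proof -
  have V: "uverts core = {u, v, a, b, c}" unfolding core_verts_eq E by auto
  define f where "f = (\<lambda>x. if x = u then 0 else if x = v then 1 else if x = a then 2 else if x = b then 3 else (4::nat))"
  have f: "f u = 0" "f v = 1" "f a = 2" "f b = 3" "f c = 4" unfolding f_def using d by auto
  have "graph_iso core (complete_bipartite 2 3)"
  proof (rule graph_isoI[of f])
    show "bij_betw f (uverts core) (uverts (complete_bipartite 2 3))"
      unfolding bij_betw_def V complete_bipartite_def using f by (auto simp: inj_on_def)
    have ij: "i < 2 \<longleftrightarrow> i \<in> {0, 1}" "2 \<le> i \<and> i < 2 + 3 \<longleftrightarrow> i \<in> {2, 3, 4}" for i :: nat by auto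
    have "uedges (complete_bipartite 2 3) = {{0, 2}, {0, 3}, {0, 4}, {1, 2}, {1, 3}, {1, 4}}"
    proof -
      have "uedges (complete_bipartite 2 3) = {{i, j} | i j. i \<in> {0, 1} \<and> j \<in> {2, 3, 4}}"
        unfolding complete_bipartite_def ij by simp
      also have "\<dots> = (\<Union>i\<in>{0, 1}. (\<lambda>j. {i, j}) ` {2, 3, 4})" by blast
      finally show ?thesis by (simp add: insert_commute)
    qed
    then show "uedges (complete_bipartite 2 3) = (\<lambda>e. f ` e) ` uedges core" unfolding E using f by simp
  qed
  then show False using not_exceptional adds_pendants_core simple_core unfolding exceptional_def by blast
qed

text \<open>Two links between \<open>u\<close> and \<open>v\<close> leave a single further edge at each end, and deleting these two
  edges cannot separate anything from the links.\<close>

lemma two_links: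
  assumes uv: "u \<in> uverts core" "v \<in> uverts core" "vdegree core u = 3" "vdegree core v = 3"
    and M: "M \<subseteq> uedges core" "M \<noteq> {}"
    and Mu: "card {e \<in> M. u \<in> e} = 2" and Mv: "card {e \<in> M. v \<in> e} = 2"
    and closed: "\<And>f x. f \<in> M \<Longrightarrow> x \<in> f \<Longrightarrow> x \<noteq> u \<Longrightarrow> x \<noteq> v \<Longrightarrow> inc x \<subseteq> M"
  obtains eu ev where "{e \<in> uedges core. u \<in> e} - M = {eu}" "{e \<in> uedges core. v \<in> e} - M = {ev}"
    "uedges core = M \<union> {eu, ev}"
proof -
  have ex: "\<exists>e. {e \<in> uedges core. w \<in> e} - M = {e}" if w: "vdegree core w = 3" "card {e \<in> M. w \<in> e} = 2" for w
  proof -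
    have sub: "{e \<in> M. w \<in> e} \<subseteq> {e \<in> uedges core. w \<in> e}" using M(1) by blast
    have fin: "finite {e \<in> uedges core. w \<in> e}" by (rule finite_inc[OF simple_core])
    have "card ({e \<in> uedges core. w \<in> e} - {e \<in> M. w \<in> e}) = 1"
      using card_Diff_subset[OF finite_subset[OF sub fin] sub] w unfolding vdegree_def by simp
    moreover have "{e \<in> uedges core. w \<in> e} - {e \<in> M. w \<in> e} = {e \<in> uedges core. w \<in> e} - M" by blast
    ultimately show ?thesis by (metis card_1_singletonE)
  qed
  obtain eu where eu: "{e \<in> uedges core. u \<in> e} - M = {eu}" using ex[OF uv(3) Mu] by blast
  obtain ev where ev: "{e \<in> uedges core. v \<in> e} - M = {ev}" using ex[OF uv(4) Mv] by blast
  \<comment> \<open>The pendant edges at \<open>u\<close> and \<open>v\<close> are outside the core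
    and have to go to the side of \<open>M\<close>.\<close>
  let ?P = "{e \<in> inc u \<union> inc v. e \<notin> uedges core}"
  let ?A = "(M \<union> ?P) - {eu, ev}"
  let ?B = "uedges G - ?A - {eu, ev}"
  have MG: "M \<subseteq> uedges G" using M(1) unfolding core_edges by blast
  have euM: "eu \<notin> M" "ev \<notin> M" "eu \<in> uedges core" "ev \<in> uedges core" using eu ev by blast+
  have "?B = {}"
  proof (rule ccontr)
    assume B: "?B \<noteq> {}"
    have at_uv: "e \<in> ?A \<union> {eu, ev}" if e: "e \<in> inc u \<union> inc v" for e
    proof (cases "e \<in> uedges core \<and> e \<notin> M")
      case True
      then show ?thesis using e eu ev by blast
    next
      case False then show ?thesis using e by blast
    qed
    show False
    proof (rule line_graph_separation[OF simple con_L, of ?A ?B "{eu, ev}"])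
      show "?A \<union> ?B \<union> {eu, ev} = uedges G" using MG euM unfolding core_edges by blast
      show "?A \<noteq> {}" using M(2) euM by blast
      show "card {eu, ev} < 3" by (simp add: card_insert_if)
      fix a b x assume ab: "a \<in> ?A" "b \<in> ?B" "x \<in> a" "x \<in> b"
      have bx: "b \<in> inc x" using ab by blast
      show False
      proof (cases "x = u \<or> x = v")
        case True
        then show False using at_uv[of b] bx ab(2) by blast
      next
        case False
        have "b \<notin> M" using ab(2) euM by blast
        then have "a \<notin> M" using closed[of a x] ab(3) False bx by blast
        then have a: "a \<in> ?P" using ab(1) by blast
        then obtain y where y: "y \<in> {u, v}" "a \<in> inc y" by blast
        obtain w where w: "a = {y, w}" by (rule edge_at[OF y(2)])
        have "y \<notin> leaves" using y uv unfolding core_verts by blast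
        then have wl: "w \<in> leaves" using a w unfolding core_edges by blast
        have "x = w" using ab(3) w y False by blast
        then have "card (inc x) = 1" using wl unfolding leaves_def vdegree_def by simp
        then obtain e where "inc x = {e}" by (rule card_1_singletonE)
        then have "a = b" using bx y(2) ab(3) by (metis (no_types, lifting) CollectD CollectI singletonD)
        then show False using ab by blast
      qed
    qed (use B in auto)
  qed
  then have "uedges G \<subseteq> M \<union> ?P \<union> {eu, ev}" by blast
  then have "uedges core = M \<union> {eu, ev}" using M(1) euM unfolding core_edges by blast
  then show ?thesis using that eu ev by blast
qed

section \<open>Suppressing the vertices of degree 2\<close>

definition mids :: "'a set" where
  "mids = {v \<in> uverts G. vdegree G v = 2}"

definition hubs :: "'a set" where
  "hubs = {v \<in> uverts G. 3 \<le> vdegree G v}"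

text \<open>For a vertex \<open>a\<close> of degree 2 this is a pair, and it serves as the edge of
  the suppressed graph that \<open>a\<close> subdivides.\<close>

definition nbrs :: "'a \<Rightarrow> 'a set" where
  "nbrs v = {w. {v, w} \<in> uedges G}"

lemma hubs_core: "hubs \<subseteq> uverts core" and mids_core: "mids \<subseteq> uverts core"
  unfolding core_verts unfolding hubs_def mids_def leaves_def by auto

lemma hub_degree: "v \<in> hubs \<Longrightarrow> vdegree core v = 3"
  using core_degree[of v] hubs_core unfolding hubs_def by auto

lemma core_verts_split: "uverts core = hubs \<union> mids" and hubs_mids: "hubs \<inter> mids = {}"
proof -
  have "v \<in> hubs \<or> v \<in> mids" if v: "v \<in> uverts core" for v
  proof -
    have "v \<in> uverts G" using v unfolding core_verts by simp
    then show ?thesis using core_degree(2)[OF v] unfolding hubs_def mids_def by auto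
  qed
  then show "uverts core = hubs \<union> mids" using hubs_core mids_core by blast
  show "hubs \<inter> mids = {}" unfolding hubs_def mids_def by auto
qed

text \<open>By \<open>degree_sum\<close> the neighbours of a vertex of degree 2 have degree at least
  3. This is why no edge is subdivided more than once.\<close>

lemma midE:
  assumes a: "a \<in> mids"
  obtains x y where "x \<noteq> y" "a \<noteq> x" "a \<noteq> y" "nbrs a = {x, y}" "inc a = {{x, a}, {y, a}}" "x \<in> hubs" "y \<in> hubs"
proof -
  have "card (inc a) = 2" using a unfolding mids_def vdegree_def by simp
  then obtain e f where ef: "inc a = {e, f}" "e \<noteq> f" by (auto simp: card_2_iff)
  obtain x where x: "e = {a, x}" "a \<noteq> x" "x \<in> uverts G" by (rule edge_at[of e a]) (use ef in auto)
  obtain y where y: "f = {a, y}" "a \<noteq> y" "y \<in> uverts G" by (rule edge_at[of f a]) (use ef in auto)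
  have E: "{a, x} \<in> uedges G" "{a, y} \<in> uedges G" using ef x y by blast+
  have "3 \<le> vdegree G x" "3 \<le> vdegree G y" using degree_sum[OF E(1) x(2)] degree_sum[OF E(2) y(2)] a unfolding mids_def by auto
  moreover have "nbrs a = {x, y}"
  proof (intro equalityI subsetI)
    fix w assume "w \<in> nbrs a"
    then have "{a, w} \<in> {e, f}" unfolding nbrs_def ef(1)[symmetric] by simp
    then show "w \<in> {x, y}" unfolding x y by (auto simp: doubleton_eq_iff)
  qed (use E in \<open>auto simp: nbrs_def\<close>)
  ultimately show ?thesis using that[of x y] x y ef by (simp add: hubs_def insert_commute) blast
qed

lemma mid_edges_core:
  assumes a: "a \<in> mids"
  shows "inc a \<subseteq> uedges core"
proof -
  obtain x y where "inc a = {{x, a}, {y, a}}" "x \<in> hubs" "y \<in> hubs" by (rule midE[OF a])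
  moreover from this have "{x, a} \<in> uedges G" "{y, a} \<in> uedges G" by blast+
  moreover have "x \<notin> leaves" "y \<notin> leaves" "a \<notin> leaves"
    using hubs_core mids_core a calculation(2,3) unfolding core_verts by auto
  ultimately show ?thesis unfolding core_edges by simp
qed

text \<open>Every vertex of the core lies on at least two of its edges, so \<open>x\<close>, which
  \<open>M\<close> misses, needs \<open>ev\<close> besides \<open>eu\<close>.\<close>

lemma third_vertex:
  assumes u: "u \<in> uverts core" and eu: "eu \<in> uedges core" "u \<in> eu"
    and E: "uedges core = M \<union> {eu, ev}" and x: "x \<in> eu" "x \<noteq> u" "\<And>f. f \<in> M \<Longrightarrow> x \<notin> f"
  shows "x \<in> ev \<and> ev \<noteq> eu"
proof -
  have "x \<in> uverts core" using simple_core eu(1) x(1) unfolding simple_graph_def by blast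
  from core_covered[OF this eu(1) x(1)] obtain f where "f \<in> uedges core" "x \<in> f" "f \<noteq> eu" by blast
  then show ?thesis using E x(3) by blast
qed

text \<open>Two such vertices would become parallel edges. By \<open>two_links\<close> only the
  third edges at \<open>u\<close> and \<open>v\<close> are left: if they coincide the core is the
  diamond, and otherwise they meet in a vertex \<open>x\<close> and the core is
  \<open>K\<^sub>2\<^sub>,\<^sub>3\<close>.\<close>

lemma nbrs_inj:
  assumes ab: "a \<in> mids" "b \<in> mids" "nbrs a = nbrs b"
  shows "a = b"
proof (rule ccontr)
  assume ne: "a \<noteq> b"
  obtain u v where a: "u \<noteq> v" "a \<noteq> u" "a \<noteq> v" "nbrs a = {u, v}" "inc a = {{u, a}, {v, a}}" "u \<in> hubs" "v \<in> hubs"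
    by (rule midE[OF ab(1)])
  obtain u' v' where b': "b \<noteq> u'" "b \<noteq> v'" "nbrs b = {u', v'}" "inc b = {{u', b}, {v', b}}"
    by (rule midE[OF ab(2)])
  have uv': "u' = u \<and> v' = v \<or> u' = v \<and> v' = u" using a(4) b'(3) ab(3) by (auto simp: doubleton_eq_iff)
  then have b: "b \<noteq> u" "b \<noteq> v" "inc b = {{u, b}, {v, b}}" using b' by auto
  let ?M = "{{u, a}, {v, a}, {u, b}, {v, b}}"
  have M: "?M \<subseteq> uedges core" using mid_edges_core[OF ab(1)] mid_edges_core[OF ab(2)] a(5) b(3) by simp
  have Mu: "{e \<in> ?M. u \<in> e} = {{u, a}, {u, b}}" and Mv: "{e \<in> ?M. v \<in> e} = {{v, a}, {v, b}}" using a b by auto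
  have hub: "u \<in> uverts core" "v \<in> uverts core" "vdegree core u = 3" "vdegree core v = 3"
    using a hubs_core hub_degree by auto
  obtain eu ev where e: "{e \<in> uedges core. u \<in> e} - ?M = {eu}" "{e \<in> uedges core. v \<in> e} - ?M = {ev}"
    "uedges core = ?M \<union> {eu, ev}"
  proof (rule two_links[of u v ?M])
    show "card {e \<in> ?M. u \<in> e} = 2" "card {e \<in> ?M. v \<in> e} = 2" unfolding Mu Mv using ne by (auto simp: card_2_iff doubleton_eq_iff)
    fix f x assume "f \<in> ?M" "x \<in> f" "x \<noteq> u" "x \<noteq> v"
    then have "x = a \<or> x = b" by auto
    then show "inc x \<subseteq> ?M"
    proof
      assume x: "x = a" show ?thesis unfolding x a(5) by simp
    next
      assume x: "x = b" show ?thesis unfolding x b(3) by simp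
    qed
  qed (use hub M in simp_all)
  have eu: "eu \<in> uedges core" "u \<in> eu" "eu \<notin> ?M" and ev: "ev \<in> uedges core" "v \<in> ev" "ev \<notin> ?M" using e(1,2) by blast+
  obtain x where x: "eu = {u, x}" "u \<noteq> x" by (rule edge_at[of eu u]) (use eu in \<open>auto simp: core_edges\<close>)
  show False
  proof (cases "x = v")
    case True
    then have "v \<in> eu" using x by simp
    with eu(1,3) have "eu \<in> {e \<in> uedges core. v \<in> e} - ?M" by (intro DiffI CollectI conjI)
    then have "ev = eu" unfolding e(2) by simp
    then have "uedges core = {{u, v}, {u, a}, {u, b}, {v, a}, {v, b}}" using e(3) x True by (simp add: insert_commute)
    then show False using core_not_diamond[of u v a b] a b ne by auto
  next
    case False
    have xM: "x \<noteq> a" "x \<noteq> b" using eu(3) x by auto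
    have "x \<in> ev \<and> ev \<noteq> eu"
      by (rule third_vertex[OF hub(1) eu(1,2) e(3)]) (use x xM False in auto)
    obtain w where w: "ev = {v, w}" by (rule edge_at[of ev v]) (use ev in \<open>auto simp: core_edges\<close>)
    then have "ev = {v, x}" using \<open>x \<in> ev \<and> ev \<noteq> eu\<close> False by auto
    then have "uedges core = {{u, a}, {u, b}, {u, x}, {v, a}, {v, b}, {v, x}}" using e(3) x by (simp add: insert_commute)
    then show False using core_not_K23[of u v a b x] a b ne x xM False by auto
  qed
qed

text \<open>Here the parallel links are the path through \<open>a\<close> and the edge between its
  neighbours. The third edges at \<open>u\<close> and \<open>v\<close> have to meet in a vertex
  \<open>x\<close>, and the core is a diamond with \<open>a\<close> and \<open>x\<close> as its
  vertices of degree 2.\<close>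

lemma nbrs_not_edge:
  assumes a: "a \<in> mids"
  shows "nbrs a \<notin> uedges G"
proof
  assume "nbrs a \<in> uedges G"
  obtain u v where a': "u \<noteq> v" "a \<noteq> u" "a \<noteq> v" "nbrs a = {u, v}" "inc a = {{u, a}, {v, a}}" "u \<in> hubs" "v \<in> hubs"
    by (rule midE[OF a])
  have uvE: "{u, v} \<in> uedges core"
    using \<open>nbrs a \<in> uedges G\<close> a' hubs_core unfolding core_edges core_verts by auto
  let ?M = "{{u, a}, {v, a}, {u, v}}"
  have M: "?M \<subseteq> uedges core" using mid_edges_core[OF a] a'(5) uvE by simp
  have Mu: "{e \<in> ?M. u \<in> e} = {{u, a}, {u, v}}" and Mv: "{e \<in> ?M. v \<in> e} = {{v, a}, {u, v}}" using a' by auto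
  have hub: "u \<in> uverts core" "v \<in> uverts core" "vdegree core u = 3" "vdegree core v = 3"
    using a' hubs_core hub_degree by auto
  obtain eu ev where e: "{e \<in> uedges core. u \<in> e} - ?M = {eu}" "{e \<in> uedges core. v \<in> e} - ?M = {ev}"
    "uedges core = ?M \<union> {eu, ev}"
  proof (rule two_links[of u v ?M])
    show "card {e \<in> ?M. u \<in> e} = 2" "card {e \<in> ?M. v \<in> e} = 2" unfolding Mu Mv using a' by (auto simp: card_2_iff doubleton_eq_iff)
    fix f x assume "f \<in> ?M" "x \<in> f" "x \<noteq> u" "x \<noteq> v"
    then have "x = a" by auto
    then show "inc x \<subseteq> ?M" using a'(5) by simp
  qed (use hub M in simp_all)
  have eu: "eu \<in> uedges core" "u \<in> eu" "eu \<notin> ?M" and ev: "ev \<in> uedges core" "v \<in> ev" "ev \<notin> ?M" using e(1,2) by blast+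
  obtain x where x: "eu = {u, x}" "u \<noteq> x" by (rule edge_at[of eu u]) (use eu in \<open>auto simp: core_edges\<close>)
  have xM: "x \<noteq> a" "x \<noteq> v" using eu(3) x by auto
  have "x \<in> ev \<and> ev \<noteq> eu"
    by (rule third_vertex[OF hub(1) eu(1,2) e(3)]) (use x xM in auto)
  obtain w where w: "ev = {v, w}" by (rule edge_at[of ev v]) (use ev in \<open>auto simp: core_edges\<close>)
  then have "ev = {v, x}" using \<open>x \<in> ev \<and> ev \<noteq> eu\<close> xM by auto
  then have "uedges core = {{u, v}, {u, a}, {u, x}, {v, a}, {v, x}}" using e(3) x by (simp add: insert_commute)
  then show False using core_not_diamond[of u v a x] a' x xM by auto
qed

text \<open>A set of edges cannot record multiplicities; that the suppression loses nothing rests on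
  \<open>nbrs_inj\<close> and \<open>nbrs_not_edge\<close>.\<close>

definition base :: "'a ugraph" where
  "base = \<lparr>uverts = hubs, uedges = {e \<in> uedges G. e \<subseteq> hubs} \<union> nbrs ` mids\<rparr>"

lemma simple_base: "simple_graph base"
proof -
  have "finite hubs" using simple finite_subset[of hubs "uverts G"] unfolding simple_graph_def hubs_def by auto
  moreover have "nbrs a \<subseteq> hubs \<and> card (nbrs a) = 2" if a: "a \<in> mids" for a
  proof -
    obtain x y where "x \<noteq> y" "nbrs a = {x, y}" "x \<in> hubs" "y \<in> hubs" by (rule midE[OF a])
    then show ?thesis by simp
  qed
  moreover have "e \<subseteq> hubs \<and> card e = 2" if "e \<in> uedges G" "e \<subseteq> hubs" for e
    using simple that unfolding simple_graph_def by blast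
  ultimately show ?thesis unfolding simple_graph_def base_def by auto
qed

definition mid_of :: "'a set \<Rightarrow> 'a" where
  "mid_of = the_inv_into mids nbrs"

lemma inj_nbrs: "inj_on nbrs mids"
  using nbrs_inj by (intro inj_onI)

lemma mid_of_nbrs: "a \<in> mids \<Longrightarrow> mid_of (nbrs a) = a"
  unfolding mid_of_def by (rule the_inv_into_f_f[OF inj_nbrs])

lemma core_edges_eq:
  "uedges core = (uedges base - nbrs ` mids) \<union> {{x, mid_of e} | x e. e \<in> nbrs ` mids \<and> x \<in> e}"
proof -
  have 1: "uedges base - nbrs ` mids = {e \<in> uedges G. e \<subseteq> hubs}"
    unfolding base_def using nbrs_not_edge by auto
  have 2: "{{x, mid_of e} | x e. e \<in> nbrs ` mids \<and> x \<in> e} = {{x, a} | x a. a \<in> mids \<and> {x, a} \<in> uedges G}"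
  proof -
    have "{{x, mid_of e} | x e. e \<in> nbrs ` mids \<and> x \<in> e} = {{x, mid_of (nbrs a)} | x a. a \<in> mids \<and> x \<in> nbrs a}" by blast
    also have "\<dots> = {{x, a} | x a. a \<in> mids \<and> x \<in> nbrs a}"
      by (intro Collect_cong iff_exI) (auto simp: mid_of_nbrs)
    also have "\<dots> = {{x, a} | x a. a \<in> mids \<and> {x, a} \<in> uedges G}" unfolding nbrs_def by (simp add: insert_commute)
    finally show ?thesis .
  qed
  show ?thesis
    unfolding 1 2
  proof (intro equalityI subsetI)
    fix e assume e: "e \<in> uedges core"
    obtain x y where xy: "e = {x, y}" "x \<in> uverts core" "y \<in> uverts core" by (rule simple_graph_edgeE[OF simple_core e])
    have eG: "e \<in> uedges G" using e unfolding core_edges by blast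
    show "e \<in> {e \<in> uedges G. e \<subseteq> hubs} \<union> {{x, a} | x a. a \<in> mids \<and> {x, a} \<in> uedges G}"
    proof (cases "e \<subseteq> hubs")
      case False
      then have "x \<in> mids \<or> y \<in> mids" using xy core_verts_split by auto
      moreover have "e = {y, x}" using xy by auto
      ultimately have "\<exists>x a. e = {x, a} \<and> a \<in> mids" using xy(1) by blast
      then show ?thesis using eG by blast
    qed (use eG in simp)
  next
    fix e assume "e \<in> {e \<in> uedges G. e \<subseteq> hubs} \<union> {{x, a} | x a. a \<in> mids \<and> {x, a} \<in> uedges G}"
    then consider "e \<in> uedges G" "e \<subseteq> hubs" | x a where "a \<in> mids" "e = {x, a}" "e \<in> uedges G" by blast
    then show "e \<in> uedges core"
    proof cases
      case 1 then show ?thesis using hubs_core unfolding core_edges core_verts by blast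
    next
      case 2 then show ?thesis using mid_edges_core[OF 2(1)] by blast
    qed
  qed
qed

lemma decorated_base: "decorated_graph base (nbrs ` mids) mid_of {} l"
proof
  show "simple_graph base" by (rule simple_base)
  show "inj_on mid_of (nbrs ` mids)" unfolding mid_of_def by (rule inj_on_the_inv_into[OF inj_nbrs])
  show "mid_of ` nbrs ` mids \<inter> uverts base = {}" using mid_of_nbrs hubs_mids unfolding base_def by auto
qed (auto simp: base_def)

lemma subdivides_base: "subdivides_edges_at_most_once base core"
  unfolding subdivides_edges_at_most_once_def
proof (intro exI[of _ "nbrs ` mids"] exI[of _ mid_of] conjI)
  interpret decorated_graph base "nbrs ` mids" mid_of "{}" id by (rule decorated_base)
  show "nbrs ` mids \<subseteq> uedges base" "inj_on mid_of (nbrs ` mids)" "mid_of ` nbrs ` mids \<inter> uverts base = {}"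
    by (rule S inj_z fresh_z)+
  have "mid_of ` nbrs ` mids = mids" using mid_of_nbrs by (force simp: image_iff)
  then have "uverts core = uverts base \<union> mid_of ` nbrs ` mids" unfolding core_verts_split base_def by simp
  then show "core = \<lparr>uverts = uverts base \<union> mid_of ` nbrs ` mids,
      uedges = (uedges base - nbrs ` mids) \<union> {{x, mid_of e} | x e. e \<in> nbrs ` mids \<and> x \<in> e}\<rparr>"
    using core_edges_eq by simp
qed

text \<open>Subdividing edges does not change the degree of a hub, and in the core every hub has
  degree 3.\<close>

lemma cubic_base: "cubic base"
  unfolding cubic_def
proof
  interpret D: decorated_graph base "nbrs ` mids" mid_of "{}" id by (rule decorated_base)
  fix v assume v: "v \<in> uverts base"
  have "uedges D.decorated = uedges core"
    unfolding D.decorated_def core_edges_eq D.pieces_eq by simp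
  then have "vdegree core v = card (D.star v)" unfolding vdegree_def D.star_def by simp
  also have "\<dots> = vdegree base v" using D.card_star[OF v] by simp
  finally show "vdegree base v = 3" using hub_degree[of v] v unfolding base_def by simp
qed

lemma base_nonempty: "uverts base \<noteq> {}"
proof -
  obtain e where e: "e \<in> uedges G" using card_E by fastforce
  obtain u v where uv: "e = {u, v}" "u \<noteq> v" "u \<in> uverts G" "v \<in> uverts G" by (rule simple_graph_edgeE[OF simple e])
  have "5 \<le> vdegree G u + vdegree G v" using degree_sum e uv by blast
  then have "3 \<le> vdegree G u \<or> 3 \<le> vdegree G v" by linarith
  then show ?thesis using uv unfolding base_def hubs_def by auto
qed

text \<open>Connectivity has to come before planarity: the injective choice of edges needed for the
  drawing rests on the bound for cuts that 3-connectedness gives.\<close>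

lemma three_polytope_base: "three_polytope base"
proof -
  have "\<exists>S z U l. decorated_graph base S z U l \<and> G = decorated_graph.decorated base S z U l"
    using subdivides_then_pendants_iff[OF simple_base cubic_base] subdivides_base adds_pendants_core by blast
  then obtain S z U l where D: "decorated_graph base S z U l" and GD: "G = decorated_graph.decorated base S z U l" by blast
  interpret D: decorated_graph base S z U l by (rule D)
  have con: "k_connected 3 base"
    by (rule D.three_connected_of_line_graph_decorated[OF cubic_base base_nonempty]) (use con_L GD in simp)
  have cut: "3 \<le> card (edges_between base X Y)" if "X \<union> Y = uverts base" "X \<inter> Y = {}" "X \<noteq> {}" "Y \<noteq> {}" for X Y
    using con that unfolding cubic_3_connected_iff[OF simple_base cubic_base base_nonempty] by blast
  obtain v where v: "v \<in> uverts base" using base_nonempty by blast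
  then have "card {e \<in> uedges base. v \<in> e} = 3" using cubic_base unfolding cubic_def vdegree_def by blast
  then obtain e0 where e0: "e0 \<in> uedges base" "v \<in> e0" by (metis (no_types, lifting) card.empty CollectD equals0I zero_neq_numeral)
  have "\<exists>c. inj_on c (uverts base) \<and> (\<forall>v\<in>uverts base. c v \<in> uedges base \<and> v \<in> c v)"
  proof (rule injective_edge_choice[OF simple_base e0])
    show "2 \<le> card (edges_between base X Y)"
      if "X \<union> Y = uverts base" "X \<inter> Y = {}" "X \<noteq> {}" "Y \<noteq> {}" for X Y
      using cut[OF that] by linarith
  qed
  then obtain c where c: "inj_on c (uverts base)" "\<And>v. v \<in> uverts base \<Longrightarrow> c v \<in> uedges base \<and> v \<in> c v" by blast
  have "planar base"
    by (rule D.planar_of_line_graph_decorated[OF _ c]) (use planar_L GD in simp_all)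
  then show ?thesis using con unfolding three_polytope_def by blast
qed

end

subsection \<open>The characterization\<close>

theorem theorem1p1:
  fixes G :: "'a ugraph"
  assumes "simple_graph G"
    and no_isolated: "\<forall>v\<in>uverts G. vdegree G v \<noteq> 0"
    and "\<not> exceptional G"
  shows "three_polytope (line_graph G) \<longleftrightarrow>
    (\<exists>H K. simple_graph H \<and> cubic H \<and> three_polytope H \<and>
       subdivides_edges_at_most_once H K \<and> adds_pendants_at_degree_3 K G)"
proof
  assume "three_polytope (line_graph G)"
  then interpret polyhedral_line_graph G
    using assms unfolding three_polytope_def by unfold_locales auto
  show "\<exists>H K. simple_graph H \<and> cubic H \<and> three_polytope H \<and>
       subdivides_edges_at_most_once H K \<and> adds_pendants_at_degree_3 K G"
    using simple_base cubic_base three_polytope_base subdivides_base adds_pendants_core by blast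
next
  assume "\<exists>H K. simple_graph H \<and> cubic H \<and> three_polytope H \<and>
       subdivides_edges_at_most_once H K \<and> adds_pendants_at_degree_3 K G"
  then obtain H where H: "simple_graph H" "cubic H" "three_polytope H"
    and K: "\<exists>K. subdivides_edges_at_most_once H K \<and> adds_pendants_at_degree_3 K G" by blast
  from K obtain S z U l where D: "decorated_graph H S z U l" and G: "G = decorated_graph.decorated H S z U l"
    unfolding subdivides_then_pendants_iff[OF H(1,2)] by blast
  interpret decorated_graph H S z U l by (rule D)
  show "three_polytope (line_graph G)"
    using H planar_line_graph_decorated line_graph_decorated_3_connected
    unfolding three_polytope_def G by blast
qed

end
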